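(* Let $\bm C\in\mathbb S^d_{++}$, $\bm A=[\bm a_1,\dots,\bm a_n]\in\mathbb R^{d\times n}$, let $s$ be a positive integer with $s<n$, $\bar s:=\min\{s,n-s\}$, $\sigma_{\max}:=\max_{i\in[n]}\bm a_i^\top\bm C^{-1}\bm a_i$, and $$z^*:=\max_{S\subseteq[n],\,|S|=s}\log\det\Big(\bm C+\sum_{i\in S}\bm a_i\bm a_i^\top\Big).$$ Then the continuous-relaxation values $\hat z_R,\hat z_M,\hat z_M^c$ defined in the context satisfy $$z^*\le\hat z_R\le z^*+n\log\Big(1+\frac{\bar s\,\sigma_{\max}^2}{n(1+\sigma_{\max})}\Big),$$ $$z^*\le\hat z_M\le z^*+s\log\Big(s-\frac{s-1}{s}(2s-n)_+\Big),$$ $$z^*\le\hat z_M^c\le z^*+(n-s)\log\Big(n-s-\frac{n-s-1}{n-s}(n-2s)_+\Big).$$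
   Context: $[n]=\{1,\dots,n\}$; $(t)_+=\max\{t,0\}$; $\mathbb S^d_{++}$ is the set of symmetric positive-definite $d\times d$ matrices. Put $\bm b_i:=\bm C^{-1/2}\bm a_i$ (positive-definite square root), $\bm B:=[\bm b_1,\dots,\bm b_n]$; let $\bm I_n+\bm B^\top\bm B=\bm V^\top\bm V$ and $(\bm I_n+\bm B^\top\bm B)^{-1}=\bm W^\top\bm W$ be Cholesky factorizations, with $i$-th columns $\bm v_i$ and $\bm w_i$. For $1\le r\le n$ and a symmetric positive-semidefinite $n\times n$ matrix $\bm X$ with eigenvalues $\lambda_1\ge\cdots\ge\lambda_n\ge0$, $f_r(\bm X)=\prod_{i=1}^k\lambda_i\cdot\big(\frac1{r-k}\sum_{i=k+1}^n\lambda_i\big)^{r-k}$, where $k$ is the unique integer with $0\le k<r$ and $\lambda_k>\frac1{r-k}\sum_{i=k+1}^n\lambda_i\ge\lambda_{k+1}$ ($\lambda_0=+\infty$). $\hat z_R:=\log\det\bm C+\max\{\log\det(\bm I_d+\sum_i x_i\bm b_i\bm b_i^\top):\bm x\in[0,1]^n,\sum_i x_i=s\}$. $\hat z_M:=\log\det\bm C+\max\{\log f_s(\sum_i x_i\bm v_i\bm v_i^\top):\bm x\in[0,1]^n,\sum_i x_i=s\}$. $\hat z_M^c:=\log\det(\bm C+\bm A\bm A^\top)+\max\{\log f_{n-s}(\sum_i x_i\bm w_i\bm w_i^\top):\bm x\in[0,1]^n,\sum_i x_i=n-s\}$. *)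

theory Defs
  imports
    Complex_Main
    "HOL-Library.Multiset"
    "Jordan_Normal_Form.Char_Poly"
    "Jordan_Normal_Form.Gauss_Jordan_Elimination"
begin

text \<open>Columns of an \<open>m \<times> n\<close> matrix are indexed by \<open>{0..<n}\<close>, which plays the role of
  \<open>{1, \<dots>, n}\<close>.\<close>

definition pos_def_mat :: "real mat \<Rightarrow> bool" where
  "pos_def_mat M \<longleftrightarrow> square_mat M \<and> M\<^sup>T = M \<and>
     (\<forall>v \<in> carrier_vec (dim_row M). v \<noteq> 0\<^sub>v (dim_row M) \<longrightarrow> 0 < v \<bullet> (M *\<^sub>v v))"

text \<open>On positive-definite matrices \<^const>\<open>mat_inverse\<close> never returns \<^const>\<open>None\<close>.\<close>

definition inv_mat :: "real mat \<Rightarrow> real mat" where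
  "inv_mat M = the (mat_inverse M)"

definition pd_sqrt :: "real mat \<Rightarrow> real mat" where
  "pd_sqrt M = (THE R. R \<in> carrier_mat (dim_row M) (dim_row M) \<and> pos_def_mat R \<and> R * R = M)"

text \<open>The matrix \<open>B\<close> with columns \<open>b\<^sub>i = C\<^bsup>-1/2\<^esup> a\<^sub>i\<close>.\<close>

definition whitened :: "real mat \<Rightarrow> real mat \<Rightarrow> real mat" where
  "whitened C A = pd_sqrt (inv_mat C) * A"

definition is_cholesky :: "real mat \<Rightarrow> real mat \<Rightarrow> bool" where
  "is_cholesky V M \<longleftrightarrow> V \<in> carrier_mat (dim_row M) (dim_row M) \<and> upper_triangular V \<and>
     (\<forall>i < dim_row M. 0 < V $$ (i, i)) \<and> V\<^sup>T * V = M"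

text \<open>\<open>\<Sum>i\<in>I. x\<^sub>i m\<^sub>i m\<^sub>i\<^sup>T\<close>, where \<open>m\<^sub>i\<close> is the \<open>i\<close>-th column of \<open>M\<close>.\<close>

definition outer_sum :: "real mat \<Rightarrow> nat set \<Rightarrow> (nat \<Rightarrow> real) \<Rightarrow> real mat" where
  "outer_sum M I x = mat (dim_row M) (dim_row M)
     (\<lambda>(p, q). \<Sum>i\<in>I. x i * (col M i $ p) * (col M i $ q))"

text \<open>Eigenvalues \<open>\<lambda>\<^sub>1 \<ge> \<dots> \<ge> \<lambda>\<^sub>n\<close> with algebraic multiplicity, numbered from 1. A real symmetric
  \<open>n \<times> n\<close> matrix has exactly \<open>n\<close> real roots of its characteristic polynomial.\<close>

definition eig :: "real mat \<Rightarrow> nat \<Rightarrow> real" where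
  "eig X i = rev (sorted_list_of_multiset (proots (char_poly X))) ! (i - 1)"

definition tail_mean :: "nat \<Rightarrow> real mat \<Rightarrow> nat \<Rightarrow> real" where
  "tail_mean r X k = (\<Sum>i = k + 1..dim_row X. eig X i) / (real r - real k)"

text \<open>The disjunct \<open>k = 0\<close> encodes the convention \<open>\<lambda>\<^sub>0 = +\<infinity>\<close>.\<close>

definition split_index :: "nat \<Rightarrow> real mat \<Rightarrow> nat" where
  "split_index r X = (THE k. k < r \<and> (k = 0 \<or> eig X k > tail_mean r X k) \<and>
     tail_mean r X k \<ge> eig X (k + 1))"

definition f_spec :: "nat \<Rightarrow> real mat \<Rightarrow> real" where
  "f_spec r X = (let k = split_index r X in
     (\<Prod>i = 1..k. eig X i) * tail_mean r X k ^ (r - k))"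

definition capped_simplex :: "nat \<Rightarrow> nat \<Rightarrow> real vec set" where
  "capped_simplex n r = {x \<in> carrier_vec n. (\<forall>i < n. 0 \<le> x $ i \<and> x $ i \<le> 1) \<and>
     (\<Sum>i < n. x $ i) = real r}"

text \<open>An attained maximum over a possibly infinite set.\<close>

definition max_on :: "'a set \<Rightarrow> ('a \<Rightarrow> real) \<Rightarrow> real" where
  "max_on K g = (GREATEST t. t \<in> g ` K)"

definition sigma_max :: "real mat \<Rightarrow> real mat \<Rightarrow> real" where
  "sigma_max C A = Max ((\<lambda>i. col A i \<bullet> (inv_mat C *\<^sub>v col A i)) ` {0..<dim_col A})"

definition z_opt :: "real mat \<Rightarrow> real mat \<Rightarrow> nat \<Rightarrow> real" where
  "z_opt C A s = Max ((\<lambda>S. ln (det (C + outer_sum A S (\<lambda>_. 1)))) `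
     {S. S \<subseteq> {0..<dim_col A} \<and> card S = s})"

definition z_R :: "real mat \<Rightarrow> real mat \<Rightarrow> nat \<Rightarrow> real" where
  "z_R C A s = ln (det C) + max_on (capped_simplex (dim_col A) s)
     (\<lambda>x. ln (det (1\<^sub>m (dim_row A) + outer_sum (whitened C A) {0..<dim_col A} (($) x))))"

text \<open>In \<open>z_M\<close> and \<open>z_Mc\<close> the argument of \<^const>\<open>ln\<close> is positive on the whole feasible set: \<open>V\<close> and
  \<open>W\<close> are invertible and a feasible \<open>x\<close> has at least as many nonzero entries as the order \<open>r\<close> of
  \<open>f_spec r\<close>, so the junk value \<open>ln 0 = 0\<close> plays no role.\<close>

definition z_M :: "real mat \<Rightarrow> real mat \<Rightarrow> nat \<Rightarrow> real" where
  "z_M C V s = ln (det C) + max_on (capped_simplex (dim_col V) s)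
     (\<lambda>x. ln (f_spec s (outer_sum V {0..<dim_col V} (($) x))))"

definition z_Mc :: "real mat \<Rightarrow> real mat \<Rightarrow> real mat \<Rightarrow> nat \<Rightarrow> real" where
  "z_Mc C A W s = ln (det (C + A * A\<^sup>T)) + max_on (capped_simplex (dim_col W) (dim_col W - s))
     (\<lambda>x. ln (f_spec (dim_col W - s) (outer_sum W {0..<dim_col W} (($) x))))"

end

theory Submission
  imports Defs
begin

text \<open>After whitening, everything is expressed through \<open>K = I + B\<^sup>T B\<close>: the objective at \<open>S\<close> is \<open>ln (det C)\<close>
  plus the logarithm of the principal minor of \<open>K\<close> at \<open>S\<close>, which Jacobi's identity turns into the
  complementary minor of \<open>K\<^sup>-\<^sup>1\<close>. So \<open>z_M\<close> and \<open>z_Mc\<close> are instances of one relaxation, of maximising a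
  principal minor of a Gram matrix \<open>V\<^sup>T V\<close>.

  For \<open>\<Lambda>\<close> positive definite with \<open>\<Lambda> \<le> \<sigma> I\<close>, Hadamard's inequality and \<open>ln t \<le> t - 1\<close> give
  \<open>ln (f_spec r X) \<le> tr (X \<Lambda>) - r - ln (det \<Lambda>) + (n - r) ln \<sigma>\<close>, with equality for a suitable \<open>\<Lambda>\<close>.
  The right-hand side is affine in \<open>X\<close>, so maxima are attained. For an optimal \<open>S\<close>, with \<open>w\<^sub>i\<close> the basis
  dual to the \<open>v\<^sub>i\<close> (\<open>i \<in> S\<close>), \<open>P\<close> the projection onto their span and \<open>\<sigma> = \<Sum> |w\<^sub>i|\<^sup>2\<close>, the certificate
  \<open>\<Lambda> = \<Sum> w\<^sub>i w\<^sub>i\<^sup>T + \<sigma> (I - P)\<close> satisfies \<open>v\<^sub>i\<^sup>T \<Lambda> v\<^sub>i = 1\<close> for \<open>i \<in> S\<close>; and \<open>v\<^sub>j\<^sup>T \<Lambda> v\<^sub>j \<le> r\<close> for \<open>j \<notin> S\<close>,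
  because no exchange of \<open>i\<close> for \<open>j\<close> increases the minor. Rescaling \<open>\<Lambda>\<close> gives the upper bounds. For \<open>z_R\<close>
  the same scheme uses \<open>ln det N \<le> tr N - n\<close> and bounds on the leverages.\<close>

section \<open>Traces and determinants\<close>

text \<open>Two obstacles shape the development. Minors live on submatrices of varying size;
  \<open>pminor\<close> pads them with the identity to size \<open>n\<close>, so that Sylvester's
  identity replaces all reindexing and an exchange becomes a rank-two update. And
  \<open>f_spec\<close> is piecewise, through \<open>split_index\<close>: neither its concavity nor
  its continuity is proved, since the dual inequality together with its attainment supplies
  everything, even the lower bound, without computing an eigenvalue. The choice of
  \<open>\<sigma>\<close> serves two ends. As the trace of
  \<open>\<Sum> w\<^sub>i w\<^sub>i\<^sup>T\<close> it bounds the largest eigenvalue of that sum,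
  whence \<open>\<Lambda> \<le> \<sigma> I\<close>. And exchanging \<open>i\<close> for
  \<open>j\<close> multiplies the minor by the squared coordinate of \<open>P v\<^sub>j\<close>
  along \<open>v\<^sub>i\<close> plus \<open>|w\<^sub>i|\<^sup>2\<close> times the squared distance
  of \<open>v\<^sub>j\<close> from the span; summed over \<open>i\<close>, these factors are exactly
  \<open>v\<^sub>j\<^sup>T \<Lambda> v\<^sub>j\<close>. A feasible \<open>x\<close> has weight at
  most \<open>min r (n - r)\<close> outside \<open>S\<close>, so the trace is at most
  \<open>r + (r - 1) min r (n - r)\<close>; divided by \<open>r\<close>, this is the argument of the
  logarithm in the bounds.\<close>

definition mtrace :: "real mat \<Rightarrow> real" where
  "mtrace A = (\<Sum>i<dim_row A. A $$ (i, i))"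

lemma mtrace_mult:
  assumes "A \<in> carrier_mat n m" "B \<in> carrier_mat m n"
  shows "mtrace (A * B) = (\<Sum>i<n. \<Sum>j<m. A $$ (i, j) * B $$ (j, i))"
  using assms by (auto simp: mtrace_def scalar_prod_def lessThan_atLeast0 intro!: sum.cong)

lemma mtrace_mult_comm:
  assumes "A \<in> carrier_mat n m" "B \<in> carrier_mat m n"
  shows "mtrace (A * B) = mtrace (B * A)"
  unfolding mtrace_mult[OF assms] mtrace_mult[OF assms(2,1)]
  by (subst sum.swap) (simp add: mult.commute)

lemma mtrace_add:
  assumes "A \<in> carrier_mat n n" "B \<in> carrier_mat n n"
  shows "mtrace (A + B) = mtrace A + mtrace B"
  using assms by (auto simp: mtrace_def sum.distrib)

lemma mtrace_minus:
  assumes "A \<in> carrier_mat n n" "B \<in> carrier_mat n n"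
  shows "mtrace (A - B) = mtrace A - mtrace B"
  using assms by (auto simp: mtrace_def sum_subtractf)

lemma mtrace_smult:
  assumes "A \<in> carrier_mat n n"
  shows "mtrace (c \<cdot>\<^sub>m A) = c * mtrace A"
  using assms by (auto simp: mtrace_def sum_distrib_left)

lemma mtrace_one [simp]: "mtrace (1\<^sub>m n) = real n"
  by (simp add: mtrace_def)

lemma mtrace_diag [simp]: "mtrace (mat_diag n x) = (\<Sum>i<n. x i)"
  by (simp add: mtrace_def mat_diag_def)

lemma mtrace_diag_mult:
  assumes "A \<in> carrier_mat n n"
  shows "mtrace (mat_diag n x * A) = (\<Sum>i<n. x i * A $$ (i, i))"
  using assms by (simp add: mtrace_def mat_diag_mult_left)

text \<open>Sylvester's identity. The unimodular \<open>?U\<close> clears the upper right block of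
  \<open>?L\<close> from either side, and the two products carry the two determinants on their
  diagonals.\<close>

lemma det_one_plus_mult_comm:
  fixes A B :: "'a :: idom mat"
  assumes A: "A \<in> carrier_mat n m" and B: "B \<in> carrier_mat m n"
  shows "det (1\<^sub>m n + A * B) = det (1\<^sub>m m + B * A)"
proof -
  let ?L = "four_block_mat (1\<^sub>m n) (- A) B (1\<^sub>m m)"
  let ?U = "four_block_mat (1\<^sub>m n) A (0\<^sub>m m n) (1\<^sub>m m)"
  have L: "?L \<in> carrier_mat (n + m) (n + m)" and U: "?U \<in> carrier_mat (n + m) (n + m)"
    using A B by auto
  have dU: "det ?U = 1"
    using A by (subst det_four_block_mat_lower_left_zero[of _ n _ m]) auto
  have "?L * ?U = four_block_mat (1\<^sub>m n) (0\<^sub>m n m) B (1\<^sub>m m + B * A)"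
    using A B by (subst mult_four_block_mat[of _ n n _ m _ m _ _ n _ m])
       (auto simp: right_add_zero_mat uminus_l_inv_mat comm_add_mat[of "B * A" m m])
  then have "det (?L * ?U) = det (1\<^sub>m m + B * A)"
    using A B by (simp, subst det_four_block_mat_upper_right_zero[of _ n _ m]) auto
  moreover have "?U * ?L = four_block_mat (1\<^sub>m n + A * B) (0\<^sub>m n m) B (1\<^sub>m m)"
    using A B by (subst mult_four_block_mat[of _ n n _ m _ m _ _ n _ m])
       (auto simp: uminus_l_inv_mat comm_add_mat[of "A * B" n n])
  then have "det (?U * ?L) = det (1\<^sub>m n + A * B)"
    using A B by (simp, subst det_four_block_mat_upper_right_zero[of _ n _ m]) auto
  ultimately show ?thesis
    using det_mult[OF L U] det_mult[OF U L] dU by simp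
qed

lemma det_2x2:
  fixes A :: "'a :: idom mat"
  assumes A: "A \<in> carrier_mat 2 2"
  shows "det A = A $$ (0,0) * A $$ (1,1) - A $$ (0,1) * A $$ (1,0)"
proof -
  let ?m = "\<lambda>a. mat 1 1 (\<lambda>_. a) :: 'a mat"
  have eq: "A = four_block_mat (?m (A $$ (0,0))) (?m (A $$ (0,1))) (?m (A $$ (1,0))) (?m (A $$ (1,1)))"
    (is "_ = ?F")
  proof (rule eq_matI)
    fix i j assume ij: "i < dim_row ?F" "j < dim_col ?F"
    then have "i = 0 \<or> i = 1" "j = 0 \<or> j = 1" by auto
    then show "A $$ (i, j) = ?F $$ (i, j)" using A by auto
  qed (use A in auto)
  have "det ?F = det (?m (A $$ (0,0)) * ?m (A $$ (1,1)) - ?m (A $$ (0,1)) * ?m (A $$ (1,0)))"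
    by (rule det_four_block_mat[of _ 1]) (auto simp: scalar_prod_def mult.commute)
  also have "\<dots> = A $$ (0,0) * A $$ (1,1) - A $$ (0,1) * A $$ (1,0)"
    by (subst det_single) (auto simp: scalar_prod_def)
  finally show ?thesis using eq by simp
qed

lemma mult_mat_diag_index [simp]:
  "A \<in> carrier_mat m n \<Longrightarrow> i < m \<Longrightarrow> j < n \<Longrightarrow> (A * mat_diag n x) $$ (i, j) = A $$ (i, j) * x j"
  by (simp add: mat_diag_mult_right)

lemma mat_diag_mult_index [simp]:
  "A \<in> carrier_mat n m \<Longrightarrow> i < n \<Longrightarrow> j < m \<Longrightarrow> (mat_diag n x * A) $$ (i, j) = x i * A $$ (i, j)"
  by (simp add: mat_diag_mult_left)

lemma mat_diag_index [simp]:
  "i < n \<Longrightarrow> j < n \<Longrightarrow> mat_diag n x $$ (i, j) = (if i = j then x j else 0)"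
  by (simp add: mat_diag_def)

lemma transpose_mat_diag [simp]: "(mat_diag n x)\<^sup>T = mat_diag n x"
  by (auto simp: mat_diag_def)

lemma mat_diag_dims [simp]: "dim_row (mat_diag n x) = n" "dim_col (mat_diag n x) = n"
  by (auto simp: mat_diag_def)

lemma det_mat_diag [simp]: "det (mat_diag n x) = (\<Prod>i<n. x i)"
  by (subst det_upper_triangular[of _ n])
     (auto simp: upper_triangular_def prod_list_diag_prod lessThan_atLeast0 intro!: prod.cong)

section \<open>Square matrices of fixed size and coordinate projections\<close>

locale square_dim =
  fixes n :: nat
begin

abbreviation I where "I \<equiv> 1\<^sub>m n :: real mat"
abbreviation M\<^sub>n where "M\<^sub>n \<equiv> carrier_mat n n :: real mat set"

definition ind :: "nat set \<Rightarrow> real mat" where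
  "ind S = mat_diag n (\<lambda>i. if i \<in> S then 1 else 0)"

lemma ind_carrier [simp]: "ind S \<in> carrier_mat n n"
  by (simp add: ind_def)

lemma ind_dims [simp]: "dim_row (ind S) = n" "dim_col (ind S) = n"
  by (simp_all add: ind_def)

lemma transpose_ind [simp]: "(ind S)\<^sup>T = ind S"
  by (simp add: ind_def)

lemma ind_idem [simp]: "ind S * ind S = ind S"
  by (simp add: ind_def if_distrib cong: if_cong)

lemmas sq_carrier [simp] = mult_carrier_mat[of _ n n _ n] add_carrier_mat[of _ n n]
  minus_carrier_mat[of _ n n] smult_carrier_mat[of _ n n]

lemmas sq_simps = assoc_mult_mat[of _ n n _ n _ n]
  add_mult_distrib_mat[of _ n n _ _ n] mult_add_distrib_mat[of _ n n _ n]
  minus_mult_distrib_mat[of _ n n _ _ n] mult_minus_distrib_mat[of _ n n _ n]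
  mult_smult_distrib[of _ n n _ n] mult_smult_assoc_mat[of _ n n _ n]
  left_mult_one_mat[of _ n n] right_mult_one_mat[of _ n n]

lemma entries_eqI:
  assumes "A \<in> carrier_mat n n" "B \<in> carrier_mat n n"
    and "\<And>i j. i < n \<Longrightarrow> j < n \<Longrightarrow> A $$ (i, j) = B $$ (i, j)"
  shows "A = B"
  using assms by auto

lemma left_inverse_imp_right_inverse:
  assumes "A \<in> carrier_mat n n" "B \<in> carrier_mat n n" "A * B = I"
  shows "B * A = I"
  using mat_mult_left_right_inverse[OF assms] .

lemma inverse_exists:
  assumes "A \<in> M\<^sub>n" "det A \<noteq> 0"
  obtains B where "B \<in> carrier_mat n n" "A * B = I" "B * A = I"
proof -
  have "A \<in> Units (ring_mat TYPE(real) n ())"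
    using det_non_zero_imp_unit[OF assms] .
  then show thesis using that by (auto simp: Units_def ring_mat_simps)
qed

lemma det_mult_inverse:
  assumes "A \<in> M\<^sub>n" "B \<in> M\<^sub>n" "A * B = I"
  shows "det A * det B = 1"
  using det_mult[OF assms(1,2)] assms(3) by simp

text \<open>Swapping \<open>i\<close> for \<open>j\<close> changes \<open>ind S\<close> by a matrix
  \<open>K\<close> of rank two. The equation for \<open>N\<close> lets the updated matrix factor as
  \<open>(I + K * N) * (I + ind S * Q)\<close>, and Sylvester's identity shrinks the first
  determinant to size 2.\<close>

lemma det_exchange:
  assumes Q: "Q \<in> M\<^sub>n" and N: "N \<in> M\<^sub>n"
    and eq: "N * (I + ind S * Q) = Q" and i: "i \<in> S" "i < n" and j: "j \<notin> S" "j < n"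
  shows "det (I + ind (insert j (S - {i})) * Q) =
    det (I + ind S * Q) * ((1 - N $$ (i,i)) * (1 + N $$ (j,j)) + N $$ (i,j) * N $$ (j,i))"
proof -
  have ij: "i \<noteq> j" using i j by auto
  \<comment> \<open>The columns \<open>- e_i\<close>, \<open>e_j\<close> of \<open>P\<close> and the
    rows \<open>i\<close>, \<open>j\<close> of \<open>N\<close> in \<open>R\<close> factor
    \<open>K * N\<close> through dimension 2.\<close>
  define P where "P = mat n 2 (\<lambda>(k, c). if c = 0 then (if k = i then - 1 else 0)
    else (if k = j then 1 else 0) :: real)"
  define R where "R = mat 2 n (\<lambda>(c, k). if c = 0 then N $$ (i, k) else N $$ (j, k))"
  have P: "P \<in> carrier_mat n 2" and R: "R \<in> carrier_mat 2 n" by (auto simp: P_def R_def)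
  define K where "K = mat_diag n (\<lambda>k. if k = j then 1 else if k = i then - 1 else 0 :: real)"
  have K: "K \<in> M\<^sub>n" by (simp add: K_def)
  have T: "ind (insert j (S - {i})) = ind S + K"
    unfolding ind_def K_def using i j by (intro eq_matI) auto
  have PR: "P * R = K * N"
    using N by (intro entries_eqI)
      (auto simp: P_def R_def K_def scalar_prod_def numeral_2_eq_2 ij mat_diag_mult_left)
  have "I + ind (insert j (S - {i})) * Q = I + ind S * Q + K * Q"
    using Q K by (simp add: T sq_simps assoc_add_mat[of _ n n])
  also have "\<dots> = (I + K * N) * (I + ind S * Q)"
  proof -
    have "K * Q = K * N + K * (N * (ind S * Q))"
      using Q K N by (subst eq[symmetric]) (simp add: sq_simps)
    then show ?thesis using Q K N
      by (intro entries_eqI) (simp_all add: sq_simps del: index_mult_mat(1))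
  qed
  finally have "det (I + ind (insert j (S - {i})) * Q) = det (I + K * N) * det (I + ind S * Q)"
    using Q K N by (simp add: det_mult[of _ n])
  also have "det (I + K * N) = det (1\<^sub>m 2 + R * P)"
    using det_one_plus_mult_comm[OF P R] PR by simp
  also have "\<dots> = (1 - N $$ (i,i)) * (1 + N $$ (j,j)) + N $$ (i,j) * N $$ (j,i)"
    using P R i j ij by (subst det_2x2)
      (auto simp: P_def R_def scalar_prod_def if_distrib[of "\<lambda>x. _ * x"] sum.delta cong: if_cong)
  finally show ?thesis by simp
qed

end

section \<open>The spectral theorem for real symmetric matrices\<close>

text \<open>The reflection that swaps \<open>e_0\<close> and \<open>v\<close> has \<open>v\<close>
  as its first column. It reflects along \<open>v - e_0\<close>, which vanishes for
  \<open>v = e_0\<close>; hence the separate case.\<close>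

lemma householder:
  fixes v :: "real vec"
  assumes v: "v \<in> carrier_vec (Suc m)" and unit: "v \<bullet> v = 1"
  obtains U where "U \<in> carrier_mat (Suc m) (Suc m)" "U\<^sup>T * U = 1\<^sub>m (Suc m)" "col U 0 = v"
proof (cases "v = unit_vec (Suc m) 0")
  case True
  then show thesis by (intro that[of "1\<^sub>m (Suc m)"]) auto
next
  case False
  define n where "n = Suc m"
  have n0: "0 < n" by (simp add: n_def)
  define w where "w = (\<lambda>i. v $ i - (if i = 0 then 1 else 0))"
  define W where "W = (\<Sum>k<n. w k * w k)"
  define U where "U = mat n n (\<lambda>(i, j). (if i = j then 1 else 0) - 2 / W * w i * w j)"
  have sv: "(\<Sum>k<n. v $ k * v $ k) = 1"
    using unit v unfolding scalar_prod_def n_def by (simp only: carrier_vecD lessThan_atLeast0)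
  have "W = (\<Sum>k<n. v $ k * v $ k + (if k = 0 then 1 - 2 * v $ 0 else 0))"
    unfolding W_def w_def by (intro sum.cong) (auto simp: algebra_simps)
  also have "\<dots> = 2 - 2 * v $ 0"
    using n0 by (simp add: sum.distrib sv sum.delta)
  finally have W: "W = - 2 * w 0" by (simp add: w_def)
  have "W \<noteq> 0"
  proof
    assume "W = 0"
    then have "\<forall>k<n. w k = 0"
      unfolding W_def by (subst (asm) sum_nonneg_eq_0_iff) auto
    then have "v = unit_vec (Suc m) 0"
      using v by (intro eq_vecI) (auto simp: w_def n_def unit_vec_def split: if_splits)
    with False show False by simp
  qed
  have U: "U \<in> carrier_mat n n" by (simp add: U_def)
  have "U\<^sup>T * U = 1\<^sub>m n"
  proof (rule eq_matI)
    fix i j assume ij: "i < dim_row (1\<^sub>m n)" "j < dim_col (1\<^sub>m n)"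
    then have "(U\<^sup>T * U) $$ (i, j) = (\<Sum>k<n. U $$ (k, i) * U $$ (k, j))"
      using U by (simp add: scalar_prod_def lessThan_atLeast0)
    also have "\<dots> = (\<Sum>k<n. (if k = i then (if k = j then 1 else 0) - 2 / W * w i * w j else 0)
        - (if k = j then 2 / W * w i * w j else 0) + (2 / W)\<^sup>2 * w i * w j * (w k * w k))"
      using ij by (intro sum.cong) (auto simp: U_def algebra_simps power2_eq_square)
    also have "\<dots> = (if i = j then 1 else 0) - 2 * (2 / W * w i * w j) + (2 / W)\<^sup>2 * w i * w j * W"
      using ij by (simp add: sum.distrib sum_subtractf sum.delta flip: sum_distrib_left W_def)
    also have "\<dots> = (if i = j then 1 else 0)"
      using \<open>W \<noteq> 0\<close> by (simp add: power2_eq_square field_simps)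
    finally show "(U\<^sup>T * U) $$ (i, j) = 1\<^sub>m n $$ (i, j)" using ij by simp
  qed (use U in auto)
  moreover have "col U 0 = v"
  proof (rule eq_vecI)
    fix i assume "i < dim_vec v"
    then have i: "i < n" using v by (simp add: n_def)
    then have "col U 0 $ i = (if i = 0 then 1 else 0) - 2 / W * w i * w 0"
      by (simp add: U_def n_def)
    also have "\<dots> = (if i = 0 then 1 else 0) + w i"
      using W \<open>W \<noteq> 0\<close> by (simp add: field_simps)
    finally show "col U 0 $ i = v $ i" by (simp add: w_def)
  qed (use U v in \<open>auto simp: n_def\<close>)
  ultimately show thesis using U that unfolding n_def by blast
qed

text \<open>A complex root of the characteristic polynomial gives a complex eigenvector
  \<open>u\<close>. Symmetry makes its Hermitian form real, hence also the eigenvalue; then the real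
  and imaginary parts of \<open>u\<close> are each an eigenvector or zero.\<close>

lemma real_symmetric_eigenvector:
  fixes A :: "real mat"
  assumes A: "A \<in> carrier_mat (Suc m) (Suc m)" and sym: "A\<^sup>T = A"
  obtains e v where "v \<in> carrier_vec (Suc m)" "v \<bullet> v = 1" "A *\<^sub>v v = e \<cdot>\<^sub>v v"
proof -
  define n where "n = Suc m"
  have A: "A \<in> carrier_mat n n" using A by (simp add: n_def)
  have Asym: "A $$ (i, j) = A $$ (j, i)" if "i < n" "j < n" for i j
    using index_transpose_mat(1)[of i A j] that A sym by auto
  let ?C = "map_mat complex_of_real A"
  have C: "?C \<in> carrier_mat n n" using A by simp
  obtain as where as: "char_poly ?C = (\<Prod>a\<leftarrow>as. [:- a, 1:])" "length as = n"
    using char_poly_factorized[OF C] by blast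
  then obtain z as' where "as = z # as'" by (cases as) (auto simp: n_def)
  then have "poly (char_poly ?C) z = 0" using as by simp
  then have "eigenvalue ?C z" using eigenvalue_root_char_poly[OF C] by simp
  then obtain u where u: "u \<in> carrier_vec n" "u \<noteq> 0\<^sub>v n" and eq: "?C *\<^sub>v u = z \<cdot>\<^sub>v u"
    unfolding eigenvalue_def eigenvector_def using C by auto
  have eqi: "(\<Sum>j<n. complex_of_real (A $$ (i, j)) * u $ j) = z * u $ i" if "i < n" for i
    using arg_cong[OF eq, of "\<lambda>v. v $ i"] that u(1) A
    by (simp add: scalar_prod_def lessThan_atLeast0)
  let ?s = "\<Sum>i<n. \<Sum>j<n. complex_of_real (A $$ (i, j)) * u $ j * cnj (u $ i)"
  let ?t = "\<Sum>i<n. (cmod (u $ i))\<^sup>2"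
  have s: "?s = z * complex_of_real ?t"
  proof -
    have "?s = (\<Sum>i<n. (\<Sum>j<n. complex_of_real (A $$ (i, j)) * u $ j) * cnj (u $ i))"
      by (simp add: sum_distrib_right)
    also have "\<dots> = (\<Sum>i<n. z * (u $ i * cnj (u $ i)))"
      by (intro sum.cong) (auto simp: eqi mult.assoc)
    finally show ?thesis by (simp add: complex_norm_square sum_distrib_left del: of_real_power)
  qed
  have "cnj ?s = (\<Sum>i<n. \<Sum>j<n. complex_of_real (A $$ (i, j)) * u $ i * cnj (u $ j))"
    by (simp add: mult_ac)
  also have "\<dots> = ?s"
    by (subst sum.swap) (intro sum.cong refl, simp add: Asym)
  finally have "cnj ?s = ?s" .
  from arg_cong[OF this, of Im] have "Im ?s = 0" unfolding cnj.sel by linarith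
  then have "Im z * ?t = 0" unfolding s by simp
  moreover have "?t > 0"
  proof -
    obtain i where "i < n" "u $ i \<noteq> 0"
      using u by (metis carrier_vecD eq_vecI index_zero_vec)
    then show ?thesis by (intro sum_pos2[of _ i]) auto
  qed
  ultimately have z: "Im z = 0" by simp
  have real_ev: "A *\<^sub>v v = Re z \<cdot>\<^sub>v v" if "v = map_vec Re u \<or> v = map_vec Im u" for v
  proof (rule eq_vecI)
    fix i assume "i < dim_vec (Re z \<cdot>\<^sub>v v)"
    then have i: "i < n" using that u by auto
    have "Re z * Re (u $ i) = (\<Sum>j<n. A $$ (i, j) * Re (u $ j))"
      "Re z * Im (u $ i) = (\<Sum>j<n. A $$ (i, j) * Im (u $ j))"
      using eqi[OF i] by (simp_all add: complex_eq_iff z)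
    then show "(A *\<^sub>v v) $ i = (Re z \<cdot>\<^sub>v v) $ i"
      using that i u A by (auto simp: scalar_prod_def lessThan_atLeast0)
  qed (use that u A in auto)
  obtain v where v: "v \<in> carrier_vec n" "v \<noteq> 0\<^sub>v n" "A *\<^sub>v v = Re z \<cdot>\<^sub>v v"
  proof (cases "map_vec Re u = 0\<^sub>v n")
    case False
    then show thesis using real_ev[of "map_vec Re u"] u that[of "map_vec Re u"] by simp
  next
    case True
    have "map_vec Im u \<noteq> 0\<^sub>v n"
    proof
      assume "map_vec Im u = 0\<^sub>v n"
      with True have "\<forall>i<n. Re (u $ i) = 0 \<and> Im (u $ i) = 0"
        using u by (metis carrier_vecD index_map_vec(1) index_zero_vec(1))
      with u show False by (auto simp: vec_eq_iff complex_eq_iff)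
    qed
    then show thesis using real_ev[of "map_vec Im u"] u that[of "map_vec Im u"] by simp
  qed
  have pos: "v \<bullet> v > 0"
  proof -
    obtain i where "i < n" "v $ i \<noteq> 0"
      using v by (metis carrier_vecD eq_vecI index_zero_vec)
    then show ?thesis using v unfolding scalar_prod_def
      by (intro sum_pos2[of _ i]) (auto simp: zero_less_mult_iff linorder_neq_iff)
  qed
  let ?c = "1 / sqrt (v \<bullet> v)"
  show thesis
  proof (rule that)
    show "?c \<cdot>\<^sub>v v \<in> carrier_vec (Suc m)" using v by (simp add: n_def)
    show "(?c \<cdot>\<^sub>v v) \<bullet> (?c \<cdot>\<^sub>v v) = 1" using v pos by simp
    show "A *\<^sub>v (?c \<cdot>\<^sub>v v) = Re z \<cdot>\<^sub>v (?c \<cdot>\<^sub>v v)"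
      using v A by (simp add: mult_mat_vec[of _ n n] smult_smult_assoc mult.commute)
  qed
qed

text \<open>Deflation: an orthogonal matrix whose first column is a unit eigenvector brings
  \<open>A\<close> to block form, symmetry clearing the first row along with the first
  column.\<close>

lemma spectral_theorem:
  fixes A :: "real mat"
  assumes "A \<in> carrier_mat n n" "A\<^sup>T = A"
  shows "\<exists>U d. U \<in> carrier_mat n n \<and> U\<^sup>T * U = 1\<^sub>m n \<and> A = U * mat_diag n d * U\<^sup>T"
  using assms
proof (induction n arbitrary: A)
  case 0
  then show ?case by (intro exI[of _ "1\<^sub>m 0"] exI[of _ "\<lambda>_. 0"]) auto
next
  case (Suc m)
  note A = \<open>A \<in> carrier_mat (Suc m) (Suc m)\<close>
  obtain e v where v: "v \<in> carrier_vec (Suc m)" "v \<bullet> v = 1" "A *\<^sub>v v = e \<cdot>\<^sub>v v"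
    using real_symmetric_eigenvector[OF Suc.prems] .
  obtain U where U: "U \<in> carrier_mat (Suc m) (Suc m)" "U\<^sup>T * U = 1\<^sub>m (Suc m)" "col U 0 = v"
    using householder[OF v(1,2)] .
  interpret square_dim "Suc m" .
  have UU: "U * U\<^sup>T = I" using left_inverse_imp_right_inverse[OF _ U(1,2)] U by simp
  define B where "B = U\<^sup>T * A * U"
  have B: "B \<in> carrier_mat (Suc m) (Suc m)" using A U by (simp add: B_def)
  have Bsym: "B\<^sup>T = B"
    unfolding B_def using A U Suc.prems(2)
    by (simp add: transpose_mult[of _ "Suc m" "Suc m" _ "Suc m"] sq_simps)
  have Bij: "B $$ (i, j) = B $$ (j, i)" if "i < Suc m" "j < Suc m" for i j
    using index_transpose_mat(1)[of i B j] that B Bsym by auto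
  have "col B 0 = U\<^sup>T *\<^sub>v (A *\<^sub>v col U 0)"
    unfolding B_def using A U
    by (simp add: sq_simps col_mult2[of _ "Suc m" "Suc m" _ "Suc m"] del: col_mult)
  also have "\<dots> = e \<cdot>\<^sub>v (U\<^sup>T *\<^sub>v col U 0)"
    using v U by (simp add: mult_mat_vec[of _ "Suc m" "Suc m"])
  also have "U\<^sup>T *\<^sub>v col U 0 = col (U\<^sup>T * U) 0"
    using U(1) by (subst col_mult2[of _ "Suc m" "Suc m" _ "Suc m"]) auto
  finally have colB: "col B 0 = e \<cdot>\<^sub>v unit_vec (Suc m) 0" using U by simp
  have B0: "B $$ (i, 0) = (if i = 0 then e else 0)" if "i < Suc m" for i
    using arg_cong[OF colB, of "\<lambda>v. v $ i"] that B by auto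
  define B' where "B' = mat m m (\<lambda>(i, j). B $$ (Suc i, Suc j))"
  have B': "B' \<in> carrier_mat m m" by (simp add: B'_def)
  have "B'\<^sup>T = B'" by (rule eq_matI) (auto simp: B'_def Bij)
  from Suc.IH[OF B' this] obtain U' d where
    U': "U' \<in> carrier_mat m m" "U'\<^sup>T * U' = 1\<^sub>m m" and B'eq: "B' = U' * mat_diag m d * U'\<^sup>T"
    by blast
  define Z where "Z = four_block_mat (1\<^sub>m 1) (0\<^sub>m 1 m) (0\<^sub>m m 1) U'"
  have Z: "Z \<in> carrier_mat (Suc m) (Suc m)" 
    unfolding Z_def using four_block_carrier_mat[of "1\<^sub>m 1" 1 1 U' m m] U' by simp
  have ZT: "Z\<^sup>T = four_block_mat (1\<^sub>m 1) (0\<^sub>m 1 m) (0\<^sub>m m 1) U'\<^sup>T"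
    unfolding Z_def using U' by (subst transpose_four_block_mat[of _ 1 1 _ m _ m]) auto
  define d' where "d' = (\<lambda>i. case i of 0 \<Rightarrow> e | Suc i \<Rightarrow> d i)"
  have D: "mat_diag (Suc m) d' = four_block_mat (mat_diag 1 (\<lambda>_. e)) (0\<^sub>m 1 m) (0\<^sub>m m 1) (mat_diag m d)"
    by (rule eq_matI) (auto simp: d'_def split: nat.splits)
  have ZZ: "Z\<^sup>T * Z = 1\<^sub>m (Suc m)"
    unfolding ZT unfolding Z_def using U'
    by (subst mult_four_block_mat[of _ 1 1 _ m _ m _ _ 1 _ m]) (auto simp: four_block_one_mat[of 1 m, simplified])
  have "Z * mat_diag (Suc m) d' * Z\<^sup>T =
      four_block_mat (mat_diag 1 (\<lambda>_. e)) (0\<^sub>m 1 m) (0\<^sub>m m 1) B'"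
  proof -
    have "Z * mat_diag (Suc m) d' = four_block_mat (mat_diag 1 (\<lambda>_. e)) (0\<^sub>m 1 m) (0\<^sub>m m 1) (U' * mat_diag m d)"
      unfolding D Z_def using U'
      by (subst mult_four_block_mat[of _ 1 1 _ m _ m _ _ 1 _ m]) auto
    then show ?thesis
      unfolding ZT B'eq using U'
      by (simp, subst mult_four_block_mat[of _ 1 1 _ m _ m _ _ 1 _ m]) auto
  qed
  also have "\<dots> = B"
  proof (rule eq_matI)
    fix i j assume "i < dim_row B" "j < dim_col B"
    then have ij: "i < Suc m" "j < Suc m" using B by auto
    then show "four_block_mat (mat_diag 1 (\<lambda>_. e)) (0\<^sub>m 1 m) (0\<^sub>m m 1) B' $$ (i, j) = B $$ (i, j)"
      using B0[of i] B0[of j] Bij[of 0 j] by (auto simp: B'_def)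
  qed (use B in \<open>auto simp: B'_def\<close>)
  finally have ZDZ: "B = Z * mat_diag (Suc m) d' * Z\<^sup>T" ..
  have "A = I * A * I" using A by simp
  also have "\<dots> = U * B * U\<^sup>T"
    unfolding UU[symmetric] B_def using A U by (simp add: sq_simps del: UU)
  also have "\<dots> = (U * Z) * mat_diag (Suc m) d' * (U * Z)\<^sup>T"
    unfolding ZDZ using U(1) Z
    by (simp add: transpose_mult[of _ "Suc m" "Suc m" _ "Suc m"] sq_simps)
  finally have "A = (U * Z) * mat_diag (Suc m) d' * (U * Z)\<^sup>T" .
  moreover have "(U * Z)\<^sup>T * (U * Z) = I"
  proof -
    have "(U * Z)\<^sup>T * (U * Z) = Z\<^sup>T * ((U\<^sup>T * U) * Z)"
      using U(1) Z by (simp add: transpose_mult[of _ "Suc m" "Suc m" _ "Suc m"] sq_simps)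
    then show ?thesis using U ZZ Z by simp
  qed
  moreover have "U * Z \<in> carrier_mat (Suc m) (Suc m)" using U Z by simp
  ultimately show ?case by blast
qed

section \<open>Orthogonal diagonalisation with ordered eigenvalues\<close>

context square_dim
begin

lemma diag_conj_entry:
  assumes "U \<in> M\<^sub>n" "i < n" "j < n"
  shows "(U * mat_diag n d * U\<^sup>T) $$ (i, j) = (\<Sum>k<n. U $$ (i, k) * d k * U $$ (j, k))"
  using assms by (simp add: scalar_prod_def mat_diag_mult_right lessThan_atLeast0)

lemma gram_entry:
  assumes "A \<in> carrier_mat m n" "B \<in> carrier_mat m n" "i < n" "j < n"
  shows "(A\<^sup>T * B) $$ (i, j) = (\<Sum>k<m. A $$ (k, i) * B $$ (k, j))"
  using assms by (simp add: scalar_prod_def lessThan_atLeast0)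

lemma orthogonal_right_inverse:
  assumes "U \<in> M\<^sub>n" "U\<^sup>T * U = I"
  shows "U * U\<^sup>T = I"
  using left_inverse_imp_right_inverse[OF _ assms] assms by simp

lemma det_orthogonal:
  assumes "U \<in> M\<^sub>n" "U\<^sup>T * U = I"
  shows "det U * det U = 1"
  using det_mult[of "U\<^sup>T" n U] assms by (simp add: det_transpose[of _ n])

lemma det_diag_conj:
  assumes U: "U \<in> M\<^sub>n" "U\<^sup>T * U = I"
  shows "det (U * mat_diag n d * U\<^sup>T) = (\<Prod>k<n. d k)"
  using det_orthogonal[OF assms] U
  by (simp add: det_mult[of _ n] det_transpose[of _ n] mult_ac)

lemma diag_conj_invert:
  assumes U: "U \<in> M\<^sub>n" "U\<^sup>T * U = I"
  shows "U\<^sup>T * (U * mat_diag n d * U\<^sup>T) * U = mat_diag n d"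
proof -
  have "U\<^sup>T * (U * mat_diag n d * U\<^sup>T) * U = (U\<^sup>T * U) * mat_diag n d * (U\<^sup>T * U)"
    using U(1) by (simp add: sq_simps)
  then show ?thesis using U by simp
qed

lemma mtrace_diag_conj:
  assumes U: "U \<in> M\<^sub>n" "U\<^sup>T * U = I"
  shows "mtrace (U * mat_diag n d * U\<^sup>T) = (\<Sum>k<n. d k)"
proof -
  have "mtrace (U * mat_diag n d * U\<^sup>T) = mtrace (U\<^sup>T * (U * mat_diag n d))"
    using U by (intro mtrace_mult_comm[of _ n n]) auto
  also have "U\<^sup>T * (U * mat_diag n d) = (U\<^sup>T * U) * mat_diag n d"
    using U(1) by (simp add: sq_simps)
  finally show ?thesis using U by simp
qed

lemma char_poly_diag_conj:
  assumes U: "U \<in> M\<^sub>n" "U\<^sup>T * U = I"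
  shows "char_poly (U * mat_diag n d * U\<^sup>T) = (\<Prod>a\<leftarrow>map d [0..<n]. [:- a, 1:])"
proof -
  have "similar_mat (U * mat_diag n d * U\<^sup>T) (mat_diag n d)"
    using U orthogonal_right_inverse[OF U] by (intro similar_matI[of _ _ U "U\<^sup>T" n]) auto
  moreover have "char_poly (mat_diag n d) = (\<Prod>a\<leftarrow>diag_mat (mat_diag n d). [:- a, 1:])"
    by (rule char_poly_upper_triangular[of _ n]) (auto simp: upper_triangular_def)
  moreover have "diag_mat (mat_diag n d) = map d [0..<n]"
    by (auto simp: diag_mat_def)
  ultimately show ?thesis using char_poly_similar by metis
qed

text \<open>Bridge between \<open>eig\<close>, a sorted list of roots, and the unordered diagonal of
  the spectral theorem: both are the same multiset, and the permutation relating them is applied to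
  the columns of \<open>U\<close>.\<close>

lemma eig_decomposition:
  assumes A: "A \<in> M\<^sub>n" "A\<^sup>T = A"
  obtains U where "U \<in> M\<^sub>n" "U\<^sup>T * U = I" "A = U * mat_diag n (\<lambda>i. eig A (Suc i)) * U\<^sup>T"
    "\<And>i j. i \<le> j \<Longrightarrow> j < n \<Longrightarrow> eig A (Suc j) \<le> eig A (Suc i)"
proof -
  obtain U d where U: "U \<in> M\<^sub>n" "U\<^sup>T * U = I" and Aeq: "A = U * mat_diag n d * U\<^sup>T"
    using spectral_theorem[OF A] by blast
  let ?es = "map d [0..<n]"
  define L where "L = rev (sorted_list_of_multiset (proots (char_poly A)))"
  have eigL: "eig A (Suc i) = L ! i" for i by (simp add: eig_def L_def)
  have ms: "proots (char_poly A) = mset ?es"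
  proof -
    have "proots (char_poly A) = (\<Sum>p\<leftarrow>map (\<lambda>a. [:- a, 1:]) ?es. proots p)"
      unfolding Aeq char_poly_diag_conj[OF U]
      by (subst proots_prod_list[symmetric]) auto
    also have "\<dots> = (\<Sum>a\<leftarrow>?es. {#a#})" by (simp add: comp_def)
    also have "\<dots> = mset ?es"
    proof -
      have "(\<Sum>a\<leftarrow>xs. {#a#}) = mset xs" for xs :: "real list" by (induction xs) auto
      then show ?thesis .
    qed
    finally show ?thesis .
  qed
  have mL: "mset L = mset ?es" by (simp add: L_def ms)
  then have lenL: "length L = n" using mset_eq_length by fastforce
  obtain p where p: "p permutes {..<n}" "permute_list p ?es = L"
    using mset_eq_permutation[OF mL] by auto
  have pn: "p i < n" if "i < n" for i using p(1) that permutes_in_image[OF p(1), of i] by auto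
  have Lp: "L ! i = d (p i)" if "i < n" for i
    using p(1) that pn by (subst p(2)[symmetric], subst permute_list_nth) auto
  define V where "V = mat n n (\<lambda>(i, j). U $$ (i, p j))"
  have V: "V \<in> M\<^sub>n" by (simp add: V_def)
  show thesis
  proof (rule that[OF V])
    show "V\<^sup>T * V = I"
    proof (rule entries_eqI)
      fix i j assume ij: "i < n" "j < n"
      have "(V\<^sup>T * V) $$ (i, j) = (U\<^sup>T * U) $$ (p i, p j)"
        unfolding gram_entry[OF V V ij] gram_entry[OF U(1) U(1) pn[OF ij(1)] pn[OF ij(2)]]
        using ij by (simp add: V_def)
      also have "\<dots> = I $$ (i, j)"
        using ij pn permutes_inj[OF p(1)] by (simp add: U inj_eq)
      finally show "(V\<^sup>T * V) $$ (i, j) = I $$ (i, j)" .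
    qed (use V in auto)
    show "A = V * mat_diag n (\<lambda>i. eig A (Suc i)) * V\<^sup>T"
    proof (rule entries_eqI)
      fix i j assume ij: "i < n" "j < n"
      have "(V * mat_diag n (\<lambda>i. eig A (Suc i)) * V\<^sup>T) $$ (i, j) =
          (\<Sum>k<n. U $$ (i, p k) * d (p k) * U $$ (j, p k))"
        unfolding diag_conj_entry[OF V ij] using ij
        by (intro sum.cong) (auto simp: V_def eigL Lp)
      also have "\<dots> = (\<Sum>k<n. U $$ (i, k) * d k * U $$ (j, k))"
        using sum.permute[OF p(1), of "\<lambda>k. U $$ (i, k) * d k * U $$ (j, k)"] by (simp add: comp_def)
      also have "\<dots> = A $$ (i, j)" unfolding Aeq diag_conj_entry[OF U(1) ij] ..
      finally show "A $$ (i, j) = (V * mat_diag n (\<lambda>i. eig A (Suc i)) * V\<^sup>T) $$ (i, j)" ..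
    qed (use V A in auto)
    show "eig A (Suc j) \<le> eig A (Suc i)" if "i \<le> j" "j < n" for i j
    proof -
      have "sorted (rev L)" by (simp add: L_def)
      then show ?thesis using that lenL unfolding eigL by (simp add: sorted_rev_nth_mono)
    qed
  qed
qed

section \<open>Positive definite matrices\<close>

definition psd_mat :: "real mat \<Rightarrow> bool" where
  "psd_mat M \<longleftrightarrow> M \<in> M\<^sub>n \<and> M\<^sup>T = M \<and> (\<forall>v \<in> carrier_vec n. 0 \<le> v \<bullet> (M *\<^sub>v v))"

lemma pos_def_mat_sq:
  assumes "M \<in> M\<^sub>n"
  shows "pos_def_mat M \<longleftrightarrow> M\<^sup>T = M \<and> (\<forall>v \<in> carrier_vec n. v \<noteq> 0\<^sub>v n \<longrightarrow> 0 < v \<bullet> (M *\<^sub>v v))"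
  using assms by (auto simp: pos_def_mat_def)

lemma pos_def_imp_psd:
  assumes "M \<in> M\<^sub>n" "pos_def_mat M"
  shows "psd_mat M"
proof -
  have "0 \<le> v \<bullet> (M *\<^sub>v v)" if "v \<in> carrier_vec n" for v
    using assms that pos_def_mat_sq[OF assms(1)] by (cases "v = 0\<^sub>v n") (auto simp: less_imp_le)
  then show ?thesis using assms by (auto simp: psd_mat_def pos_def_mat_def)
qed

lemma quad_form_entry:
  assumes "X \<in> carrier_mat n m" "A \<in> M\<^sub>n" "k < m"
  shows "(X\<^sup>T * A * X) $$ (k, k) = col X k \<bullet> (A *\<^sub>v col X k)"
proof -
  have "(X\<^sup>T * A * X) $$ (k, k) = (X\<^sup>T * (A * X)) $$ (k, k)"
    using assms by (simp add: assoc_mult_mat[of _ m n _ n _ m])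
  also have "\<dots> = row (X\<^sup>T) k \<bullet> col (A * X) k"
    using assms by (subst index_mult_mat) auto
  also have "col (A * X) k = A *\<^sub>v col X k"
    using assms by (intro col_mult2[of _ n n _ m]) auto
  finally show ?thesis using assms by simp
qed

lemma quad_form_gram:
  assumes L: "L \<in> M\<^sub>n" and v: "v \<in> carrier_vec n"
  shows "v \<bullet> (L\<^sup>T * L *\<^sub>v v) = (L *\<^sub>v v) \<bullet> (L *\<^sub>v v)"
proof -
  have "v \<bullet> (L\<^sup>T * L *\<^sub>v v) = v \<bullet> (L\<^sup>T *\<^sub>v (L *\<^sub>v v))"
    using assms by (simp add: assoc_mult_mat_vec[of _ n n _ n])
  also have "\<dots> = (L\<^sup>T *\<^sub>v (L *\<^sub>v v)) \<bullet> v"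
    using assms by (intro comm_scalar_prod[of _ n]) auto
  also have "\<dots> = (L *\<^sub>v v) \<bullet> (L *\<^sub>v v)"
    using assms by (intro transpose_vec_mult_scalar[of _ n n]) auto
  finally show ?thesis .
qed

lemma scalar_prod_self_nonneg: "0 \<le> v \<bullet> (v :: real vec)"
  by (auto simp: scalar_prod_def intro!: sum_nonneg)

lemma scalar_prod_self_pos:
  assumes "v \<in> carrier_vec n" "v \<noteq> 0\<^sub>v n"
  shows "0 < v \<bullet> (v :: real vec)"
proof -
  obtain i where "i < n" "v $ i \<noteq> 0"
    using assms by (metis carrier_vecD eq_vecI index_zero_vec)
  then show ?thesis using assms unfolding scalar_prod_def
    by (intro sum_pos2[of _ i]) (auto simp: zero_less_mult_iff linorder_neq_iff)
qed

lemma psd_gram: "L \<in> M\<^sub>n \<Longrightarrow> psd_mat (L\<^sup>T * L)"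
  by (auto simp: psd_mat_def transpose_mult[of _ n n _ n] quad_form_gram scalar_prod_self_nonneg
    simp del: assoc_mult_mat_vec)

lemma pos_def_gram:
  assumes L: "L \<in> M\<^sub>n" "det L \<noteq> 0"
  shows "pos_def_mat (L\<^sup>T * L)"
proof -
  have "0 < (L *\<^sub>v v) \<bullet> (L *\<^sub>v v)" if "v \<in> carrier_vec n" "v \<noteq> 0\<^sub>v n" for v
  proof -
    have "L *\<^sub>v v \<noteq> 0\<^sub>v n"
      using det_0_iff_vec_prod_zero_field[OF L(1)] L(2) that by auto
    then show ?thesis using L(1) that(1) by (intro scalar_prod_self_pos mult_mat_vec_carrier[of _ n n])
  qed
  then show ?thesis
    using L by (subst pos_def_mat_sq) (auto simp: transpose_mult[of _ n n _ n] quad_form_gram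
        simp del: assoc_mult_mat_vec)
qed

lemma psd_diag_entry:
  assumes "psd_mat M" "X \<in> carrier_mat n m" "k < m"
  shows "0 \<le> (X\<^sup>T * M * X) $$ (k, k)"
  using assms by (subst quad_form_entry) (auto simp: psd_mat_def)

lemma pos_def_congruence_diag:
  assumes M: "M \<in> M\<^sub>n" "pos_def_mat M" and U: "U \<in> M\<^sub>n" "U\<^sup>T * U = I" and k: "k < n"
  shows "0 < (U\<^sup>T * M * U) $$ (k, k)"
proof -
  have "col U k \<noteq> 0\<^sub>v n"
  proof
    assume "col U k = 0\<^sub>v n"
    then have "(U\<^sup>T * U) $$ (k, k) = 0" using U(1) k by simp
    then show False using U k by simp
  qed
  then show ?thesis using assms pos_def_mat_sq[OF M(1)] by (subst quad_form_entry) auto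
qed

lemma spectral_psd:
  assumes "psd_mat M"
  obtains U d where "U \<in> M\<^sub>n" "U\<^sup>T * U = I" "M = U * mat_diag n d * U\<^sup>T" "\<And>k. k < n \<Longrightarrow> 0 \<le> d k"
proof -
  have M: "M \<in> M\<^sub>n" "M\<^sup>T = M" using assms by (auto simp: psd_mat_def)
  obtain U d where U: "U \<in> M\<^sub>n" "U\<^sup>T * U = I" and eq: "M = U * mat_diag n d * U\<^sup>T"
    using spectral_theorem[OF M] by blast
  have "0 \<le> d k" if "k < n" for k
    using psd_diag_entry[OF assms U(1) that] that unfolding eq diag_conj_invert[OF U] by simp
  then show thesis using that U eq by blast
qed

lemma spectral_pos_def:
  assumes "M \<in> M\<^sub>n" "pos_def_mat M"
  obtains U d where "U \<in> M\<^sub>n" "U\<^sup>T * U = I" "M = U * mat_diag n d * U\<^sup>T" "\<And>k. k < n \<Longrightarrow> 0 < d k"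
proof -
  have M: "M \<in> M\<^sub>n" "M\<^sup>T = M" using assms by (auto simp: pos_def_mat_def)
  obtain U d where U: "U \<in> M\<^sub>n" "U\<^sup>T * U = I" and eq: "M = U * mat_diag n d * U\<^sup>T"
    using spectral_theorem[OF M] by blast
  have "0 < d k" if "k < n" for k
    using pos_def_congruence_diag[OF assms U that] that unfolding eq diag_conj_invert[OF U] by simp
  then show thesis using that U eq by blast
qed

lemma diag_conj_mult:
  assumes U: "U \<in> M\<^sub>n" "U\<^sup>T * U = I"
  shows "(U * mat_diag n d * U\<^sup>T) * (U * mat_diag n e * U\<^sup>T) = U * mat_diag n (\<lambda>k. d k * e k) * U\<^sup>T"
proof -
  have "(U * mat_diag n d * U\<^sup>T) * (U * mat_diag n e * U\<^sup>T) = U * mat_diag n d * (U\<^sup>T * U) * (mat_diag n e * U\<^sup>T)"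
    using U(1) by (simp add: sq_simps)
  also have "\<dots> = U * (mat_diag n d * mat_diag n e) * U\<^sup>T"
    unfolding U(2) using U(1) by (simp add: sq_simps del: mat_diag_diag)
  finally show ?thesis by simp
qed

lemma mat_diag_cong: "(\<And>k. k < n \<Longrightarrow> d k = e k) \<Longrightarrow> mat_diag n d = mat_diag n e"
  by (auto simp: mat_diag_def)

lemma transpose_diag_conj:
  "U \<in> M\<^sub>n \<Longrightarrow> (U * mat_diag n d * U\<^sup>T)\<^sup>T = U * mat_diag n d * U\<^sup>T"
  by (simp add: transpose_mult[of _ n n _ n] sq_simps)

lemma pos_def_diag_conj:
  assumes U: "U \<in> M\<^sub>n" "U\<^sup>T * U = I" and d: "\<And>k. k < n \<Longrightarrow> 0 < d k"
  shows "pos_def_mat (U * mat_diag n d * U\<^sup>T)"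
proof -
  define L where "L = U * mat_diag n (\<lambda>k. sqrt (d k)) * U\<^sup>T"
  have L: "L \<in> M\<^sub>n" using U by (simp add: L_def)
  have "L\<^sup>T * L = U * mat_diag n d * U\<^sup>T"
    unfolding L_def transpose_diag_conj[OF U(1)] diag_conj_mult[OF U]
    using d by (subst mat_diag_cong[of "\<lambda>k. sqrt (d k) * sqrt (d k)" d]) (auto simp: less_imp_le)
  moreover have "det L \<noteq> 0"
    unfolding L_def det_diag_conj[OF U] using d by (auto simp: less_imp_neq[symmetric] prod_zero_iff)
  ultimately show ?thesis using pos_def_gram[OF L] by simp
qed

lemma psd_sqrt_exists:
  assumes "psd_mat M"
  obtains R where "R \<in> M\<^sub>n" "R\<^sup>T = R" "R * R = M"
proof -
  obtain U d where U: "U \<in> M\<^sub>n" "U\<^sup>T * U = I" and eq: "M = U * mat_diag n d * U\<^sup>T"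
    and d: "\<And>k. k < n \<Longrightarrow> 0 \<le> d k"
    by (rule spectral_psd[OF assms]) blast
  show thesis
  proof (rule that)
    show "(U * mat_diag n (\<lambda>k. sqrt (d k)) * U\<^sup>T) * (U * mat_diag n (\<lambda>k. sqrt (d k)) * U\<^sup>T) = M"
      unfolding eq diag_conj_mult[OF U] using d
      by (subst mat_diag_cong[of "\<lambda>k. sqrt (d k) * sqrt (d k)" d]) auto
  qed (use U in \<open>auto simp: transpose_diag_conj\<close>)
qed

lemma pos_def_sqrt_exists:
  assumes "M \<in> M\<^sub>n" "pos_def_mat M"
  obtains R where "R \<in> M\<^sub>n" "pos_def_mat R" "R * R = M"
proof -
  obtain U d where U: "U \<in> M\<^sub>n" "U\<^sup>T * U = I" and eq: "M = U * mat_diag n d * U\<^sup>T"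
    and d: "\<And>k. k < n \<Longrightarrow> 0 < d k"
    by (rule spectral_pos_def[OF assms]) blast
  show thesis
  proof (rule that)
    show "(U * mat_diag n (\<lambda>k. sqrt (d k)) * U\<^sup>T) * (U * mat_diag n (\<lambda>k. sqrt (d k)) * U\<^sup>T) = M"
      unfolding eq diag_conj_mult[OF U] using d
      by (subst mat_diag_cong[of "\<lambda>k. sqrt (d k) * sqrt (d k)" d]) (auto simp: less_imp_le)
    show "pos_def_mat (U * mat_diag n (\<lambda>k. sqrt (d k)) * U\<^sup>T)"
      using d by (intro pos_def_diag_conj[OF U]) auto
  qed (use U in auto)
qed

text \<open>The difference \<open>Y = R - S\<close> of two roots satisfies \<open>R Y + Y S = 0\<close>, so an eigenvector of \<open>Y\<close>
  with eigenvalue \<open>\<mu> \<noteq> 0\<close> would be isotropic for \<open>R + S\<close>.\<close>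

lemma pos_def_sqrt_unique:
  assumes R: "R \<in> M\<^sub>n" "pos_def_mat R" and S: "S \<in> M\<^sub>n" "pos_def_mat S" and eq: "R * R = S * S"
  shows "R = S"
proof -
  define Y where "Y = R - S"
  have Y: "Y \<in> M\<^sub>n" using R S by (simp add: Y_def)
  have sym: "R\<^sup>T = R" "S\<^sup>T = S" using R S by (auto simp: pos_def_mat_def)
  then have YT: "Y\<^sup>T = Y" unfolding Y_def using R S by (simp add: transpose_minus[of _ n n])
  obtain U d where U: "U \<in> M\<^sub>n" "U\<^sup>T * U = I" and Yeq: "Y = U * mat_diag n d * U\<^sup>T"
    using spectral_theorem[OF Y YT] by blast
  have zero: "R * Y + Y * S = 0\<^sub>m n n"
    using R S eq unfolding Y_def
    by (intro entries_eqI) (auto simp: sq_simps simp del: index_mult_mat(1))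
  have YU: "Y * U = U * mat_diag n d"
  proof -
    have "Y * U = U * mat_diag n d * (U\<^sup>T * U)"
      unfolding Yeq using U(1) by (simp add: sq_simps)
    then show ?thesis using U by simp
  qed
  have UY: "U\<^sup>T * Y = mat_diag n d * U\<^sup>T"
  proof -
    have "U\<^sup>T * Y = (U\<^sup>T * U) * mat_diag n d * U\<^sup>T"
      unfolding Yeq using U(1) by (simp add: sq_simps)
    then show ?thesis using U by simp
  qed
  have "d k = 0" if k: "k < n" for k
  proof -
    have "U\<^sup>T * (R * Y + Y * S) * U = U\<^sup>T * R * (Y * U) + U\<^sup>T * Y * S * U"
      using U(1) R S Y by (simp add: sq_simps)
    also have "\<dots> = (U\<^sup>T * R * U) * mat_diag n d + mat_diag n d * (U\<^sup>T * S * U)"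
      unfolding YU UY using U(1) R S by (simp add: sq_simps)
    finally have "(U\<^sup>T * (0\<^sub>m n n) * U) = (U\<^sup>T * R * U) * mat_diag n d + mat_diag n d * (U\<^sup>T * S * U)"
      unfolding zero .
    from arg_cong[OF this, of "\<lambda>A. A $$ (k, k)"]
    have "((U\<^sup>T * R * U) $$ (k, k) + (U\<^sup>T * S * U) $$ (k, k)) * d k = 0"
      using k U(1) R S by (simp add: algebra_simps mult_mat_diag_index[of _ n n] mat_diag_mult_index[of _ n n]
        del: index_mult_mat(1))
    moreover have "(U\<^sup>T * R * U) $$ (k, k) + (U\<^sup>T * S * U) $$ (k, k) > 0"
      using pos_def_congruence_diag[OF R U k] pos_def_congruence_diag[OF S U k] by simp
    ultimately show ?thesis by simp
  qed
  then have "mat_diag n d = 0\<^sub>m n n" by (auto simp: mat_diag_def)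
  then have "Y = 0\<^sub>m n n" unfolding Yeq using U by simp
  then show ?thesis unfolding Y_def using R S
    by (intro entries_eqI) (auto simp: mat_eq_iff)
qed

lemma pos_def_det_pos:
  assumes "M \<in> M\<^sub>n" "pos_def_mat M"
  shows "0 < det M"
proof -
  obtain U d where U: "U \<in> M\<^sub>n" "U\<^sup>T * U = I" and eq: "M = U * mat_diag n d * U\<^sup>T"
    and d: "\<And>k. k < n \<Longrightarrow> 0 < d k"
    by (rule spectral_pos_def[OF assms]) blast
  show ?thesis unfolding eq det_diag_conj[OF U] using d by (intro prod_pos) auto
qed

lemma psd_det_imp_pos_def:
  assumes "psd_mat M" "det M \<noteq> 0"
  shows "pos_def_mat M"
proof -
  obtain U d where U: "U \<in> M\<^sub>n" "U\<^sup>T * U = I" and eq: "M = U * mat_diag n d * U\<^sup>T"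
    and d: "\<And>k. k < n \<Longrightarrow> 0 \<le> d k"
    by (rule spectral_psd[OF assms(1)]) blast
  have "d k \<noteq> 0" if "k < n" for k
    using assms(2) that unfolding eq det_diag_conj[OF U] by (auto simp: prod_zero_iff)
  then show ?thesis unfolding eq using d by (intro pos_def_diag_conj[OF U]) (auto simp: less_le)
qed

lemma ln_det_le_trace:
  assumes "M \<in> M\<^sub>n" "pos_def_mat M"
  shows "ln (det M) \<le> mtrace M - real n"
proof -
  obtain U d where U: "U \<in> M\<^sub>n" "U\<^sup>T * U = I" and eq: "M = U * mat_diag n d * U\<^sup>T"
    and d: "\<And>k. k < n \<Longrightarrow> 0 < d k"
    by (rule spectral_pos_def[OF assms]) blast
  have "ln (det M) = (\<Sum>k<n. ln (d k))"
    unfolding eq det_diag_conj[OF U] by (intro ln_prod) (use d in force)+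
  also have "\<dots> \<le> (\<Sum>k<n. d k - 1)"
    using d by (intro sum_mono ln_le_minus_one) auto
  also have "\<dots> = mtrace M - real n"
    unfolding eq mtrace_diag_conj[OF U] by (simp add: sum_subtractf)
  finally show ?thesis .
qed

lemma pos_def_congruence:
  assumes M: "M \<in> M\<^sub>n" "pos_def_mat M" and L: "L \<in> M\<^sub>n" "det L \<noteq> 0"
  shows "pos_def_mat (L\<^sup>T * M * L)"
proof -
  obtain R where R: "R \<in> M\<^sub>n" "pos_def_mat R" "R * R = M"
    using pos_def_sqrt_exists[OF M] .
  have "(R * L)\<^sup>T * (R * L) = L\<^sup>T * (R\<^sup>T * R) * L"
    using R(1) L by (simp add: transpose_mult[of _ n n _ n] sq_simps)
  also have "R\<^sup>T * R = M" using R by (auto simp: pos_def_mat_def)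
  finally have "L\<^sup>T * M * L = (R * L)\<^sup>T * (R * L)" ..
  moreover have "det (R * L) \<noteq> 0"
    using pos_def_det_pos[OF R(1,2)] L R(1) by (simp add: det_mult[of _ n])
  ultimately show ?thesis using pos_def_gram[of "R * L"] R(1) L by simp
qed

lemma det_congruence:
  "M \<in> M\<^sub>n \<Longrightarrow> L \<in> M\<^sub>n \<Longrightarrow> det (L\<^sup>T * M * L) = det M * (det L)\<^sup>2"
  by (simp add: det_mult[of _ n] det_transpose[of _ n] power2_eq_square)

text \<open>The tangent plane inequality of the concave function \<open>ln det\<close>, touching
  where \<open>F\<close> inverts \<open>A\<close>. As \<open>A * F\<close> need not be symmetric,
  the trace bound is applied to \<open>R A R\<close> with \<open>R\<close> the square root of
  \<open>F\<close>.\<close>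

lemma ln_det_le_trace_mult:
  assumes A: "A \<in> M\<^sub>n" "pos_def_mat A" and F: "F \<in> M\<^sub>n" "pos_def_mat F"
  shows "ln (det A) + ln (det F) \<le> mtrace (A * F) - real n"
proof -
  obtain R where R: "R \<in> M\<^sub>n" "pos_def_mat R" "R * R = F"
    using pos_def_sqrt_exists[OF F] .
  have RT: "R\<^sup>T = R" using R by (simp add: pos_def_mat_def)
  have dR: "0 < det R" using pos_def_det_pos[OF R(1,2)] .
  have detF: "det F = (det R)\<^sup>2"
    unfolding R(3)[symmetric] using R(1) by (simp add: det_mult[of _ n] power2_eq_square)
  have "ln (det (R\<^sup>T * A * R)) \<le> mtrace (R\<^sup>T * A * R) - real n"
    using A R dR by (intro ln_det_le_trace pos_def_congruence) auto
  moreover have "ln (det (R\<^sup>T * A * R)) = ln (det A) + ln (det F)"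
    unfolding det_congruence[OF A(1) R(1)] detF
    using pos_def_det_pos[OF A] dR by (simp add: ln_mult)
  moreover have "mtrace (R\<^sup>T * A * R) = mtrace (A * F)"
  proof -
    have "mtrace (R\<^sup>T * A * R) = mtrace (R * (A * R))"
      using A R RT by (simp add: sq_simps)
    also have "\<dots> = mtrace (A * R * R)" using A R by (intro mtrace_mult_comm[of _ n n]) auto
    also have "A * R * R = A * F" using A(1) R(1) by (simp add: sq_simps flip: R(3))
    finally show ?thesis .
  qed
  ultimately show ?thesis by simp
qed

text \<open>Rescaling \<open>M\<close> to unit diagonal makes the trace bound \<open>mtrace M - n\<close> vanish.\<close>

lemma hadamard:
  assumes M: "M \<in> M\<^sub>n" "pos_def_mat M"
  shows "ln (det M) \<le> (\<Sum>i<n. ln (M $$ (i, i)))"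
proof -
  have pos: "0 < M $$ (i, i)" if "i < n" for i
    using pos_def_congruence_diag[OF M, of I, OF _ _ that] M(1) by simp
  define F where "F = mat_diag n (\<lambda>i. 1 / M $$ (i, i))"
  have F: "F \<in> M\<^sub>n" by (simp add: F_def)
  have "pos_def_mat F"
    using pos_def_diag_conj[of I "\<lambda>i. 1 / M $$ (i, i)"] pos by (simp add: F_def)
  then have "ln (det M) + ln (det F) \<le> mtrace (M * F) - real n"
    using M F by (intro ln_det_le_trace_mult)
  also have "mtrace (M * F) = (\<Sum>i<n. 1)"
    unfolding mtrace_mult_comm[OF M(1) F] unfolding F_def mtrace_diag_mult[OF M(1)]
    using pos by (intro sum.cong) (auto simp: less_imp_neq[symmetric])
  also have "ln (det F) = - (\<Sum>i<n. ln (M $$ (i, i)))"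
    unfolding F_def det_mat_diag using pos
    by (subst ln_prod) (auto simp: ln_div less_imp_neq[symmetric] sum_negf)
  finally show ?thesis by simp
qed

section \<open>Duality for the spectral function\<close>

lemma mat_diag_mult_vec_index:
  fixes w :: "real vec"
  assumes "w \<in> carrier_vec n" "i < n"
  shows "(mat_diag n f *\<^sub>v w) $ i = f i * w $ i"
proof -
  have "(mat_diag n f *\<^sub>v w) $ i = (\<Sum>j<n. (if i = j then f j else 0) * w $ j)"
    using assms by (simp add: scalar_prod_def lessThan_atLeast0)
  also have "\<dots> = (\<Sum>j<n. if i = j then f j * w $ j else 0)"
    by (intro sum.cong) auto
  finally show ?thesis using assms by simp
qed

lemma eig_diagonalization:
  assumes A: "A \<in> M\<^sub>n" "A\<^sup>T = A"
  obtains U where "U \<in> M\<^sub>n" "U\<^sup>T * U = I" "A = U * mat_diag n (\<lambda>i. eig A (Suc i)) * U\<^sup>T"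
  by (rule eig_decomposition[OF A], rule that)

lemma eig_antimono:
  assumes A: "A \<in> M\<^sub>n" "A\<^sup>T = A" and "i \<le> j" "j < n"
  shows "eig A (Suc j) \<le> eig A (Suc i)"
  by (rule eig_decomposition[OF A]) (use assms in blast)

lemma psd_eig_nonneg:
  assumes "psd_mat X" "i < n"
  shows "0 \<le> eig X (Suc i)"
proof -
  have X: "X \<in> M\<^sub>n" "X\<^sup>T = X" using assms by (auto simp: psd_mat_def)
  obtain U where U: "U \<in> M\<^sub>n" "U\<^sup>T * U = I" and eq: "X = U * mat_diag n (\<lambda>i. eig X (Suc i)) * U\<^sup>T"
    using eig_diagonalization[OF X] .
  have "(U\<^sup>T * X * U) $$ (i, i) = mat_diag n (\<lambda>i. eig X (Suc i)) $$ (i, i)"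
    by (subst eq, subst diag_conj_invert[OF U]) simp
  then show ?thesis using psd_diag_entry[OF assms(1) U(1) assms(2)] assms(2) by simp
qed

lemma tail_mean_eq:
  assumes "X \<in> M\<^sub>n"
  shows "tail_mean r X k = (\<Sum>i\<in>{k..<n}. eig X (Suc i)) / (real r - real k)"
proof -
  have "(\<Sum>i = k + 1..n. eig X i) = (\<Sum>i\<in>{k..<n}. eig X (Suc i))"
    by (rule sum.reindex_bij_witness[of _ Suc "\<lambda>i. i - 1"]) auto
  then show ?thesis using assms by (simp add: tail_mean_def)
qed

text \<open>\<open>P k\<close> is the second defining condition at \<open>k\<close>; peeling off one
  summand shows the first condition at \<open>Suc k\<close> to be exactly the failure of
  \<open>P k\<close>. Since \<open>P\<close> persists once true, the two conditions single out the
  least index with \<open>P\<close>, and the \<open>THE\<close> is well defined.\<close>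

lemma split_index_spec:
  assumes X: "psd_mat X" and r: "0 < r" "r \<le> n"
  defines "k \<equiv> split_index r X"
  shows "k < r" "k = 0 \<or> tail_mean r X k < eig X k" "eig X (Suc k) \<le> tail_mean r X k"
proof -
  have Xc: "X \<in> M\<^sub>n" "X\<^sup>T = X" using X by (auto simp: psd_mat_def)
  \<comment> \<open>\<open>L\<close> counts from 0, \<open>eig\<close> from 1.\<close>
  define L where "L = (\<lambda>i. eig X (Suc i))"
  have mono: "L j \<le> L i" if "i \<le> j" "j < n" for i j
    unfolding L_def by (rule eig_antimono[OF Xc that])
  have nonneg: "0 \<le> L i" if "i < n" for i using psd_eig_nonneg[OF X that] by (simp add: L_def)
  define P where "P = (\<lambda>k. (real r - real k) * L k \<le> (\<Sum>i\<in>{k..<n}. L i))"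
  have tail: "tail_mean r X k = (\<Sum>i\<in>{k..<n}. L i) / (real r - real k)" for k
    unfolding L_def by (rule tail_mean_eq[OF Xc(1)])
  have split: "(\<Sum>i\<in>{k..<n}. L i) = L k + (\<Sum>i\<in>{Suc k..<n}. L i)" if "k < r" for k
    using that r by (intro sum.atLeast_Suc_lessThan) auto
  have cond2: "eig X (k + 1) \<le> tail_mean r X k \<longleftrightarrow> P k" if "k < r" for k
    using that by (simp add: tail P_def L_def pos_le_divide_eq mult.commute)
  have cond1: "eig X (Suc k) > tail_mean r X (Suc k) \<longleftrightarrow> \<not> P k" if "Suc k < r" for k
  proof -
    have "eig X (Suc k) > tail_mean r X (Suc k) \<longleftrightarrow>
        (\<Sum>i\<in>{Suc k..<n}. L i) < L k * (real r - real (Suc k))"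
      using that by (simp add: tail L_def pos_divide_less_eq)
    also have "\<dots> \<longleftrightarrow> \<not> P k"
      using split[of k] that by (auto simp: P_def algebra_simps)
    finally show ?thesis .
  qed
  have step: "P (Suc k)" if "P k" "Suc k < r" for k
  proof -
    have "L (Suc k) \<le> L k" using that r by (intro mono) auto
    then have "(real r - real (Suc k)) * L (Suc k) \<le> (real r - real (Suc k)) * L k"
      using that by (intro mult_left_mono) auto
    also have "\<dots> \<le> (\<Sum>i\<in>{Suc k..<n}. L i)"
      using that split[of k] by (simp add: P_def algebra_simps)
    finally show ?thesis by (simp add: P_def)
  qed
  have step': "P k'" if "P k" "k \<le> k'" "k' < r" for k k'
    using that(2,1,3) by (induction k' rule: dec_induct) (auto intro: step)
  \<comment> \<open>Nonnegativity of the eigenvalues stops the search below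
    \<open>r\<close>.\<close>
  have last: "P (r - 1)"
  proof -
    have "0 \<le> (\<Sum>i\<in>{r..<n}. L i)" by (intro sum_nonneg) (auto intro: nonneg)
    then show ?thesis using split[of "r - 1"] r by (simp add: P_def of_nat_diff)
  qed
  define Q where "Q = (\<lambda>k. k < r \<and> (k = 0 \<or> eig X k > tail_mean r X k) \<and>
     tail_mean r X k \<ge> eig X (k + 1))"
  have Q: "Q k \<longleftrightarrow> k < r \<and> P k \<and> (\<forall>j<k. \<not> P j)" for k
  proof (cases k)
    case 0
    then show ?thesis using cond2[of 0] by (auto simp: Q_def)
  next
    case (Suc j)
    then show ?thesis using cond2[of k] cond1[of j] step'[of _ j]
      by (auto simp: Q_def less_Suc_eq_le)
  qed
  define k0 where "k0 = (LEAST k. P k)"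
  have "P k0" unfolding k0_def by (rule LeastI[of P, OF last])
  moreover have "k0 \<le> r - 1" unfolding k0_def by (rule Least_le[of P, OF last])
  moreover have "\<forall>j<k0. \<not> P j" unfolding k0_def using not_less_Least by blast
  ultimately have "Q k0" using r unfolding Q by simp
  moreover have "k1 = k2" if "Q k1" "Q k2" for k1 k2
    using that unfolding Q by (metis linorder_neqE_nat)
  ultimately have "(THE k. Q k) = k0" by (intro the_equality)
  with \<open>Q k0\<close> have "Q k"
    by (simp add: k_def split_index_def Q_def)
  then show "k < r" "k = 0 \<or> tail_mean r X k < eig X k" "eig X (Suc k) \<le> tail_mean r X k"
    by (auto simp: Q_def)
qed

text \<open>The eigenvalues after the split index are fractions \<open>y\<^sub>i\<close> of \<open>m = tail_mean\<close>, and
  \<open>\<Sum> y\<^sub>i = r\<close>; so \<open>ln (f_spec r X)\<close> is a weighted sum of logarithms with weights in \<open>[0, 1]\<close>.\<close>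

lemma f_spec_weights:
  assumes X: "psd_mat X" and r: "0 < r" "r \<le> n" and pos: "0 < eig X r"
  shows "\<exists>c y m. 0 < m \<and> (\<forall>i<n. m \<le> c i \<and> (y i < 1 \<longrightarrow> c i = m) \<and> 0 \<le> y i \<and> y i \<le> 1 \<and>
      eig X (Suc i) = c i * y i) \<and> (\<Sum>i<n. y i) = real r \<and>
    0 < f_spec r X \<and> ln (f_spec r X) = (\<Sum>i<n. y i * ln (c i))"
proof -
  have Xc: "X \<in> M\<^sub>n" "X\<^sup>T = X" using X by (auto simp: psd_mat_def)
  define L where "L = (\<lambda>i. eig X (Suc i))"
  have mono: "L j \<le> L i" if "i \<le> j" "j < n" for i j
    unfolding L_def by (rule eig_antimono[OF Xc that])
  have nonneg: "0 \<le> L i" if "i < n" for i using psd_eig_nonneg[OF X that] by (simp add: L_def)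
  define k where "k = split_index r X"
  define m where "m = tail_mean r X k"
  note spec = split_index_spec[OF X r, folded k_def m_def]
  have k: "k < r" "k < n" using spec(1) r by auto
  \<comment> \<open>As \<open>k < r\<close>, the tail contains the positive eigenvalue number
    \<open>r\<close>, which makes its mean \<open>m\<close> positive.\<close>
  have Lr: "0 < L (r - 1)" using pos r by (simp add: L_def)
  have "0 < (\<Sum>i\<in>{k..<n}. L i)"
    using Lr k r nonneg by (intro sum_pos2[of _ "r - 1"]) auto
  moreover have meq: "m * (real r - real k) = (\<Sum>i\<in>{k..<n}. L i)"
    unfolding m_def tail_mean_eq[OF Xc(1)] L_def using k by simp
  ultimately have m: "0 < m" using k by (metis of_nat_less_iff diff_gt_0_iff_gt zero_less_mult_pos2)
  have below: "m < L i" if "i < k" for i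
  proof -
    have "m < L (k - 1)" using spec(2) that by (auto simp: L_def m_def)
    also have "\<dots> \<le> L i" using that k by (intro mono) auto
    finally show ?thesis .
  qed
  have above: "L i \<le> m" if "k \<le> i" "i < n" for i
    using mono[OF that] spec(3) by (simp add: L_def m_def)
  define c where "c = (\<lambda>i. if i < k then L i else m)"
  define y where "y = (\<lambda>i. if i < k then 1 else L i / m)"
  have split_sum: "(\<Sum>i<n. g i) = (\<Sum>i<k. g i) + (\<Sum>i\<in>{k..<n}. g i)" for g :: "nat \<Rightarrow> real"
    using k by (simp add: lessThan_atLeast0 sum.atLeastLessThan_concat)
  have sumL: "(\<Sum>i\<in>{k..<n}. L i / m) = real r - real k"
    using meq m by (simp add: sum_divide_distrib[symmetric] field_simps)
  have f: "f_spec r X = (\<Prod>i<k. L i) * m ^ (r - k)"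
  proof -
    have "(\<Prod>i = 1..k. eig X i) = (\<Prod>i<k. L i)"
      unfolding L_def by (rule prod.reindex_bij_witness[of _ Suc "\<lambda>i. i - 1"]) auto
    then show ?thesis by (simp add: f_spec_def Let_def k_def[symmetric] m_def[symmetric])
  qed
  have Lpos: "0 < L i" if "i < k" for i using below[OF that] m by simp
  have prod_pos: "0 < (\<Prod>i<k. L i)" using Lpos by (intro prod_pos) auto
  show ?thesis
  proof (rule exI[of _ c], rule exI[of _ y], rule exI[of _ m], intro conjI allI impI)
    show "0 < f_spec r X" unfolding f using prod_pos m by simp
    have "ln (\<Prod>i<k. L i) = (\<Sum>i<k. ln (L i))"
      by (intro ln_prod) (use Lpos in force)+
    then have "ln (f_spec r X) = (\<Sum>i<k. ln (L i)) + real (r - k) * ln m"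
      unfolding f using prod_pos m Lpos
      by (subst ln_mult) (auto simp: ln_realpow dest: Lpos)
    also have "real (r - k) * ln m = (\<Sum>i\<in>{k..<n}. L i / m * ln m)"
      using sumL k by (simp add: sum_distrib_right[symmetric] of_nat_diff del: times_divide_eq_left)
    finally show "ln (f_spec r X) = (\<Sum>i<n. y i * ln (c i))"
      unfolding split_sum by (simp add: y_def c_def)
    show "(\<Sum>i<n. y i) = real r" unfolding split_sum using sumL by (simp add: y_def)
    show "0 < m" by (fact m)
  qed (use below above m nonneg in \<open>auto simp: c_def y_def L_def less_imp_le split: if_splits\<close>)
qed

text \<open>The bound \<open>F \<le> \<sigma> I\<close> in the Loewner order.\<close>

definition majorized :: "real mat \<Rightarrow> real \<Rightarrow> bool" where
  "majorized F \<sigma> \<longleftrightarrow> (\<forall>v\<in>carrier_vec n. v \<bullet> (F *\<^sub>v v) \<le> \<sigma> * (v \<bullet> v))"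

lemma majorized_diag_conj:
  assumes U: "U \<in> M\<^sub>n" "U\<^sup>T * U = I" and d: "\<And>i. i < n \<Longrightarrow> d i \<le> \<sigma>"
  shows "majorized (U * mat_diag n d * U\<^sup>T) \<sigma>"
  unfolding majorized_def
proof
  fix v :: "real vec" assume v: "v \<in> carrier_vec n"
  define w where "w = U\<^sup>T *\<^sub>v v"
  have w: "w \<in> carrier_vec n" using U v by (simp add: w_def)
  have conj: "v \<bullet> (U * D * U\<^sup>T *\<^sub>v v) = w \<bullet> (D *\<^sub>v w)" if "D \<in> M\<^sub>n" for D
  proof -
    have "w \<bullet> (D *\<^sub>v w) = v \<bullet> (U *\<^sub>v (D *\<^sub>v w))"
      unfolding w_def using transpose_vec_mult_scalar[OF U(1), of "D *\<^sub>v w" v] v w that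
      by (simp add: w_def)
    then show ?thesis using U(1) v that w
      by (simp add: w_def assoc_mult_mat_vec[of _ n n _ n] mult_mat_vec_carrier[of _ n n])
  qed
  have vv: "v \<bullet> v = w \<bullet> w"
    using conj[of I] U(1) orthogonal_right_inverse[OF U] v w by simp
  have "v \<bullet> (U * mat_diag n d * U\<^sup>T *\<^sub>v v) = (\<Sum>i<n. d i * (w $ i * w $ i))"
    unfolding conj[OF mat_diag_dim] using w
    unfolding scalar_prod_def by (auto simp: lessThan_atLeast0 mat_diag_mult_vec_index
        simp del: index_mult_mat_vec intro!: sum.cong)
  also have "\<dots> \<le> (\<Sum>i<n. \<sigma> * (w $ i * w $ i))"
    using d by (intro sum_mono mult_right_mono) auto
  also have "\<dots> = \<sigma> * (v \<bullet> v)"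
    unfolding vv using w by (simp add: scalar_prod_def lessThan_atLeast0 sum_distrib_left)
  finally show "v \<bullet> (U * mat_diag n d * U\<^sup>T *\<^sub>v v) \<le> \<sigma> * (v \<bullet> v)" .
qed

text \<open>Weak duality: \<open>\<Lambda>\<close> is a dual certificate for \<open>f_spec\<close>. Its diagonal \<open>d\<close> in an eigenbasis of
  \<open>X\<close> satisfies \<open>d\<^sub>i \<le> \<sigma>\<close> and, by Hadamard, \<open>\<Sum> ln d\<^sub>i \<ge> ln det \<Lambda>\<close>.\<close>

lemma ln_f_spec_le_dual:
  assumes X: "psd_mat X" and r: "0 < r" "r \<le> n" and pos: "0 < eig X r"
    and F: "F \<in> M\<^sub>n" "pos_def_mat F" and \<sigma>: "majorized F \<sigma>"
  shows "ln (f_spec r X) \<le> mtrace (X * F) - real r - ln (det F) + (real n - real r) * ln \<sigma>"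
proof -
  have Xc: "X \<in> M\<^sub>n" "X\<^sup>T = X" using X by (auto simp: psd_mat_def)
  obtain c y m where m: "0 < m" and cy: "\<forall>i<n. m \<le> c i \<and> (y i < 1 \<longrightarrow> c i = m) \<and> 0 \<le> y i \<and> y i \<le> 1 \<and>
      eig X (Suc i) = c i * y i" and sum_y: "(\<Sum>i<n. y i) = real r"
    and lnf: "ln (f_spec r X) = (\<Sum>i<n. y i * ln (c i))"
    using f_spec_weights[OF X r pos] by blast
  have c: "m \<le> c i" and y: "0 \<le> y i" "y i \<le> 1" and eigs: "eig X (Suc i) = c i * y i"
    and cm: "y i < 1 \<Longrightarrow> c i = m" if "i < n" for i
    using cy that by auto
  obtain U where U: "U \<in> M\<^sub>n" "U\<^sup>T * U = I" and eq: "X = U * mat_diag n (\<lambda>i. eig X (Suc i)) * U\<^sup>T"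
    using eig_diagonalization[OF Xc] .
  define N where "N = U\<^sup>T * F * U"
  have N: "N \<in> M\<^sub>n" using U F by (simp add: N_def)
  have detU: "det U \<noteq> 0" using det_orthogonal[OF U] by auto
  have pdN: "pos_def_mat N" unfolding N_def using pos_def_congruence[OF F U(1) detU] .
  have detN: "det N = det F"
    unfolding N_def det_congruence[OF F(1) U(1)] using det_orthogonal[OF U] by (simp add: power2_eq_square)
  define d where "d = (\<lambda>i. N $$ (i, i))"
  have dpos: "0 < d i" if "i < n" for i
    unfolding d_def N_def using pos_def_congruence_diag[OF F U that] .
  have dle: "d i \<le> \<sigma>" if i: "i < n" for i
  proof -
    have "d i = col U i \<bullet> (F *\<^sub>v col U i)"
      unfolding d_def N_def using quad_form_entry[OF U(1) F(1) i] .
    also have "\<dots> \<le> \<sigma> * (col U i \<bullet> col U i)"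
      using \<sigma> U i by (auto simp: majorized_def)
    also have "col U i \<bullet> col U i = (U\<^sup>T * U) $$ (i, i)"
      using U(1) i by simp
    finally show ?thesis using U i by simp
  qed
  have cpos: "0 < c i" if "i < n" for i using c[OF that] m by simp
  have tr: "mtrace (X * F) = (\<Sum>i<n. c i * y i * d i)"
  proof -
    have "mtrace (X * F) = mtrace (U * (mat_diag n (\<lambda>i. eig X (Suc i)) * U\<^sup>T * F))"
      by (subst eq) (use U(1) F in \<open>simp add: sq_simps\<close>)
    also have "\<dots> = mtrace (mat_diag n (\<lambda>i. eig X (Suc i)) * U\<^sup>T * F * U)"
      using U F by (intro mtrace_mult_comm[of _ n n]) auto
    also have "mat_diag n (\<lambda>i. eig X (Suc i)) * U\<^sup>T * F * U = mat_diag n (\<lambda>i. eig X (Suc i)) * N"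
      unfolding N_def using U(1) F by (simp add: sq_simps)
    finally show ?thesis
      using mtrace_diag_mult[OF N] by (simp add: d_def eigs)
  qed
  have "ln (f_spec r X) \<le> (\<Sum>i<n. y i * (c i * d i - 1) - ln (d i) + (1 - y i) * ln \<sigma>)"
    unfolding lnf
  proof (intro sum_mono)
    fix i assume "i \<in> {..<n}"
    then have i: "i < n" by simp
    have "ln (c i * d i) \<le> c i * d i - 1" using cpos dpos i by (intro ln_le_minus_one) auto
    then have "ln (c i) \<le> c i * d i - 1 - ln (d i)"
      using ln_mult[of "c i" "d i"] cpos[OF i] dpos[OF i] by simp
    then have "y i * ln (c i) \<le> y i * (c i * d i - 1 - ln (d i))"
      using y i by (intro mult_left_mono) auto
    \<comment> \<open>Splitting off a full \<open>ln (d i)\<close> prepares for Hadamard's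
      inequality; the leftover weight \<open>1 - y i \<ge> 0\<close> is where
      \<open>d i \<le> \<sigma>\<close> enters, and these weights sum to
      \<open>n - r\<close>.\<close>
    also have "\<dots> = y i * (c i * d i - 1) - ln (d i) + (1 - y i) * ln (d i)"
      by (simp add: algebra_simps)
    also have "(1 - y i) * ln (d i) \<le> (1 - y i) * ln \<sigma>"
      using y i dle[OF i] dpos[OF i] by (intro mult_left_mono) auto
    finally show "y i * ln (c i) \<le> y i * (c i * d i - 1) - ln (d i) + (1 - y i) * ln \<sigma>" by simp
  qed
  also have "\<dots> = mtrace (X * F) - real r - (\<Sum>i<n. ln (d i)) + (real n - real r) * ln \<sigma>"
    unfolding tr by (simp add: sum.distrib sum_subtractf algebra_simps sum_y flip: sum_distrib_left)
  also have "\<dots> \<le> mtrace (X * F) - real r - ln (det F) + (real n - real r) * ln \<sigma>"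
    using hadamard[OF N pdN] unfolding detN d_def by simp
  finally show ?thesis .
qed

text \<open>Inverting the weights \<open>c\<close> in an eigenbasis of \<open>X\<close> gives
  equality throughout weak duality: \<open>F\<close> is diagonal there, its entries satisfy
  \<open>c i * d i = 1\<close>, and wherever \<open>y i < 1\<close> the entry \<open>1 / c i\<close>
  already equals the bound \<open>1 / m\<close>.\<close>

lemma ln_f_spec_dual_attained:
  assumes X: "psd_mat X" and r: "0 < r" "r \<le> n" and pos: "0 < eig X r"
  obtains F \<sigma> where "F \<in> M\<^sub>n" "pos_def_mat F" "0 < \<sigma>" "majorized F \<sigma>"
    "ln (f_spec r X) = mtrace (X * F) - real r - ln (det F) + (real n - real r) * ln \<sigma>"
proof -
  have Xc: "X \<in> M\<^sub>n" "X\<^sup>T = X" using X by (auto simp: psd_mat_def)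
  obtain c y m where m: "0 < m" and cy: "\<forall>i<n. m \<le> c i \<and> (y i < 1 \<longrightarrow> c i = m) \<and> 0 \<le> y i \<and> y i \<le> 1 \<and>
      eig X (Suc i) = c i * y i" and sum_y: "(\<Sum>i<n. y i) = real r"
    and lnf: "ln (f_spec r X) = (\<Sum>i<n. y i * ln (c i))"
    using f_spec_weights[OF X r pos] by blast
  have c: "m \<le> c i" and y: "0 \<le> y i" "y i \<le> 1" and eigs: "eig X (Suc i) = c i * y i"
    and cm: "y i < 1 \<Longrightarrow> c i = m" if "i < n" for i
    using cy that by auto
  obtain U where U: "U \<in> M\<^sub>n" "U\<^sup>T * U = I" and eq: "X = U * mat_diag n (\<lambda>i. eig X (Suc i)) * U\<^sup>T"
    using eig_diagonalization[OF Xc] .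
  have cpos: "0 < c i" if "i < n" for i using c[OF that] m by simp
  define F where "F = U * mat_diag n (\<lambda>i. 1 / c i) * U\<^sup>T"
  have F: "F \<in> M\<^sub>n" using U by (simp add: F_def)
  show thesis
  proof (rule that[OF F])
    show "pos_def_mat F" unfolding F_def using cpos by (intro pos_def_diag_conj[OF U]) auto
    show "0 < 1 / m" using m by simp
    show "majorized F (1 / m)"
      unfolding F_def using c m cpos by (intro majorized_diag_conj[OF U] divide_left_mono) auto
    have XF: "mtrace (X * F) = real r"
    proof -
      have "X * F = U * mat_diag n (\<lambda>i. eig X (Suc i) * (1 / c i)) * U\<^sup>T"
        unfolding F_def by (subst eq) (rule diag_conj_mult[OF U])
      then have "mtrace (X * F) = (\<Sum>i<n. eig X (Suc i) * (1 / c i))"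
        using mtrace_diag_conj[OF U] by simp
      also have "\<dots> = (\<Sum>i<n. y i)"
        using cpos by (intro sum.cong) (auto simp: eigs less_imp_neq[symmetric])
      finally show ?thesis using sum_y by simp
    qed
    have lnd: "ln (det F) = - (\<Sum>i<n. ln (c i))"
      unfolding F_def det_diag_conj[OF U] using cpos
      by (subst ln_prod) (auto simp: ln_div less_imp_neq[symmetric] sum_negf)
    have "(\<Sum>i<n. (1 - y i) * ln (c i)) = (\<Sum>i<n. (1 - y i) * ln m)"
    proof (intro sum.cong refl)
      fix i assume "i \<in> {..<n}"
      then show "(1 - y i) * ln (c i) = (1 - y i) * ln m"
        using cm[of i] y(2)[of i] by (cases "y i < 1") auto
    qed
    also have "\<dots> = (real n - real r) * ln m"
      by (simp add: sum_distrib_right[symmetric] sum_subtractf sum_y)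
    finally show "ln (f_spec r X) = mtrace (X * F) - real r - ln (det F) + (real n - real r) * ln (1 / m)"
      unfolding lnf XF lnd using m by (simp add: ln_div algebra_simps sum_subtractf)
  qed
qed

text \<open>A Leibniz term survives only if its permutation sends the rows \<open>J\<close> into the
  first \<open>k\<close> columns, which the pigeonhole principle excludes.\<close>

lemma det_zero_block:
  assumes A: "A \<in> M\<^sub>n" and J: "J \<subseteq> {..<n}" "k < card J"
    and zero: "\<And>i j. i \<in> J \<Longrightarrow> k \<le> j \<Longrightarrow> j < n \<Longrightarrow> A $$ (i, j) = 0"
  shows "det A = 0"
  unfolding det_def'[OF A]
proof (intro sum.neutral ballI)
  fix p assume "p \<in> {p. p permutes {0..<n}}"
  then have p: "p permutes {0..<n}" by simp
  have "\<not> p ` J \<subseteq> {..<k}"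
  proof
    assume "p ` J \<subseteq> {..<k}"
    then have "card (p ` J) \<le> k" using card_mono[of "{..<k}" "p ` J"] by simp
    moreover have "card (p ` J) = card J"
      by (intro card_image inj_on_subset[OF permutes_inj[OF p]]) auto
    ultimately show False using J by simp
  qed
  then obtain i where i: "i \<in> J" "k \<le> p i" by (auto simp: image_subset_iff not_less)
  moreover have "p i < n" using i J permutes_in_image[OF p, of i] by auto
  ultimately have "A $$ (i, p i) = 0" using zero by simp
  then have "(\<Prod>i = 0..<n. A $$ (i, p i)) = 0" using i J by (intro prod_zero bexI[of _ i]) auto
  then show "signof p * (\<Prod>i = 0..<n. A $$ (i, p i)) = 0" by simp
qed

lemma psd_diag_congruence:
  assumes V: "V \<in> M\<^sub>n" and x: "\<And>i. i < n \<Longrightarrow> 0 \<le> x i"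
  shows "psd_mat (V * mat_diag n x * V\<^sup>T)"
proof -
  define L where "L = mat_diag n (\<lambda>i. sqrt (x i)) * V\<^sup>T"
  have L: "L \<in> M\<^sub>n" using V by (simp add: L_def)
  have "L\<^sup>T * L = V * (mat_diag n (\<lambda>i. sqrt (x i)) * mat_diag n (\<lambda>i. sqrt (x i))) * V\<^sup>T"
    unfolding L_def using V by (simp add: transpose_mult[of _ n n _ n] sq_simps del: mat_diag_diag)
  also have "\<dots> = V * mat_diag n x * V\<^sup>T"
    unfolding mat_diag_diag
    using x by (subst mat_diag_cong[of "\<lambda>k. sqrt (x k) * sqrt (x k)" x]) auto
  finally show ?thesis using psd_gram[OF L] by simp
qed

text \<open>Keeps \<open>ln\<close> away from its default value at 0. Entries at most 1 with sum
  \<open>r\<close> force at least \<open>r\<close> nonzero weights. If eigenvalue number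
  \<open>r\<close> vanished, the eigenvectors from position \<open>r\<close> on would be orthogonal
  to all columns of \<open>V\<close> with nonzero weight, giving the invertible \<open>Z\<close> too
  large a zero block.\<close>

lemma eig_pos_of_capped:
  assumes V: "V \<in> M\<^sub>n" "det V \<noteq> 0" and r: "0 < r" "r \<le> n"
    and x: "\<And>i. i < n \<Longrightarrow> 0 \<le> x i" "\<And>i. i < n \<Longrightarrow> x i \<le> 1" "(\<Sum>i<n. x i) = real r"
  shows "0 < eig (V * mat_diag n x * V\<^sup>T) r"
proof (rule ccontr)
  define X where "X = V * mat_diag n x * V\<^sup>T"
  assume "\<not> 0 < eig (V * mat_diag n x * V\<^sup>T) r"
  then have neg: "eig X (Suc (r - 1)) \<le> 0" using r by (simp add: X_def)
  have X: "psd_mat X" unfolding X_def using psd_diag_congruence V x by blast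
  then have Xc: "X \<in> M\<^sub>n" "X\<^sup>T = X" by (auto simp: psd_mat_def)
  obtain U where U: "U \<in> M\<^sub>n" "U\<^sup>T * U = I" and eq: "X = U * mat_diag n (\<lambda>i. eig X (Suc i)) * U\<^sup>T"
    using eig_diagonalization[OF Xc] .
  define Z where "Z = V\<^sup>T * U"
  have Z: "Z \<in> M\<^sub>n" using V U by (simp add: Z_def)
  have detZ: "det Z \<noteq> 0"
    unfolding Z_def using V U det_orthogonal[OF U] by (auto simp: det_mult[of _ n] det_transpose[of _ n])
  define J where "J = {i. i < n \<and> x i \<noteq> 0}"
  have "real r = (\<Sum>i\<in>J. x i)"
    unfolding x(3)[symmetric] J_def by (intro sum.mono_neutral_right) auto
  also have "\<dots> \<le> real (card J)"
    using sum_mono[of J x "\<lambda>_. 1"] x(2) by (auto simp: J_def)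
  finally have card: "r - 1 < card J" using r by linarith
  have "det Z = 0"
  proof (rule det_zero_block[OF Z _ card])
    fix i j assume i: "i \<in> J" and j: "r - 1 \<le> j" "j < n"
    have "eig X (Suc j) = 0"
      using eig_antimono[OF Xc j] neg psd_eig_nonneg[OF X j(2)] by simp
    then have "(U\<^sup>T * X * U) $$ (j, j) = 0"
      by (subst eq, subst diag_conj_invert[OF U]) (use j in simp)
    moreover have "U\<^sup>T * X * U = Z\<^sup>T * mat_diag n x * Z"
      unfolding X_def Z_def using U(1) V(1) by (simp add: transpose_mult[of _ n n _ n] sq_simps)
    moreover have "(Z\<^sup>T * mat_diag n x * Z) $$ (j, j) = (\<Sum>l<n. x l * (Z $$ (l, j))\<^sup>2)"
      using diag_conj_entry[of "Z\<^sup>T" j j x] Z j by (simp add: power2_eq_square mult_ac)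
    ultimately have "(\<Sum>l<n. x l * (Z $$ (l, j))\<^sup>2) = 0" by simp
    then have "x i * (Z $$ (i, j))\<^sup>2 = 0"
      using i x(1) by (subst (asm) sum_nonneg_eq_0_iff) (auto simp: J_def)
    then show "Z $$ (i, j) = 0" using i by (simp add: J_def)
  qed (auto simp: J_def)
  with detZ show False by simp
qed

end

section \<open>Maxima over the capped simplex\<close>

text \<open>Bolzano-Weierstrass one coordinate at a time: a monotone subsequence for the new
  coordinate, drawn from the one already found, preserves the earlier limits.\<close>

lemma coordinatewise_convergent_subseq:
  fixes X :: "nat \<Rightarrow> nat \<Rightarrow> real"
  assumes "\<And>k i. i < n \<Longrightarrow> 0 \<le> X k i \<and> X k i \<le> 1"
  shows "\<exists>\<phi> l. strict_mono (\<phi> :: nat \<Rightarrow> nat) \<and> (\<forall>i<n. (\<lambda>k. X (\<phi> k) i) \<longlonglongrightarrow> l i)"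
  using assms
proof (induction n)
  case 0
  show ?case by (rule exI[of _ id]) (auto simp: strict_mono_def)
next
  case (Suc n)
  then obtain \<phi> l where \<phi>: "strict_mono (\<phi> :: nat \<Rightarrow> nat)"
    and l: "\<And>i. i < n \<Longrightarrow> (\<lambda>k. X (\<phi> k) i) \<longlonglongrightarrow> l i"
    by (metis less_SucI)
  obtain \<psi> where \<psi>: "strict_mono (\<psi> :: nat \<Rightarrow> nat)" "monoseq (\<lambda>k. X (\<phi> (\<psi> k)) n)"
    using seq_monosub[of "\<lambda>k. X (\<phi> k) n"] by blast
  have "Bseq (\<lambda>k. X (\<phi> (\<psi> k)) n)"
    using Suc.prems[of n] by (intro BseqI'[of _ 1]) auto
  then obtain a where a: "(\<lambda>k. X (\<phi> (\<psi> k)) n) \<longlonglongrightarrow> a"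
    using Bseq_monoseq_convergent[OF _ \<psi>(2)] by (auto simp: convergent_def)
  have "(\<lambda>k. X (\<phi> (\<psi> k)) i) \<longlonglongrightarrow> (l(n := a)) i" if "i < Suc n" for i
    using that a LIMSEQ_subseq_LIMSEQ[OF l \<psi>(1), of i] by (cases "i = n") (auto simp: comp_def)
  moreover have "strict_mono (\<lambda>k. \<phi> (\<psi> k))" using \<phi> \<psi>(1) by (simp add: strict_mono_def)
  ultimately show ?case
    by (intro exI[of _ "\<lambda>k. \<phi> (\<psi> k)"] exI[of _ "l(n := a)"] conjI) auto
qed

text \<open>A function with an affine majorant touching it at every point is upper semicontinuous, hence
  attains its maximum; this avoids proving continuity of \<^const>\<open>f_spec\<close>.\<close>

lemma capped_simplex_attains_max:
  assumes "r \<le> n"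
    and maj: "\<And>y. y \<in> capped_simplex n r \<Longrightarrow> \<exists>a c. (\<forall>x\<in>capped_simplex n r. f x \<le> a + (\<Sum>i<n. c i * x $ i)) \<and>
      f y = a + (\<Sum>i<n. c i * y $ i)"
  shows "\<exists>y\<in>capped_simplex n r. \<forall>x\<in>capped_simplex n r. f x \<le> f y"
proof -
  let ?K = "capped_simplex n r"
  define p where "p = vec n (\<lambda>i. if i < r then 1 else 0 :: real)"
  have "(\<Sum>i<n. p $ i) = (\<Sum>i<r. 1)"
    using assms(1) unfolding p_def by (intro sum.mono_neutral_cong_right) auto
  then have p: "p \<in> ?K" by (auto simp: capped_simplex_def p_def)
  \<comment> \<open>The majorant at the sample point \<open>p\<close> serves only to make the
    supremum finite.\<close>
  obtain a c where ac: "\<And>x. x \<in> ?K \<Longrightarrow> f x \<le> a + (\<Sum>i<n. c i * x $ i)"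
    using maj[OF p] by blast
  have "f x \<le> a + (\<Sum>i<n. \<bar>c i\<bar>)" if "x \<in> ?K" for x
  proof -
    have "c i * x $ i \<le> \<bar>c i\<bar>" if "i < n" for i
    proof -
      have "\<bar>c i * x $ i\<bar> \<le> \<bar>c i\<bar> * 1"
        unfolding abs_mult using \<open>x \<in> ?K\<close> that by (intro mult_left_mono) (auto simp: capped_simplex_def)
      then show ?thesis by simp
    qed
    then have "(\<Sum>i<n. c i * x $ i) \<le> (\<Sum>i<n. \<bar>c i\<bar>)" by (intro sum_mono) auto
    with ac[OF that] show ?thesis by simp
  qed
  then have bdd: "bdd_above (f ` ?K)" by (rule bdd_aboveI2)
  define m where "m = Sup (f ` ?K)"
  have "\<exists>x\<in>?K. m - 1 / real (Suc k) < f x" for k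
  proof -
    have "m - 1 / real (Suc k) < m" by simp
    then show ?thesis unfolding m_def using p bdd by (subst (asm) less_cSup_iff) auto
  qed
  then obtain x where x: "\<And>k. x k \<in> ?K" "\<And>k. m - 1 / real (Suc k) < f (x k)" by metis
  have bounds: "0 \<le> x k $ i \<and> x k $ i \<le> 1" if "i < n" for k i
    using x(1)[of k] that by (auto simp: capped_simplex_def)
  obtain \<phi> l where \<phi>: "strict_mono (\<phi> :: nat \<Rightarrow> nat)"
    and l: "\<And>i. i < n \<Longrightarrow> (\<lambda>k. x (\<phi> k) $ i) \<longlonglongrightarrow> l i"
    using coordinatewise_convergent_subseq[of n "\<lambda>k i. x k $ i"] bounds by blast
  define y where "y = vec n l"
  have y: "y \<in> ?K"
  proof -
    have "0 \<le> l i" "l i \<le> 1" if "i < n" for i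
      using LIMSEQ_le_const[OF l[OF that]] LIMSEQ_le_const2[OF l[OF that]] bounds[OF that] by auto
    moreover have "(\<lambda>k. \<Sum>i<n. x (\<phi> k) $ i) \<longlonglongrightarrow> (\<Sum>i<n. l i)"
      using l by (intro tendsto_sum) auto
    then have "(\<Sum>i<n. l i) = real r"
      using x(1) by (simp add: capped_simplex_def LIMSEQ_const_iff)
    ultimately show ?thesis by (simp add: capped_simplex_def y_def)
  qed
  \<comment> \<open>A fresh majorant, touching at the limit point: it dominates \<open>f\<close>
    along the sequence and, being continuous, tends to \<open>f y\<close>.\<close>
  obtain a c where ac: "\<And>x. x \<in> ?K \<Longrightarrow> f x \<le> a + (\<Sum>i<n. c i * x $ i)" "f y = a + (\<Sum>i<n. c i * y $ i)"
    using maj[OF y] by blast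
  have "m \<le> f y"
  proof (rule LIMSEQ_le)
    have "(\<lambda>k. m - 1 / real (Suc k)) \<longlonglongrightarrow> m - 0"
      using LIMSEQ_inverse_real_of_nat by (intro tendsto_diff tendsto_const) (simp add: inverse_eq_divide)
    from LIMSEQ_subseq_LIMSEQ[OF this \<phi>] show "(\<lambda>k. m - 1 / real (Suc (\<phi> k))) \<longlonglongrightarrow> m"
      by (simp add: comp_def)
    have "(\<lambda>k. a + (\<Sum>i<n. c i * x (\<phi> k) $ i)) \<longlonglongrightarrow> a + (\<Sum>i<n. c i * l i)"
      using l by (intro tendsto_intros) auto
    then show "(\<lambda>k. a + (\<Sum>i<n. c i * x (\<phi> k) $ i)) \<longlonglongrightarrow> f y"
      unfolding ac(2) by (simp add: y_def)
    show "\<exists>N. \<forall>k\<ge>N. m - 1 / real (Suc (\<phi> k)) \<le> a + (\<Sum>i<n. c i * x (\<phi> k) $ i)"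
      using x(2) ac(1)[OF x(1)] by (meson less_imp_le order_trans)
  qed
  moreover have "f x \<le> m" if "x \<in> ?K" for x
    unfolding m_def using bdd that by (intro cSup_upper) auto
  ultimately show ?thesis using y by (meson order_trans)
qed

lemma max_on_eq:
  assumes "y \<in> K" "\<And>x. x \<in> K \<Longrightarrow> f x \<le> f y"
  shows "max_on K f = f y"
  unfolding max_on_def by (rule Greatest_equality) (use assms in auto)

text \<open>\<open>max_on\<close> is a \<open>GREATEST\<close> and says nothing until attainment is
  known; the later bounds use it through these two facts alone.\<close>

lemma max_on_capped_simplex:
  assumes "r \<le> n"
    and "\<And>y. y \<in> capped_simplex n r \<Longrightarrow> \<exists>a c. (\<forall>x\<in>capped_simplex n r. f x \<le> a + (\<Sum>i<n. c i * x $ i)) \<and>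
      f y = a + (\<Sum>i<n. c i * y $ i)"
  shows "x \<in> capped_simplex n r \<Longrightarrow> f x \<le> max_on (capped_simplex n r) f"
    and "(\<And>x. x \<in> capped_simplex n r \<Longrightarrow> f x \<le> b) \<Longrightarrow> max_on (capped_simplex n r) f \<le> b"
proof -
  obtain y where y: "y \<in> capped_simplex n r" "\<And>x. x \<in> capped_simplex n r \<Longrightarrow> f x \<le> f y"
    using capped_simplex_attains_max[OF assms] by blast
  have eq: "max_on (capped_simplex n r) f = f y" by (rule max_on_eq[of y _ f, OF y])
  show "x \<in> capped_simplex n r \<Longrightarrow> f x \<le> max_on (capped_simplex n r) f" using eq y by simp
  show "(\<And>x. x \<in> capped_simplex n r \<Longrightarrow> f x \<le> b) \<Longrightarrow> max_on (capped_simplex n r) f \<le> b"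
    using eq y by simp
qed

section \<open>Quadratic forms and Loewner bounds\<close>

context square_dim
begin

lemma psd_majorized_trace:
  assumes "psd_mat A"
  shows "majorized A (mtrace A)"
proof -
  obtain U d where U: "U \<in> M\<^sub>n" "U\<^sup>T * U = I" and eq: "A = U * mat_diag n d * U\<^sup>T"
    and d: "\<And>k. k < n \<Longrightarrow> 0 \<le> d k"
    by (rule spectral_psd[OF assms]) blast
  show ?thesis unfolding eq mtrace_diag_conj[OF U]
    using d by (intro majorized_diag_conj[OF U] member_le_sum) auto
qed

lemma quad_form_add:
  assumes "A \<in> M\<^sub>n" "B \<in> M\<^sub>n" "v \<in> carrier_vec n"
  shows "v \<bullet> ((A + B) *\<^sub>v v) = v \<bullet> (A *\<^sub>v v) + v \<bullet> (B *\<^sub>v v)"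
  using assms by (simp add: add_mult_distrib_mat_vec[of _ n n] scalar_prod_add_distrib[of _ n]
      mult_mat_vec_carrier[of _ n n])

lemma quad_form_minus:
  assumes "A \<in> M\<^sub>n" "B \<in> M\<^sub>n" "v \<in> carrier_vec n"
  shows "v \<bullet> ((A - B) *\<^sub>v v) = v \<bullet> (A *\<^sub>v v) - v \<bullet> (B *\<^sub>v v)"
  using assms by (simp add: minus_mult_distrib_mat_vec[of _ n n] scalar_prod_minus_distrib[of _ n]
      mult_mat_vec_carrier[of _ n n])

lemma quad_form_smult:
  assumes "A \<in> M\<^sub>n" "v \<in> carrier_vec n"
  shows "v \<bullet> ((c \<cdot>\<^sub>m A) *\<^sub>v v) = c * (v \<bullet> (A *\<^sub>v v))"
proof -
  have "(c \<cdot>\<^sub>m A) *\<^sub>v v = c \<cdot>\<^sub>v (A *\<^sub>v v)" using assms by (intro eq_vecI) auto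
  then show ?thesis using assms by (simp add: mult_mat_vec_carrier[of _ n n])
qed

lemma transpose_smult: "(c \<cdot>\<^sub>m A)\<^sup>T = c \<cdot>\<^sub>m A\<^sup>T" for A :: "real mat"
  by (intro eq_matI) auto

lemma psd_add: "psd_mat A \<Longrightarrow> psd_mat B \<Longrightarrow> psd_mat (A + B)"
  by (auto simp: psd_mat_def quad_form_add transpose_add[of _ n n])

lemma psd_smult: "psd_mat A \<Longrightarrow> 0 \<le> c \<Longrightarrow> psd_mat (c \<cdot>\<^sub>m A)"
  by (auto simp: psd_mat_def quad_form_smult transpose_smult)

lemma pos_def_add_psd:
  assumes "A \<in> M\<^sub>n" "pos_def_mat A" "psd_mat B"
  shows "pos_def_mat (A + B)"
proof -
  have "0 < v \<bullet> ((A + B) *\<^sub>v v)" if "v \<in> carrier_vec n" "v \<noteq> 0\<^sub>v n" for v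
  proof -
    have "0 < v \<bullet> (A *\<^sub>v v)" using assms pos_def_mat_sq[OF assms(1)] that by auto
    moreover have "0 \<le> v \<bullet> (B *\<^sub>v v)" using assms(3) that by (auto simp: psd_mat_def)
    ultimately show ?thesis using assms that
      by (subst quad_form_add) (auto simp: psd_mat_def)
  qed
  moreover have "(A + B)\<^sup>T = A + B"
    using assms by (simp add: transpose_add[of _ n n] psd_mat_def pos_def_mat_def)
  moreover have "A + B \<in> M\<^sub>n" using assms by (auto simp: psd_mat_def)
  ultimately show ?thesis by (subst pos_def_mat_sq) auto
qed

lemma pos_def_one: "pos_def_mat I"
  using pos_def_diag_conj[of I "\<lambda>_. 1"] by simp

text \<open>Symmetry and idempotence turn the trace into a sum of quadratic forms of
  \<open>F\<close> at the columns of \<open>R\<close>, whose squared lengths add up to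
  \<open>mtrace R\<close>.\<close>

lemma majorized_trace_projection:
  assumes R: "R \<in> M\<^sub>n" "R\<^sup>T = R" "R * R = R" and F: "F \<in> M\<^sub>n" "majorized F \<sigma>"
  shows "mtrace (R * F) \<le> \<sigma> * mtrace R"
proof -
  have "mtrace (R * F) = mtrace (R * (R * F))"
    using R F by (simp flip: assoc_mult_mat[of R n n R n F n])
  also have "\<dots> = mtrace (R\<^sup>T * F * R)"
    using R F by (subst mtrace_mult_comm[of _ n n]) (auto simp: sq_simps)
  also have "\<dots> = (\<Sum>k<n. col R k \<bullet> (F *\<^sub>v col R k))"
    using R(1) F(1) unfolding mtrace_def
    by (intro sum.cong) (auto simp: quad_form_entry simp del: index_mult_mat(1) assoc_mult_mat)
  also have "\<dots> \<le> (\<Sum>k<n. \<sigma> * (col R k \<bullet> col R k))"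
    using R F by (intro sum_mono) (auto simp: majorized_def)
  also have "(\<Sum>k<n. \<sigma> * (col R k \<bullet> col R k)) = \<sigma> * mtrace (R\<^sup>T * R)"
    using R(1) by (simp add: mtrace_def sum_distrib_left)
  finally show ?thesis using R by simp
qed

section \<open>Principal minors and dual certificates\<close>

lemma ind_mult_ind: "ind S * ind T = ind (S \<inter> T)"
  unfolding ind_def mat_diag_diag by (rule mat_diag_cong) auto

lemma one_minus_ind: "I - ind S = ind (- S)"
  by (intro eq_matI) (auto simp: ind_def)

lemma ind_plus_compl: "ind S + ind (- S) = I"
  by (intro eq_matI) (auto simp: ind_def)

lemma ind_sandwich_entry:
  assumes "A \<in> M\<^sub>n" "i < n" "j < n"
  shows "(ind S * A * ind T) $$ (i, j) = (if i \<in> S \<and> j \<in> T then A $$ (i, j) else 0)"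
  using assms by (simp add: ind_def mult_mat_diag_index[of _ n n] mat_diag_mult_index[of _ n n]
      del: index_mult_mat(1))

text \<open>The determinant of the principal submatrix of \<open>M\<close> indexed by \<open>S\<close>.\<close>

definition pminor :: "real mat \<Rightarrow> nat set \<Rightarrow> real" where
  "pminor M S = det (I + ind S * (M - I))"

text \<open>Idempotence of \<open>ind S\<close> and Sylvester's identity reconcile two paddings: the
  one-sided form suits exchanges and inverses, the symmetric one is the matrix \<open>G\<close> of a
  Gram block.\<close>

lemma pminor_sym:
  assumes "M \<in> M\<^sub>n"
  shows "pminor M S = det (I + ind S * (M - I) * ind S)"
proof -
  have "det (I + ind S * ((M - I) * ind S)) = det (I + (M - I) * ind S * ind S)"
    using assms by (intro det_one_plus_mult_comm[of _ n n]) auto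
  also have "(M - I) * ind S * ind S = (M - I) * ind S"
    using assms by (simp add: sq_simps)
  also have "det (I + (M - I) * ind S) = det (I + ind S * (M - I))"
    using assms by (intro det_one_plus_mult_comm[of _ n n]) auto
  finally show ?thesis using assms by (simp add: pminor_def sq_simps)
qed

end

text \<open>The inverse \<open>H\<close> is a parameter, so that the dual basis can instantiate the
  same locale with the two inverse matrices interchanged.\<close>

locale gram_block = square_dim n for n +
  fixes V H :: "real mat" and S :: "nat set"
  assumes V: "V \<in> M\<^sub>n" and detV: "det V \<noteq> 0" and S: "S \<subseteq> {..<n}" and H: "H \<in> M\<^sub>n"
    and GH0: "(I + ind S * (V\<^sup>T * V - I) * ind S) * H = I"
begin

abbreviation D where "D \<equiv> ind S"
abbreviation E where "E \<equiv> ind (- S)"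
definition M where "M = V\<^sup>T * V"
definition Q where "Q = M - I"
definition G where "G = I + D * Q * D"
definition P where "P = V * D * H * V\<^sup>T"
definition cert where "cert c = V * D * V\<^sup>T + c \<cdot>\<^sub>m (I - P)"

text \<open>Up to reordering, \<open>G\<close> is block diagonal with blocks \<open>M\<^sub>S\<^sub>S\<close> and the identity, and \<open>H\<close> is its
  inverse. Hence \<open>P\<close> is the orthogonal projection onto the span of the columns of \<open>V\<close> in \<open>S\<close>.\<close>

lemma carriers [simp]: "V \<in> M\<^sub>n" "H \<in> M\<^sub>n" "M \<in> M\<^sub>n" "Q \<in> M\<^sub>n" "G \<in> M\<^sub>n" "P \<in> M\<^sub>n" "cert c \<in> M\<^sub>n"
  using V H by (auto simp: M_def Q_def G_def P_def cert_def)

lemma dims [simp]: "dim_row V = n" "dim_col V = n" "dim_row H = n" "dim_col H = n"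
  "dim_row M = n" "dim_col M = n" "dim_row Q = n" "dim_col Q = n" "dim_row G = n" "dim_col G = n"
  "dim_row P = n" "dim_col P = n" "dim_row (cert c) = n" "dim_col (cert c) = n"
  using carriers by (auto simp only: carrier_matD)

lemma GH: "G * H = I" and HG: "H * G = I"
proof -
  show "G * H = I" using GH0 by (simp add: G_def Q_def M_def)
  then show "H * G = I" by (rule left_inverse_imp_right_inverse[rotated 2]) auto
qed

lemma MT [simp]: "M\<^sup>T = M" by (simp add: M_def transpose_mult[of _ n n _ n])
lemma QT [simp]: "Q\<^sup>T = Q" by (simp add: Q_def transpose_minus[of _ n n])
lemma GT [simp]: "G\<^sup>T = G"
  by (simp add: G_def transpose_add[of _ n n] transpose_mult[of _ n n _ n] sq_simps)

lemma HT [simp]: "H\<^sup>T = H"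
proof -
  have "H\<^sup>T * G = I" using arg_cong[OF GH, of transpose_mat] by (simp add: transpose_mult[of _ n n _ n])
  then have "H\<^sup>T * G * H = H" by simp
  then show ?thesis by (simp add: sq_simps GH)
qed

lemma DE: "D * E = 0\<^sub>m n n" and ED: "E * D = 0\<^sub>m n n"
  by (auto simp: ind_mult_ind ind_def intro!: eq_matI)

lemma DG: "D * G = D * M * D" and GD: "G * D = D * G"
proof -
  have *: "D * (D * X) = D * X" if "X \<in> M\<^sub>n" for X
    using that by (simp flip: assoc_mult_mat[of D n n D n X n])
  show "D * G = D * M * D"
    by (intro entries_eqI) (simp_all add: G_def Q_def sq_simps * del: index_mult_mat(1))
  show "G * D = D * G"
    by (intro entries_eqI) (simp_all add: G_def Q_def sq_simps * del: index_mult_mat(1))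
qed

lemma HD: "H * D = D * H"
proof -
  have "H * D = H * D * (G * H)" by (simp add: GH)
  also have "\<dots> = H * (D * G) * H" by (simp add: sq_simps)
  also have "\<dots> = (H * G) * (D * H)" by (simp add: GD[symmetric] sq_simps)
  finally show ?thesis by (simp add: HG)
qed

lemma GE: "G * E = E"
proof -
  have "G * E = E + D * Q * (D * E)" by (simp add: G_def sq_simps)
  then show ?thesis by (simp add: DE sq_simps)
qed

lemma HE: "H * E = E"
proof -
  have "H * E = H * (G * E)" by (simp add: GE)
  also have "\<dots> = (H * G) * E" by (simp add: sq_simps)
  finally show ?thesis by (simp add: HG)
qed

text \<open>\<open>sq_simps\<close> nests products to the right, so each cancellation and
  commutation rule is restated in front of an arbitrary tail \<open>X\<close>.\<close>

lemma reassoc: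
  assumes "X \<in> M\<^sub>n"
  shows "D * (D * X) = D * X" "G * (H * X) = X" "H * (G * X) = X" "H * (D * X) = D * (H * X)"
    "G * (D * X) = D * (G * X)" "D * (M * (D * X)) = D * (G * X)" "V\<^sup>T * (V * X) = M * X"
    "D * (H * (M * (D * X))) = D * X"
proof -
  have fold: "A * (B * X) = C * X" if "A \<in> M\<^sub>n" "B \<in> M\<^sub>n" "A * B = C" for A B C
    using assms that by (simp flip: assoc_mult_mat[of A n n B n X n])
  show "D * (D * X) = D * X" "G * (H * X) = X" "H * (G * X) = X"
    using fold[OF _ _ ind_idem] fold[OF _ _ GH] fold[OF _ _ HG] assms by auto
  show HDX: "H * (D * X) = D * (H * X)" and "G * (D * X) = D * (G * X)"
    using fold[OF _ _ HD] fold[OF _ _ GD] assms by (auto simp: sq_simps)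
  show DMD: "D * (M * (D * X)) = D * (G * X)"
  proof -
    have "D * (M * (D * X)) = (D * M * D) * X" using assms by (simp add: sq_simps)
    also have "\<dots> = D * (G * X)" unfolding DG[symmetric] using assms by (simp add: sq_simps)
    finally show ?thesis .
  qed
  show "V\<^sup>T * (V * X) = M * X" using fold[of "V\<^sup>T" V M] by (simp add: M_def)
  have "D * (H * (M * (D * X))) = H * D * (M * (D * X))"
    using assms by (simp add: HD sq_simps)
  also have "\<dots> = H * (D * (G * X))" using assms by (simp add: sq_simps DMD)
  also have "\<dots> = H * (G * (D * X))"
    using assms fold[OF _ _ GD] by (simp add: sq_simps)
  also have "\<dots> = D * X" using fold[of H G I] assms HG
    by (simp flip: assoc_mult_mat[of H n n G n "D * X" n])
  finally show "D * (H * (M * (D * X))) = D * X" .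
qed

lemmas closed_forms = reassoc GH HG HD GD ind_idem M_def[symmetric]
lemma D_M_D: "D * (M * D) = D * G" using DG by (simp add: sq_simps)
lemma D_H_M_D: "D * (H * (M * D)) = D"
  using reassoc(8)[of I] by simp

lemma det_G: "det G \<noteq> 0"
  using det_mult_inverse[OF _ _ GH] by auto

lemma det_H: "det G * det H = 1"
  using det_mult_inverse[OF _ _ GH] by auto

lemma det_G_pminor: "det G = pminor M S"
  by (simp add: pminor_sym G_def Q_def)

lemma card_S: "card S \<le> n"
  using card_mono[OF _ S] by simp

lemma sum_S: "(\<Sum>i<n. if i \<in> S then g i else 0) = (\<Sum>i\<in>S. g i)" for g :: "nat \<Rightarrow> real"
proof -
  have "(\<Sum>i<n. if i \<in> S then g i else 0) = (\<Sum>i\<in>{..<n} \<inter> S. g i)"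
    by (simp add: sum.If_cases Int_def)
  also have "{..<n} \<inter> S = S" using S by auto
  finally show ?thesis .
qed

text \<open>On the span of the selected columns the eigenvalues of \<open>cert c\<close> are those
  of their Gram matrix, on the complement they are \<open>c\<close>. The computation extracts
  \<open>c\<close> and moves the rest to \<open>G * (E + D / c)\<close> by Sylvester's
  identity.\<close>

lemma det_cert:
  assumes c: "0 < c"
  shows "det (cert c) = c ^ (n - card S) * det G"
proof -
  define R where "R = (1 / c) \<cdot>\<^sub>m D - D * H"
  have R: "R \<in> M\<^sub>n" by (simp add: R_def)
  have DR: "D * R = R" and RD: "R * D = R"
    by (auto simp: R_def sq_simps closed_forms)
  have "cert c = c \<cdot>\<^sub>m (I + V * (R * V\<^sup>T))"
    unfolding cert_def P_def R_def using c
    by (intro entries_eqI) (simp_all add: sq_simps algebra_simps del: index_mult_mat(1))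
  then have "det (cert c) = c ^ n * det (I + V * (R * V\<^sup>T))"
    using R by simp
  also have "det (I + V * (R * V\<^sup>T)) = det (I + D * (R * M))"
    using R by (subst det_one_plus_mult_comm[of _ n n])
      (auto simp: sq_simps M_def DR simp flip: assoc_mult_mat[of D n n R n _ n])
  also have "\<dots> = det (I + R * M * D)"
    using R by (intro det_one_plus_mult_comm[of _ n n]) auto
  also have "I + R * M * D = G * (E + (1 / c) \<cdot>\<^sub>m D)"
  proof -
    have "R * M * D = R * (D * (M * D))"
      using R by (simp add: sq_simps RD flip: assoc_mult_mat[of R n n D n _ n])
    also have "\<dots> = R * G"
      using R by (simp add: D_M_D RD flip: assoc_mult_mat[of R n n D n _ n])
    also have "\<dots> = (1 / c) \<cdot>\<^sub>m (D * G) - D"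
      unfolding R_def by (simp add: sq_simps HG)
    finally have "I + R * M * D = E + (1 / c) \<cdot>\<^sub>m (D * G)"
      by (intro entries_eqI) (auto simp: one_minus_ind[symmetric] simp del: index_mult_mat(1))
    then show ?thesis by (simp add: sq_simps GE GD)
  qed
  also have "det \<dots> = det G * (\<Prod>i<n. if i \<in> S then 1 / c else 1)"
  proof -
    have "E + (1 / c) \<cdot>\<^sub>m D = mat_diag n (\<lambda>i. if i \<in> S then 1 / c else 1)"
      by (intro eq_matI) (auto simp: ind_def)
    then show ?thesis by (simp add: det_mult[of _ n])
  qed
  also have "(\<Prod>i<n. if i \<in> S then 1 / c else 1) = (1 / c) ^ card S"
  proof -
    have "(\<Prod>i<n. if i \<in> S then 1 / c else 1) = (\<Prod>i\<in>{..<n} \<inter> S. 1 / c)"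
      by (simp add: prod.If_cases Int_def)
    also have "{..<n} \<inter> S = S" using S by auto
    finally show ?thesis by simp
  qed
  finally show ?thesis using c card_S by (simp add: power_divide power_diff)
qed

lemma P_sym: "P\<^sup>T = P" and P_idem: "P * P = P"
  by (simp_all add: P_def transpose_mult[of _ n n _ n] sq_simps closed_forms)

lemma psd_VDV: "psd_mat (V * D * V\<^sup>T)"
  unfolding ind_def by (rule psd_diag_congruence) auto

lemma complement_projection: "(I - P)\<^sup>T = I - P" "(I - P) * (I - P) = I - P"
proof -
  show "(I - P)\<^sup>T = I - P" by (simp add: transpose_minus[of _ n n] P_sym)
  show "(I - P) * (I - P) = I - P"
    by (intro entries_eqI) (simp_all add: sq_simps P_idem del: index_mult_mat(1))
qed

lemma psd_cert: "0 \<le> c \<Longrightarrow> psd_mat (cert c)"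
  unfolding cert_def using psd_gram[of "I - P"]
  by (intro psd_add psd_smult psd_VDV) (simp_all add: complement_projection)

lemma pos_def_cert: "0 < c \<Longrightarrow> pos_def_mat (cert c)"
  using det_cert[of c] det_G by (intro psd_det_imp_pos_def psd_cert) auto

lemma det_G_pos: "0 < det G"
  using pos_def_det_pos[OF _ pos_def_cert[of 1]] det_cert[of 1] by simp

lemma mtrace_P: "mtrace P = real (card S)"
proof -
  have "mtrace P = mtrace (V * (D * (H * V\<^sup>T)))" by (simp add: P_def sq_simps)
  also have "\<dots> = mtrace (D * (D * (H * M)))"
    by (subst mtrace_mult_comm[of _ n n]) (auto simp: sq_simps closed_forms)
  also have "\<dots> = mtrace D"
    by (subst mtrace_mult_comm[of _ n n]) (auto simp: sq_simps D_H_M_D)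
  also have "\<dots> = real (card S)" using sum_S[of "\<lambda>_. 1"] by (simp add: ind_def)
  finally show ?thesis .
qed

lemma PVD: "P * (V * D) = V * D"
  by (simp add: P_def sq_simps closed_forms D_H_M_D)

text \<open>\<open>V D V^T\<close> sees only \<open>P v\<close>, and its largest eigenvalue is at
  most its trace. So the first summand costs at most \<open>c |P v|^2\<close>, and the second
  supplies \<open>c\<close> times the rest of \<open>|v|^2\<close>.\<close>

lemma majorized_cert:
  assumes c: "mtrace (V * D * V\<^sup>T) \<le> c"
  shows "majorized (cert c) c"
  unfolding majorized_def
proof
  fix v :: "real vec" assume v: "v \<in> carrier_vec n"
  define A where "A = V * D * V\<^sup>T"
  have A: "A \<in> M\<^sub>n" by (simp add: A_def)
  have "P * A * P = A"
  proof -
    have "P * A * P = (P * (V * D)) * (P * (V * D))\<^sup>T"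
      by (simp add: A_def transpose_mult[of _ n n _ n] P_sym sq_simps closed_forms)
    then show ?thesis
      by (simp add: PVD A_def transpose_mult[of _ n n _ n] sq_simps closed_forms)
  qed
  have dual: "x \<bullet> (P *\<^sub>v y) = (P *\<^sub>v x) \<bullet> y" if "x \<in> carrier_vec n" "y \<in> carrier_vec n" for x y
    using transpose_vec_mult_scalar[of P n n y x] that by (simp add: P_sym)
  let ?w = "P *\<^sub>v v"
  have w: "?w \<in> carrier_vec n" using v by (intro mult_mat_vec_carrier[of _ n n]) auto
  have "v \<bullet> (A *\<^sub>v v) = v \<bullet> (P *\<^sub>v (A *\<^sub>v ?w))"
    using v A by (subst \<open>P * A * P = A\<close>[symmetric])
      (simp add: assoc_mult_mat_vec[of _ n n _ n] mult_mat_vec_carrier[of _ n n])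
  also have "\<dots> = ?w \<bullet> (A *\<^sub>v ?w)"
    using v w A by (intro dual mult_mat_vec_carrier[of _ n n]) auto
  also have "\<dots> \<le> mtrace A * (?w \<bullet> ?w)"
    using psd_majorized_trace[OF psd_VDV] w by (simp add: majorized_def A_def)
  also have "\<dots> \<le> c * (?w \<bullet> ?w)"
    using c scalar_prod_self_nonneg[of ?w] by (intro mult_right_mono) (auto simp: A_def)
  also have "?w \<bullet> ?w = v \<bullet> (P *\<^sub>v v)"
  proof -
    have "v \<bullet> (P *\<^sub>v v) = v \<bullet> (P *\<^sub>v ?w)"
      using v by (simp add: P_idem flip: assoc_mult_mat_vec[of P n n P n])
    then show ?thesis using dual[OF v w] by simp
  qed
  finally have "v \<bullet> (A *\<^sub>v v) \<le> c * (v \<bullet> (P *\<^sub>v v))" .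
  moreover have "v \<bullet> (cert c *\<^sub>v v) = v \<bullet> (A *\<^sub>v v) + c * (v \<bullet> v - v \<bullet> (P *\<^sub>v v))"
    unfolding cert_def A_def[symmetric] using v A
    by (simp add: quad_form_add quad_form_smult quad_form_minus)
  ultimately show "v \<bullet> (cert c *\<^sub>v v) \<le> c * (v \<bullet> v)" by (simp add: algebra_simps)
qed

text \<open>Compare an optimal dual certificate \<open>F\<close> of \<open>V D V\<^sup>T\<close> with \<open>cert (1 / \<sigma>)\<close>.\<close>

lemma ln_det_G_le_f_spec:
  assumes "0 < card S"
  shows "ln (det G) \<le> ln (f_spec (card S) (V * D * V\<^sup>T))"
proof -
  have "0 < eig (V * D * V\<^sup>T) (card S)"
    unfolding ind_def using assms card_S sum_S[of "\<lambda>_. 1"] detV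
    by (intro eig_pos_of_capped) auto
  from ln_f_spec_dual_attained[OF psd_VDV assms card_S this]
  obtain F \<sigma> where F: "F \<in> M\<^sub>n" "pos_def_mat F" and \<sigma>: "0 < \<sigma>" "majorized F \<sigma>"
    and f: "ln (f_spec (card S) (V * D * V\<^sup>T)) =
      mtrace (V * D * V\<^sup>T * F) - real (card S) - ln (det F) + (real n - real (card S)) * ln \<sigma>" .
  \<comment> \<open>The scalar \<open>1 / \<sigma>\<close> reproduces the term
    \<open>(n - card S) ln \<sigma>\<close> of the dual value, while
    \<open>F \<le> \<sigma> I\<close> limits the trace over the complement to its dimension
    \<open>n - card S\<close>.\<close>
  have "ln (det (cert (1 / \<sigma>))) = ln (det G) - (real n - real (card S)) * ln \<sigma>"
    using \<sigma> det_G_pos card_S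
    by (simp add: det_cert ln_mult ln_realpow ln_div of_nat_diff)
  moreover have "ln (det (cert (1 / \<sigma>))) + ln (det F) \<le> mtrace (cert (1 / \<sigma>) * F) - real n"
    using \<sigma> F by (intro ln_det_le_trace_mult pos_def_cert) auto
  moreover have "mtrace (cert (1 / \<sigma>) * F) = mtrace (V * D * V\<^sup>T * F) + 1 / \<sigma> * mtrace ((I - P) * F)"
    unfolding cert_def using F(1)
    by (simp add: add_mult_distrib_mat[of _ n n _ _ n] mult_smult_assoc_mat[of _ n n _ n]
        mtrace_add[of _ n] mtrace_smult[of _ n])
  moreover have "1 / \<sigma> * mtrace ((I - P) * F) \<le> real n - real (card S)"
  proof -
    have "mtrace ((I - P) * F) \<le> \<sigma> * mtrace (I - P)"
      using F \<sigma> by (intro majorized_trace_projection complement_projection) auto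
    also have "mtrace (I - P) = real n - real (card S)"
      by (simp add: mtrace_minus[of _ n] mtrace_P)
    finally show ?thesis using \<sigma> by (simp add: field_simps)
  qed
  ultimately show ?thesis unfolding f by simp
qed

text \<open>By Woodbury's formula \<open>N = Q (I + D Q)\<^sup>-\<^sup>1\<close>, the matrix governing exchanges in \<open>S\<close>.\<close>

definition N where "N = Q - Q * D * H * D * Q"

lemma N_carrier [simp]: "N \<in> M\<^sub>n" by (simp add: N_def)
lemma N_dims [simp]: "dim_row N = n" "dim_col N = n"
  using N_carrier by (auto simp only: carrier_matD)
lemma N_sym: "N\<^sup>T = N"
  by (simp add: N_def transpose_minus[of _ n n] transpose_mult[of _ n n _ n] sq_simps)

lemma N_entry_sym: "i < n \<Longrightarrow> j < n \<Longrightarrow> N $$ (i, j) = N $$ (j, i)"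
  using index_transpose_mat(1)[of i N j] N_sym by (auto simp del: index_transpose_mat)

lemma M_eq: "M = Q + I"
  unfolding Q_def by (intro entries_eqI) auto

lemma HDQD: "H * (D * (Q * D)) = I - H"
proof -
  have "D * (Q * D) = G - I" by (intro entries_eqI) (auto simp: G_def sq_simps simp del: index_mult_mat(1))
  then show ?thesis by (simp add: sq_simps HG)
qed

lemma N_eq: "N * (I + D * Q) = Q"
proof -
  have "H * (D * (Q * (D * Q))) = H * (D * (Q * D)) * Q" by (simp add: sq_simps)
  also have "\<dots> = Q - H * Q" by (simp add: HDQD sq_simps)
  finally have *: "D * (H * (D * (Q * (D * Q)))) = D * Q - D * (H * Q)" by (simp add: sq_simps)
  have "N * (I + D * Q) = Q - Q * (D * (H * Q)) + (Q * (D * Q) - Q * (D * (H * (D * (Q * (D * Q))))))"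
    unfolding N_def by (simp add: sq_simps closed_forms)
  also have "\<dots> = Q"
    unfolding * by (intro entries_eqI) (simp_all add: sq_simps del: index_mult_mat(1))
  finally show ?thesis .
qed

text \<open>Inside \<open>S\<close> this gives \<open>1 - N_ii = H_ii\<close>, the squared length of
  the dual basis vector \<open>w_i\<close>.\<close>

lemma DND: "D * N * D = I - H"
proof -
  have "D * N * D = D * (Q * D) - D * (Q * D) * (H * (D * (Q * D)))"
    unfolding N_def by (simp add: sq_simps closed_forms)
  also have "D * (Q * D) = G - I" by (intro entries_eqI) (auto simp: G_def sq_simps simp del: index_mult_mat(1))
  also have "G - I - (G - I) * (H * (G - I)) = I - H"
    by (intro entries_eqI) (simp_all add: sq_simps closed_forms del: index_mult_mat(1))
  finally show ?thesis .
qed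

text \<open>Identifies \<open>N_ij\<close>, for \<open>i\<close> in \<open>S\<close> and
  \<open>j\<close> outside, as the coordinate of \<open>P v_j\<close> along
  \<open>v_i\<close>.\<close>

lemma DNE: "D * N * E = H * (D * (M * E))"
proof -
  have "D * (M * E) = D * (Q * E)" by (simp add: M_eq sq_simps DE)
  moreover have "D * N * E = D * (Q * E) - D * (Q * D) * (H * (D * (Q * E)))"
    unfolding N_def by (simp add: sq_simps closed_forms)
  moreover have "D * (Q * D) = G - I" by (intro entries_eqI) (auto simp: G_def sq_simps simp del: index_mult_mat(1))
  ultimately show ?thesis
    by (intro entries_eqI) (simp_all add: sq_simps closed_forms del: index_mult_mat(1))
qed

text \<open>\<open>M - M D H M\<close> is \<open>V^T (I - P) V\<close>, so \<open>1 + N_jj\<close>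
  is the squared distance of \<open>v_j\<close> from the span when \<open>j\<close> lies outside
  \<open>S\<close>.\<close>

lemma ENE: "E * (M - M * D * H * M) * E = E + E * N * E"
proof -
  have DM: "D * (M * E) = D * (Q * E)" by (simp add: M_eq sq_simps DE)
  have MD: "E * (M * D) = E * (Q * D)" by (simp add: M_eq sq_simps ED)
  have "E * (M - M * D * H * M) * E = E * (M * E) - E * (M * D) * (H * (D * (M * E)))"
    by (simp add: sq_simps closed_forms)
  also have "\<dots> = E * (M * E) - E * (Q * D) * (H * (D * (Q * E)))" unfolding DM MD ..
  also have "\<dots> = E + E * N * E"
    unfolding N_def
    by (intro entries_eqI) (simp_all add: M_eq sq_simps closed_forms del: index_mult_mat(1))
  finally show ?thesis .
qed

end

lemma outer_sum_eq:
  assumes A: "A \<in> carrier_mat d n" and J: "J \<subseteq> {..<n}"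
  shows "outer_sum A J x = A * mat_diag n (\<lambda>i. if i \<in> J then x i else 0) * A\<^sup>T"
proof (rule eq_matI)
  let ?R = "A * mat_diag n (\<lambda>i. if i \<in> J then x i else 0) * A\<^sup>T"
  fix p q assume "p < dim_row ?R" "q < dim_col ?R"
  then have pq: "p < d" "q < d" using A by auto
  have "?R $$ (p, q) = (\<Sum>i<n. A $$ (p, i) * (if i \<in> J then x i else 0) * A $$ (q, i))"
    using A pq by (simp add: scalar_prod_def mat_diag_mult_right lessThan_atLeast0)
  also have "\<dots> = (\<Sum>i\<in>J. x i * (col A i $ p) * (col A i $ q))"
    using A pq J by (intro sum.mono_neutral_cong_right) auto
  finally show "outer_sum A J x $$ (p, q) = ?R $$ (p, q)"
    using A pq by (simp add: outer_sum_def)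
qed (use A in \<open>auto simp: outer_sum_def\<close>)

section \<open>The dual basis and its certificate\<close>

context gram_block
begin

lemma G_eq_gram: "G = (V * D)\<^sup>T * (V * D) + E\<^sup>T * E"
proof -
  have EE: "E\<^sup>T * E = I - D" by (simp add: one_minus_ind)
  show ?thesis unfolding EE
    by (intro entries_eqI)
      (simp_all add: G_def Q_def transpose_mult[of _ n n _ n] sq_simps closed_forms del: index_mult_mat(1))
qed

lemma pos_def_G: "pos_def_mat G"
proof (rule psd_det_imp_pos_def)
  show "psd_mat G" unfolding G_eq_gram by (intro psd_add psd_gram) auto
qed (rule det_G)

lemma H_diag_pos:
  assumes "i < n"
  shows "0 < H $$ (i, i)"
proof -
  have "pos_def_mat (H\<^sup>T * G * H)"
    using det_H by (intro pos_def_congruence pos_def_G) auto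
  then have "pos_def_mat H" by (simp add: sq_simps GH)
  from pos_def_congruence_diag[OF _ this, of I, OF _ _ _ assms] show ?thesis by simp
qed

lemma H_eq: "D * H + E = H"
proof -
  have "H = H * (D + E)" by (simp add: ind_plus_compl)
  also have "\<dots> = D * H + E" by (simp add: sq_simps HD HE)
  finally show ?thesis ..
qed

text \<open>The columns of \<open>V H\<close> in \<open>S\<close> form the basis dual to those of \<open>V\<close>, which exchanges the roles
  of \<open>G\<close> and \<open>H\<close>. The certificate for the upper bound is \<open>cert\<close> of this dual block.\<close>

lemma inverse_block: "gram_block n (V * H) G S"
proof
  have "D * (V * H)\<^sup>T * (V * H) * D = D * H"
    by (simp add: transpose_mult[of _ n n _ n] sq_simps closed_forms)
  then have "I + D * ((V * H)\<^sup>T * (V * H) - I) * D = H"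
    by (subst H_eq[symmetric], intro entries_eqI)
      (simp_all add: sq_simps one_minus_ind[symmetric] del: index_mult_mat(1))
  then show "(I + D * ((V * H)\<^sup>T * (V * H) - I) * D) * G = I" by (simp add: HG)
  show "det (V * H) \<noteq> 0" using detV det_H by (auto simp: det_mult[of _ n])
qed (use S in auto)

definition dual_cert where "dual_cert c = V * H * D * (V * H)\<^sup>T + c \<cdot>\<^sub>m (I - P)"

lemma dual_cert_carrier [simp]: "dual_cert c \<in> M\<^sub>n" by (simp add: dual_cert_def)
lemma dual_cert_dims [simp]: "dim_row (dual_cert c) = n" "dim_col (dual_cert c) = n"
  using dual_cert_carrier by (auto simp only: carrier_matD)

text \<open>A basis and its dual span the same space, so the projection of the dual block is again
  \<open>P\<close>.\<close>

lemma dual_cert_eq: "dual_cert c = gram_block.cert n (V * H) G S c"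
proof -
  interpret W: gram_block n "V * H" G S by (rule inverse_block)
  have "W.P = P"
    unfolding W.P_def P_def by (simp add: transpose_mult[of _ n n _ n] sq_simps closed_forms)
  then show ?thesis by (simp add: W.cert_def dual_cert_def)
qed

lemma mtrace_dual: "mtrace (V * H * D * (V * H)\<^sup>T) = (\<Sum>i\<in>S. H $$ (i, i))"
proof -
  have "mtrace (V * H * D * (V * H)\<^sup>T) = mtrace (V * (D * (H * (H * V\<^sup>T))))"
    by (simp add: transpose_mult[of _ n n _ n] sq_simps closed_forms)
  also have "\<dots> = mtrace (D * (D * (H * (H * M))))"
    by (subst mtrace_mult_comm[of _ n n]) (auto simp: sq_simps closed_forms)
  also have "\<dots> = mtrace (D * (H * (H * (M * D))))"
    by (subst mtrace_mult_comm[of _ n n]) (auto simp: sq_simps)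
  also have "D * (H * (H * (M * D))) = H * (D * (H * (M * D)))"
    by (simp add: reassoc)
  also have "\<dots> = D * H" by (simp add: D_H_M_D HD)
  also have "mtrace (D * H) = (\<Sum>i\<in>S. H $$ (i, i))"
    unfolding ind_def by (simp add: mtrace_diag_mult if_distrib[of "\<lambda>x. x * _"] sum_S cong: if_cong)
  finally show ?thesis .
qed

lemma det_dual_cert: "0 < c \<Longrightarrow> det (dual_cert c) = c ^ (n - card S) / det G"
proof -
  interpret W: gram_block n "V * H" G S by (rule inverse_block)
  assume "0 < c"
  have "det W.G * det G = 1" by (rule W.det_H)
  then have "det W.G = 1 / det G" using det_G by (simp add: field_simps)
  with W.det_cert[OF \<open>0 < c\<close>] show ?thesis unfolding dual_cert_eq by simp
qed

lemma pos_def_dual_cert: "0 < c \<Longrightarrow> pos_def_mat (dual_cert c)"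
proof -
  interpret W: gram_block n "V * H" G S by (rule inverse_block)
  show "0 < c \<Longrightarrow> pos_def_mat (dual_cert c)" unfolding dual_cert_eq by (rule W.pos_def_cert)
qed

lemma majorized_dual_cert: "(\<Sum>i\<in>S. H $$ (i, i)) \<le> c \<Longrightarrow> majorized (dual_cert c) c"
proof -
  interpret W: gram_block n "V * H" G S by (rule inverse_block)
  show "(\<Sum>i\<in>S. H $$ (i, i)) \<le> c \<Longrightarrow> majorized (dual_cert c) c"
    unfolding dual_cert_eq by (rule W.majorized_cert) (simp only: mtrace_dual)
qed

text \<open>Its diagonal collects the coefficients of the dual bound as an affine function of the
  weights \<open>x\<close>.\<close>

definition K where "K c = V\<^sup>T * dual_cert c * V"

lemma K_carrier [simp]: "K c \<in> M\<^sub>n" by (simp add: K_def)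

lemma K_eq: "K c = M * (D * (H * (H * M))) + c \<cdot>\<^sub>m (M - M * D * H * M)"
  unfolding K_def dual_cert_def P_def
  by (simp add: transpose_mult[of _ n n _ n] sq_simps closed_forms)

text \<open>A column in \<open>S\<close> pairs to 1 with its own dual vector and to 0 with the
  others, and \<open>I - P\<close> annihilates it.\<close>

lemma K_diag_in:
  assumes "i \<in> S" "i < n"
  shows "K c $$ (i, i) = 1"
proof -
  have "D * (M * (D * (H * (H * (M * D))))) = D"
    by (simp add: reassoc D_H_M_D)
  moreover have "D * (M - M * D * H * M) * D = 0\<^sub>m n n"
    by (simp add: sq_simps D_H_M_D)
  ultimately have "D * K c * D = D + c \<cdot>\<^sub>m 0\<^sub>m n n"
    unfolding K_eq by (simp add: sq_simps)
  from arg_cong[OF this, of "\<lambda>A. A $$ (i, i)"] have "K c $$ (i, i) = D $$ (i, i)"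
    using assms by (simp add: ind_sandwich_entry del: index_mult_mat(1) assoc_mult_mat)
  then show ?thesis using assms by (simp add: ind_def)
qed

text \<open>Squared coordinates of \<open>P v_j\<close> plus \<open>c\<close> times the squared
  distance of \<open>v_j\<close> from the span, read off from \<open>DNE\<close> and
  \<open>ENE\<close>.\<close>

lemma K_diag_out:
  assumes j: "j \<notin> S" "j < n"
  shows "K c $$ (j, j) = (\<Sum>i\<in>S. (N $$ (i, j))\<^sup>2) + c * (1 + N $$ (j, j))"
proof -
  have "E * (M * (D * (H * (H * M)))) * E = (D * N * E)\<^sup>T * (D * N * E)"
    unfolding DNE by (simp add: transpose_mult[of _ n n _ n] sq_simps closed_forms)
  then have "E * K c * E = (D * N * E)\<^sup>T * (D * N * E) + c \<cdot>\<^sub>m (E + E * N * E)"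
    unfolding K_eq ENE[symmetric] by (simp add: sq_simps)
  from arg_cong[OF this, of "\<lambda>A. A $$ (j, j)"]
  have "K c $$ (j, j) = ((D * N * E)\<^sup>T * (D * N * E)) $$ (j, j) + c * (1 + N $$ (j, j))"
    using j by (simp add: ind_sandwich_entry del: index_mult_mat(1) assoc_mult_mat) (simp add: ind_def)
  also have "((D * N * E)\<^sup>T * (D * N * E)) $$ (j, j) = (\<Sum>i<n. if i \<in> S then (N $$ (i, j))\<^sup>2 else 0)"
    using j by (subst gram_entry)
      (auto simp: ind_sandwich_entry power2_eq_square simp del: index_mult_mat(1) assoc_mult_mat intro!: sum.cong)
  finally show ?thesis by (simp add: sum_S)
qed

lemma N_diag_in:
  assumes "i \<in> S" "i < n"
  shows "N $$ (i, i) = 1 - H $$ (i, i)"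
  using arg_cong[OF DND, of "\<lambda>A. A $$ (i, i)"] assms
  by (simp add: ind_sandwich_entry del: index_mult_mat(1) assoc_mult_mat)

lemma exchange_le:
  assumes i: "i \<in> S" "i < n" and j: "j \<notin> S" "j < n"
    and opt: "pminor M (insert j (S - {i})) \<le> pminor M S"
  shows "(1 - N $$ (i, i)) * (1 + N $$ (j, j)) + (N $$ (i, j))\<^sup>2 \<le> 1"
proof -
  let ?r = "(1 - N $$ (i, i)) * (1 + N $$ (j, j)) + N $$ (i, j) * N $$ (j, i)"
  have "pminor M (insert j (S - {i})) = pminor M S * ?r"
    using det_exchange[OF _ _ N_eq i j] by (simp add: pminor_def Q_def[symmetric])
  then have "pminor M S * ?r \<le> pminor M S * 1" using opt by simp
  moreover have "0 < pminor M S" using det_G_pos by (simp add: det_G_pminor)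
  ultimately have "?r \<le> 1" by (simp only: mult_le_cancel_left_pos)
  then show ?thesis using N_entry_sym[of i j] i j by (simp add: power2_eq_square)
qed

text \<open>Weak duality with a rescaled \<open>dual_cert c\<close>. For \<open>c\<close> the sum of
  the \<open>H_ii\<close>, \<open>majorized_dual_cert\<close> applies at its threshold, and outside
  \<open>S\<close> the entry \<open>K_jj\<close> splits into one exchange factor per
  \<open>i\<close> in \<open>S\<close>, each at most 1 by optimality.\<close>

lemma ln_f_spec_le_opt:
  assumes s: "0 < card S"
    and opt: "\<And>T. T \<subseteq> {..<n} \<Longrightarrow> card T = card S \<Longrightarrow> pminor M T \<le> pminor M S"
    and x: "\<And>i. i < n \<Longrightarrow> 0 \<le> x i" "\<And>i. i < n \<Longrightarrow> x i \<le> 1" "(\<Sum>i<n. x i) = real (card S)"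
  defines "s \<equiv> real (card S)"
  shows "ln (f_spec (card S) (V * mat_diag n x * V\<^sup>T)) \<le>
    ln (pminor M S) + s * ln (s - (s - 1) / s * max (2 * s - real n) 0)"
proof -
  define X where "X = V * mat_diag n x * V\<^sup>T"
  define c where "c = (\<Sum>i\<in>S. H $$ (i, i))"
  have fin: "finite S" using S finite_subset by blast
  have c: "0 < c" unfolding c_def using s S by (intro sum_pos) (auto intro!: H_diag_pos fin)
  have s1: "1 \<le> s" using s by (simp add: s_def)
  have sn: "s \<le> real n" using card_S by (simp add: s_def)
  \<comment> \<open>\<open>s * t\<close> bounds the total of \<open>x\<close> weighted by 1 on
    \<open>S\<close> and by \<open>s\<close> elsewhere, since at most \<open>min s (n - s)\<close>
    of the weight lies outside \<open>S\<close>.\<close>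
  define t where "t = s - (s - 1) / s * max (2 * s - real n) 0"
  have st: "s * t = s + (s - 1) * min s (real n - s)"
    using s1 by (cases "2 * s \<le> real n") (auto simp: t_def field_simps max_def min_def)
  have "0 < s * t" unfolding st using s1 sn by (intro add_pos_nonneg mult_nonneg_nonneg) auto
  then have t: "0 < t" using s1 by (simp add: zero_less_mult_iff)
  have Kle: "K c $$ (j, j) \<le> (if j \<in> S then 1 else s)" if j: "j < n" for j
  proof (cases "j \<in> S")
    case True
    then show ?thesis using K_diag_in j by simp
  next
    case False
    have "K c $$ (j, j) = (\<Sum>i\<in>S. (N $$ (i, j))\<^sup>2 + (1 - N $$ (i, i)) * (1 + N $$ (j, j)))"
      unfolding K_diag_out[OF False j] c_def sum.distrib sum_distrib_right
      using S by (auto simp: N_diag_in intro!: arg_cong2[of _ _ _ _ "(+)"] sum.cong)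
    also have "\<dots> \<le> (\<Sum>i\<in>S. 1)"
    proof (intro sum_mono)
      fix i assume i: "i \<in> S"
      have "card (insert j (S - {i})) = card S"
        using False i fin s by (simp add: card_Diff_singleton)
      then have "pminor M (insert j (S - {i})) \<le> pminor M S"
        using S j by (intro opt) auto
      from exchange_le[OF i _ False j this]
      show "(N $$ (i, j))\<^sup>2 + (1 - N $$ (i, i)) * (1 + N $$ (j, j)) \<le> 1"
        using i S by (auto simp: add.commute)
    qed
    finally show ?thesis using False by (simp add: s_def)
  qed
  have tr: "mtrace (X * dual_cert c) \<le> s * t"
  proof -
    have "mtrace (X * dual_cert c) = mtrace (V * (mat_diag n x * (V\<^sup>T * dual_cert c)))"
      by (simp add: X_def sq_simps)
    also have "\<dots> = mtrace (mat_diag n x * K c)"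
      by (subst mtrace_mult_comm[of _ n n]) (auto simp: K_def sq_simps)
    also have "\<dots> = (\<Sum>i<n. x i * K c $$ (i, i))" by (simp add: mtrace_diag_mult)
    also have "\<dots> \<le> (\<Sum>i<n. x i * (if i \<in> S then 1 else s))"
      using Kle x by (intro sum_mono mult_left_mono) auto
    also have "\<dots> = (\<Sum>i<n. x i + (s - 1) * (if i \<in> S then 0 else x i))"
      by (intro sum.cong) (auto simp: algebra_simps)
    also have "\<dots> = s + (s - 1) * (\<Sum>i<n. if i \<in> S then 0 else x i)"
      by (simp add: sum.distrib sum_distrib_left[symmetric] x(3) s_def)
    also have "\<dots> \<le> s + (s - 1) * min s (real n - s)"
    proof -
      have "(\<Sum>i<n. if i \<in> S then 0 else x i) \<le> (\<Sum>i<n. x i)"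
        using x by (intro sum_mono) auto
      moreover have "(\<Sum>i<n. if i \<in> S then 0 else x i) \<le> (\<Sum>i<n. 1 - (if i \<in> S then 1 else 0))"
        using x by (intro sum_mono) auto
      then have "(\<Sum>i<n. if i \<in> S then 0 else x i) \<le> real n - s"
        using sum_S[of "\<lambda>_. 1"] by (simp add: sum_subtractf s_def)
      ultimately show ?thesis using s1 x(3) by (intro add_left_mono mult_left_mono) (auto simp: s_def)
    qed
    finally show ?thesis by (simp add: st)
  qed
  \<comment> \<open>Dividing by \<open>t\<close> brings the trace down to \<open>s\<close>. Then
    \<open>- ln (det F)\<close> gains \<open>n ln t\<close> and the Loewner term loses
    \<open>(n - s) ln t\<close>, which leaves \<open>s ln t\<close>.\<close>
  define F where "F = (1 / t) \<cdot>\<^sub>m dual_cert c"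
  have F: "F \<in> M\<^sub>n" by (simp add: F_def)
  have "psd_mat F"
    unfolding F_def using pos_def_imp_psd[OF _ pos_def_dual_cert[OF c]] t by (intro psd_smult) auto
  have detF: "det F = (1 / t) ^ n * (c ^ (n - card S) / det G)"
    unfolding F_def det_smult using det_dual_cert[OF c] dual_cert_carrier[of c] by (simp add: carrier_matD)
  have detF_pos: "0 < det F" unfolding detF using c t det_G_pos by simp
  have pdF: "pos_def_mat F" using psd_det_imp_pos_def[OF \<open>psd_mat F\<close>] detF_pos by simp
  have majF: "majorized F (c / t)"
    using majorized_dual_cert[of c] t
    by (auto simp: F_def majorized_def quad_form_smult c_def divide_right_mono)
  have X: "psd_mat X" unfolding X_def using x by (intro psd_diag_congruence) auto
  have eig: "0 < eig X (card S)"
    unfolding X_def using s card_S x detV by (intro eig_pos_of_capped) auto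
  have "ln (f_spec (card S) X) \<le> mtrace (X * F) - s - ln (det F) + (real n - s) * ln (c / t)"
    unfolding s_def using ln_f_spec_le_dual[OF X s card_S eig F pdF majF] .
  also have "mtrace (X * F) = mtrace (X * dual_cert c) / t"
    unfolding F_def X_def by (simp add: mult_smult_distrib[of _ n n _ n] mtrace_smult[of _ n])
  also have "\<dots> \<le> s" using tr t by (simp add: pos_divide_le_eq)
  also have "ln (det F) = - real n * ln t + (real n - s) * ln c - ln (det G)"
    unfolding detF using c t det_G_pos card_S
    by (simp add: ln_mult ln_div ln_realpow of_nat_diff s_def)
  finally have "ln (f_spec (card S) X) \<le> ln (det G) + s * ln t"
    using c t by (simp add: ln_div algebra_simps)
  then show ?thesis by (simp add: X_def t_def det_G_pminor)
qed

end

section \<open>Bounds for the relaxation of the maximal principal minor\<close>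

context square_dim
begin

text \<open>As a sum of two Gram matrices, \<open>G\<close> annihilates \<open>v\<close> only if
  both factors do; invertibility of \<open>V\<close> then kills the part of \<open>v\<close> on
  \<open>S\<close>, and the other factor is the part off \<open>S\<close>.\<close>

lemma gram_block_exists:
  assumes V: "V \<in> M\<^sub>n" "det V \<noteq> 0" and S: "S \<subseteq> {..<n}"
  obtains H where "gram_block n V H S"
proof -
  define G where "G = I + ind S * (V\<^sup>T * V - I) * ind S"
  have G: "G \<in> M\<^sub>n" using V by (simp add: G_def)
  have Geq: "G = (V * ind S)\<^sup>T * (V * ind S) + (ind (- S))\<^sup>T * ind (- S)"
  proof -
    have EE: "(ind (- S))\<^sup>T * ind (- S) = I - ind S" by (simp add: one_minus_ind)
    show ?thesis
      unfolding G_def EE using V(1)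
      by (intro entries_eqI) (simp_all add: transpose_mult[of _ n n _ n] sq_simps del: index_mult_mat(1))
  qed
  have "det G \<noteq> 0"
  proof
    assume "det G = 0"
    then obtain v where v: "v \<in> carrier_vec n" "v \<noteq> 0\<^sub>v n" "G *\<^sub>v v = 0\<^sub>v n"
      using det_0_iff_vec_prod_zero_field[OF G] by auto
    let ?a = "V * ind S *\<^sub>v v" and ?b = "ind (- S) *\<^sub>v v"
    have car: "?a \<in> carrier_vec n" "?b \<in> carrier_vec n"
      using V v by (auto intro!: mult_mat_vec_carrier[of _ n n] simp del: assoc_mult_mat_vec)
    have "?a \<bullet> ?a + ?b \<bullet> ?b = v \<bullet> (G *\<^sub>v v)"
      unfolding Geq using V(1) v(1)
      by (simp add: quad_form_add quad_form_gram del: assoc_mult_mat_vec transpose_ind)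
    also have "\<dots> = 0" using v by simp
    finally have "?a \<bullet> ?a = 0" "?b \<bullet> ?b = 0"
      using scalar_prod_self_nonneg[of ?a] scalar_prod_self_nonneg[of ?b] by linarith+
    then have ab: "?a = 0\<^sub>v n" "?b = 0\<^sub>v n"
      using scalar_prod_self_pos car by (metis less_irrefl)+
    have iv: "ind S *\<^sub>v v \<in> carrier_vec n" using v(1) by (intro mult_mat_vec_carrier[of _ n n]) auto
    have "ind S *\<^sub>v v = 0\<^sub>v n"
      using ab(1) V v iv det_0_iff_vec_prod_zero_field[OF V(1)]
      by (auto simp: assoc_mult_mat_vec[of _ n n _ n])
    moreover have "v = ind S *\<^sub>v v + ind (- S) *\<^sub>v v"
      using v(1) by (simp add: ind_plus_compl flip: add_mult_distrib_mat_vec[of _ n n])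
    ultimately show False using ab(2) v by simp
  qed
  then obtain H where "H \<in> M\<^sub>n" "G * H = I" "H * G = I" using inverse_exists[OF G] by blast
  then have "gram_block n V H S" using V S by unfold_locales (auto simp: G_def)
  then show thesis by (rule that)
qed

lemma pminor_gram_pos:
  assumes "V \<in> M\<^sub>n" "det V \<noteq> 0" "S \<subseteq> {..<n}"
  shows "0 < pminor (V\<^sup>T * V) S"
proof -
  obtain H where "gram_block n V H S" using gram_block_exists[OF assms] .
  then interpret gram_block n V H S .
  show ?thesis using det_G_pos by (simp add: det_G_pminor M_def)
qed

lemma outer_sum_vec:
  assumes "V \<in> M\<^sub>n"
  shows "outer_sum V {0..<n} (($) x) = V * mat_diag n (($) x) * V\<^sup>T"
proof -
  have "mat_diag n (\<lambda>i. if i \<in> {0..<n} then x $ i else 0) = mat_diag n (($) x)"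
    by (rule mat_diag_cong) auto
  with outer_sum_eq[OF assms, of "{0..<n}" "($) x"] show ?thesis by (simp add: atLeast0LessThan)
qed

lemma capped_simplexD:
  assumes "x \<in> capped_simplex n r"
  shows "\<And>i. i < n \<Longrightarrow> 0 \<le> x $ i" "\<And>i. i < n \<Longrightarrow> x $ i \<le> 1" "(\<Sum>i<n. x $ i) = real r"
  using assms by (auto simp: capped_simplex_def)

lemma indicator_capped:
  assumes "S \<subseteq> {..<n}"
  shows "vec n (\<lambda>i. if i \<in> S then 1 else 0) \<in> capped_simplex n (card S)"
proof -
  have "(\<Sum>i<n. vec n (\<lambda>i. if i \<in> S then 1 else 0) $ i) = (\<Sum>i\<in>S. 1 :: real)"
    using assms by (intro sum.mono_neutral_cong_right) auto
  then show ?thesis by (auto simp: capped_simplex_def)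
qed

text \<open>The dual pair optimal at \<open>y\<close> stays feasible at every other
  \<open>x\<close>, and the trace is linear in \<open>x\<close>.\<close>

lemma f_spec_affine_majorant:
  assumes V: "V \<in> M\<^sub>n" "det V \<noteq> 0" and r: "0 < r" "r \<le> n" and y: "y \<in> capped_simplex n r"
  defines "f \<equiv> \<lambda>x. ln (f_spec r (outer_sum V {0..<n} (($) x)))"
  shows "\<exists>a c. (\<forall>x\<in>capped_simplex n r. f x \<le> a + (\<Sum>i<n. c i * x $ i)) \<and> f y = a + (\<Sum>i<n. c i * y $ i)"
proof -
  define X where "X = (\<lambda>x. V * mat_diag n (($) x) * V\<^sup>T)"
  have psd: "psd_mat (X x)" and eig: "0 < eig (X x) r" if "x \<in> capped_simplex n r" for x
    unfolding X_def using capped_simplexD[OF that] V r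
    by (auto intro!: psd_diag_congruence eig_pos_of_capped)
  obtain F \<sigma> where F: "F \<in> M\<^sub>n" "pos_def_mat F" and \<sigma>: "0 < \<sigma>" "majorized F \<sigma>"
    and fy: "ln (f_spec r (X y)) = mtrace (X y * F) - real r - ln (det F) + (real n - real r) * ln \<sigma>"
    using ln_f_spec_dual_attained[OF psd[OF y] r eig[OF y]] .
  have tr: "mtrace (X x * F) = (\<Sum>i<n. (V\<^sup>T * F * V) $$ (i, i) * x $ i)" for x
  proof -
    have "mtrace (X x * F) = mtrace (V * (mat_diag n (($) x) * (V\<^sup>T * F)))"
      using V F by (simp add: X_def sq_simps)
    also have "\<dots> = mtrace (mat_diag n (($) x) * (V\<^sup>T * F * V))"
      using V F by (subst mtrace_mult_comm[of _ n n]) (auto simp: sq_simps)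
    also have "\<dots> = (\<Sum>i<n. (V\<^sup>T * F * V) $$ (i, i) * x $ i)"
      using V F by (subst mtrace_diag_mult) (auto simp: mult.commute)
    finally show ?thesis .
  qed
  have f: "f x = ln (f_spec r (X x))" for x
    using outer_sum_vec[OF V(1)] by (simp add: f_def X_def)
  let ?a = "- real r - ln (det F) + (real n - real r) * ln \<sigma>"
  have "f x \<le> ?a + (\<Sum>i<n. (V\<^sup>T * F * V) $$ (i, i) * x $ i)" if "x \<in> capped_simplex n r" for x
    using ln_f_spec_le_dual[OF psd[OF that] r eig[OF that] F \<sigma>(2)] unfolding f tr by simp
  moreover have "f y = ?a + (\<Sum>i<n. (V\<^sup>T * F * V) $$ (i, i) * y $ i)"
    using fy unfolding f tr by simp
  ultimately show ?thesis
    by (intro exI[of _ ?a] exI[of _ "\<lambda>i. (V\<^sup>T * F * V) $$ (i, i)"]) blast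
qed

definition mesp_relax :: "real mat \<Rightarrow> nat \<Rightarrow> real" where
  "mesp_relax V r = max_on (capped_simplex n r) (\<lambda>x. ln (f_spec r (outer_sum V {0..<n} (($) x))))"

lemma mesp_relax_lower:
  assumes V0: "V \<in> M\<^sub>n" "det V \<noteq> 0" and S0: "S \<subseteq> {..<n}" "0 < card S"
  shows "ln (pminor (V\<^sup>T * V) S) \<le> mesp_relax V (card S)"
proof -
  obtain H where "gram_block n V H S" using gram_block_exists[OF V0 S0(1)] .
  then interpret gram_block n V H S .
  let ?x = "vec n (\<lambda>i. if i \<in> S then 1 else 0) :: real vec"
  have "mat_diag n (($) ?x) = D" unfolding ind_def by (rule mat_diag_cong) auto
  then have "ln (pminor (V\<^sup>T * V) S) \<le> ln (f_spec (card S) (outer_sum V {0..<n} (($) ?x)))"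
    using ln_det_G_le_f_spec[OF S0(2)] outer_sum_vec[OF V0(1), of ?x] by (simp add: det_G_pminor M_def)
  also have "\<dots> \<le> mesp_relax V (card S)"
    unfolding mesp_relax_def using S0(2) card_S V0
    by (intro max_on_capped_simplex(1) f_spec_affine_majorant indicator_capped S0(1)) auto
  finally show ?thesis .
qed

lemma mesp_relax_upper:
  assumes V0: "V \<in> M\<^sub>n" "det V \<noteq> 0" and S0: "S \<subseteq> {..<n}" "0 < card S"
    and opt: "\<And>T. T \<subseteq> {..<n} \<Longrightarrow> card T = card S \<Longrightarrow> pminor (V\<^sup>T * V) T \<le> pminor (V\<^sup>T * V) S"
  defines "s \<equiv> real (card S)"
  shows "mesp_relax V (card S) \<le>
    ln (pminor (V\<^sup>T * V) S) + s * ln (s - (s - 1) / s * max (2 * s - real n) 0)"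
proof -
  obtain H where "gram_block n V H S" using gram_block_exists[OF V0 S0(1)] .
  then interpret gram_block n V H S .
  show ?thesis
    unfolding mesp_relax_def
  proof (rule max_on_capped_simplex(2)[OF card_S])
    fix x assume "x \<in> capped_simplex n (card S)"
    then show "ln (f_spec (card S) (outer_sum V {0..<n} (($) x))) \<le>
        ln (pminor (V\<^sup>T * V) S) + s * ln (s - (s - 1) / s * max (2 * s - real n) 0)"
      unfolding outer_sum_vec[OF V0(1)] s_def M_def[symmetric]
      using opt capped_simplexD[of x "card S"] by (intro ln_f_spec_le_opt S0(2)) (auto simp: M_def)
  qed (use f_spec_affine_majorant V0 S0 card_S in blast)
qed

section \<open>The relaxation of the log-determinant\<close>

definition info_mat :: "real mat \<Rightarrow> (nat \<Rightarrow> real) \<Rightarrow> real mat" where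
  "info_mat B x = I + B * mat_diag n x * B\<^sup>T"

lemma info_mat_carrier [simp]: "B \<in> M\<^sub>n \<Longrightarrow> info_mat B x \<in> M\<^sub>n"
  by (simp add: info_mat_def)

lemma pos_def_info_mat:
  assumes "B \<in> M\<^sub>n" "\<And>i. i < n \<Longrightarrow> 0 \<le> x i"
  shows "pos_def_mat (info_mat B x)"
  unfolding info_mat_def using assms by (intro pos_def_add_psd pos_def_one psd_diag_congruence) auto

text \<open>Only \<open>B^T B\<close> enters, so the rectangular whitened matrix can be traded for a
  square one with the same Gram matrix.\<close>

lemma det_info_mat:
  assumes B: "B \<in> M\<^sub>n"
  shows "det (info_mat B x) = det (I + mat_diag n x * (B\<^sup>T * B))"
proof -
  have "det (I + B * (mat_diag n x * B\<^sup>T)) = det (I + mat_diag n x * B\<^sup>T * B)"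
    using B by (intro det_one_plus_mult_comm[of _ n n]) auto
  then show ?thesis using B by (simp add: info_mat_def sq_simps)
qed

lemma det_info_mat_ind:
  assumes B: "B \<in> M\<^sub>n"
  shows "det (info_mat B (\<lambda>i. if i \<in> S then 1 else 0)) = pminor (I + B\<^sup>T * B) S"
proof -
  have "I + B\<^sup>T * B - I = B\<^sup>T * B" using B by (intro entries_eqI) auto
  then show ?thesis using det_info_mat[OF B] by (simp add: pminor_def ind_def)
qed

text \<open>The inverse is congruent to \<open>A\<close> itself: \<open>F = F^T A F\<close>.\<close>

lemma pos_def_inverse:
  assumes A: "A \<in> M\<^sub>n" "pos_def_mat A"
  obtains F where "F \<in> M\<^sub>n" "pos_def_mat F" "A * F = I" "F * A = I" "ln (det F) = - ln (det A)"
proof -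
  have dA: "0 < det A" using pos_def_det_pos[OF A] .
  then obtain F where F: "F \<in> M\<^sub>n" "A * F = I" "F * A = I" using inverse_exists[OF A(1)] by force
  have dF: "det A * det F = 1" using det_mult_inverse[OF A(1) F(1,2)] .
  have AT: "A\<^sup>T = A" using A by (simp add: pos_def_mat_def)
  have FT: "F\<^sup>T = F"
  proof -
    have "F\<^sup>T * A = I"
      using arg_cong[OF F(2), of transpose_mat] A(1) F(1) AT by (simp add: transpose_mult[of _ n n _ n])
    then have "F\<^sup>T * A * F = F" using F(1) by simp
    then show ?thesis using A F by (simp add: sq_simps)
  qed
  have "pos_def_mat (F\<^sup>T * A * F)" using A F dF by (intro pos_def_congruence) auto
  also have "F\<^sup>T * A * F = F" using A F FT by (simp add: sq_simps)
  finally have "pos_def_mat F" .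
  moreover have "ln (det F) = - ln (det A)"
  proof -
    have "det F = 1 / det A" using dF dA by (simp add: field_simps)
    then show ?thesis using dA by (simp add: ln_div)
  qed
  ultimately show thesis using that F by blast
qed

lemma mtrace_info_mat:
  assumes B: "B \<in> M\<^sub>n" and F: "F \<in> M\<^sub>n"
  shows "mtrace (info_mat B x * F) = mtrace F + (\<Sum>i<n. (B\<^sup>T * F * B) $$ (i, i) * x i)"
proof -
  have "mtrace (info_mat B x * F) = mtrace F + mtrace (B * (mat_diag n x * (B\<^sup>T * F)))"
    using B F by (simp add: info_mat_def sq_simps mtrace_add[of _ n])
  also have "mtrace (B * (mat_diag n x * (B\<^sup>T * F))) = mtrace (mat_diag n x * (B\<^sup>T * F * B))"
    using B F by (subst mtrace_mult_comm[of _ n n]) (auto simp: sq_simps)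
  also have "\<dots> = (\<Sum>i<n. (B\<^sup>T * F * B) $$ (i, i) * x i)"
    using B F by (subst mtrace_diag_mult) (auto simp: mult.commute)
  finally show ?thesis .
qed

text \<open>The tangent plane of \<open>ln det\<close> at \<open>y\<close>, with \<open>F\<close>
  the inverse of the matrix there.\<close>

lemma ln_det_info_affine_majorant:
  assumes B: "B \<in> M\<^sub>n" and y: "y \<in> capped_simplex n r"
  shows "\<exists>a c. (\<forall>x\<in>capped_simplex n r. ln (det (info_mat B (($) x))) \<le> a + (\<Sum>i<n. c i * x $ i)) \<and>
    ln (det (info_mat B (($) y))) = a + (\<Sum>i<n. c i * y $ i)"
proof -
  have pd: "pos_def_mat (info_mat B (($) x))" if "x \<in> capped_simplex n r" for x
    using capped_simplexD[OF that] by (intro pos_def_info_mat[OF B]) auto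
  obtain F where F: "F \<in> M\<^sub>n" "pos_def_mat F" "info_mat B (($) y) * F = I"
    and lnF: "ln (det F) = - ln (det (info_mat B (($) y)))"
    by (rule pos_def_inverse[OF info_mat_carrier[OF B] pd[OF y]])
  let ?a = "mtrace F - real n - ln (det F)"
  have "ln (det (info_mat B (($) x))) \<le> ?a + (\<Sum>i<n. (B\<^sup>T * F * B) $$ (i, i) * x $ i)"
    if "x \<in> capped_simplex n r" for x
    using ln_det_le_trace_mult[OF info_mat_carrier[OF B] pd[OF that] F(1,2)] mtrace_info_mat[OF B F(1)]
    by simp
  moreover have "ln (det (info_mat B (($) y))) = ?a + (\<Sum>i<n. (B\<^sup>T * F * B) $$ (i, i) * y $ i)"
    using mtrace_info_mat[OF B F(1), of "($) y"] lnF F(3) by simp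
  ultimately show ?thesis
    by (intro exI[of _ ?a] exI[of _ "\<lambda>i. (B\<^sup>T * F * B) $$ (i, i)"]) blast
qed

definition dopt_relax :: "real mat \<Rightarrow> nat \<Rightarrow> real" where
  "dopt_relax B r = max_on (capped_simplex n r) (\<lambda>x. ln (det (info_mat B (($) x))))"

lemma dopt_relax_lower:
  assumes B: "B \<in> M\<^sub>n" and S: "S \<subseteq> {..<n}"
  shows "ln (pminor (I + B\<^sup>T * B) S) \<le> dopt_relax B (card S)"
proof -
  let ?x = "vec n (\<lambda>i. if i \<in> S then 1 else 0) :: real vec"
  have "mat_diag n (($) ?x) = mat_diag n (\<lambda>i. if i \<in> S then 1 else 0)" by (rule mat_diag_cong) auto
  then have "ln (pminor (I + B\<^sup>T * B) S) = ln (det (info_mat B (($) ?x)))"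
    by (simp add: info_mat_def flip: det_info_mat_ind[OF B])
  also have "\<dots> \<le> dopt_relax B (card S)"
    unfolding dopt_relax_def using S card_mono[OF _ S]
    by (intro max_on_capped_simplex(1) ln_det_info_affine_majorant[OF B] indicator_capped) auto
  finally show ?thesis .
qed

text \<open>With \<open>h\<^sub>i\<close> the leverage \<open>b\<^sub>i\<^sup>T (I + B\<^sub>S B\<^sub>S\<^sup>T)\<^sup>-\<^sup>1 b\<^sub>i\<close>, optimality of \<open>S\<close> under exchanges gives
  \<open>h\<^sub>j - h\<^sub>i \<le> h\<^sub>i h\<^sub>j\<close>, where \<open>h\<^sub>j \<le> \<sigma>\<close> and \<open>h\<^sub>i \<le> \<sigma> / (1 + \<sigma>)\<close> for \<open>i \<in> S\<close>.\<close>

lemma dopt_relax_upper: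
  assumes B: "B \<in> M\<^sub>n" and S: "S \<subseteq> {..<n}" "0 < card S" and n: "card S \<le> n"
    and opt: "\<And>T. T \<subseteq> {..<n} \<Longrightarrow> card T = card S \<Longrightarrow> pminor (I + B\<^sup>T * B) T \<le> pminor (I + B\<^sup>T * B) S"
    and \<sigma>: "0 \<le> \<sigma>" "\<And>i. i < n \<Longrightarrow> (B\<^sup>T * B) $$ (i, i) \<le> \<sigma>"
  shows "dopt_relax B (card S) \<le> ln (pminor (I + B\<^sup>T * B) S) +
    real n * ln (1 + real (min (card S) (n - card S)) * \<sigma>\<^sup>2 / (real n * (1 + \<sigma>)))"
proof -
  have fin: "finite S" using S finite_subset by blast
  define e where "e = (\<lambda>i. if i \<in> S then 1 else 0 :: real)"
  define Q where "Q = B\<^sup>T * B"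
  have Q: "Q \<in> M\<^sub>n" using B by (simp add: Q_def)
  have KQ: "I + B\<^sup>T * B - I = Q" using Q by (intro entries_eqI) (auto simp: Q_def)
  define A where "A = info_mat B e"
  have A: "A \<in> M\<^sub>n" "pos_def_mat A"
    using B by (auto simp: A_def e_def intro!: pos_def_info_mat)
  have A_ind: "A = I + B * ind S * B\<^sup>T" by (simp add: A_def info_mat_def e_def ind_def)
  have detA: "det A = pminor (I + B\<^sup>T * B) S"
    unfolding A_def e_def by (rule det_info_mat_ind[OF B])
  have detA_pos: "0 < det A" by (rule pos_def_det_pos[OF A])
  obtain F where F: "F \<in> M\<^sub>n" "pos_def_mat F" "A * F = I" "F * A = I" and lnF: "ln (det F) = - ln (det A)"
    by (rule pos_def_inverse[OF A])
  have FT: "F\<^sup>T = F" using F by (simp add: pos_def_mat_def)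
  define N where "N = B\<^sup>T * F * B"
  have N: "N \<in> M\<^sub>n" using B F by (simp add: N_def)
  have NT: "N\<^sup>T = N" using B F FT by (simp add: N_def transpose_mult[of _ n n _ n] sq_simps)
  have Nsym: "N $$ (i, j) = N $$ (j, i)" if "i < n" "j < n" for i j
    using index_transpose_mat(1)[of i N j] NT N that by (auto simp del: index_transpose_mat)
  have N_eq: "N * (I + ind S * Q) = Q"
  proof -
    have "N * (I + ind S * Q) = B\<^sup>T * F * (A * B)"
      unfolding N_def Q_def A_ind using B F(1) by (simp add: sq_simps)
    also have "\<dots> = B\<^sup>T * ((F * A) * B)" using A(1) B F(1) by (simp add: sq_simps)
    finally show ?thesis using B F by (simp add: Q_def)
  qed
  define W where "W = F * B"
  have W: "W \<in> M\<^sub>n" using B F by (simp add: W_def)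
  define y where "y = (\<lambda>j. \<Sum>k<n. (W $$ (k, j))\<^sup>2)"
  \<comment> \<open>Comes from \<open>F = F A F\<close> by expanding the middle factor
    \<open>A = I + B (ind S) B^T\<close>.\<close>
  have Ny: "N $$ (j, j) = y j + (\<Sum>i\<in>S. (N $$ (i, j))\<^sup>2)" if j: "j < n" for j
  proof -
    have "B\<^sup>T * F * A * (F * B) = W\<^sup>T * W + N * ind S * N"
      unfolding N_def W_def A_ind using B F(1) FT
      by (simp add: transpose_mult[of _ n n _ n] sq_simps)
    moreover have "B\<^sup>T * F * A * (F * B) = B\<^sup>T * F * ((A * F) * B)"
      using A(1) B F(1) by (simp add: sq_simps)
    then have "B\<^sup>T * F * A * (F * B) = N" using B F by (simp add: N_def)
    ultimately have "N = W\<^sup>T * W + N * ind S * N\<^sup>T" using NT by simp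
    then have "N $$ (j, j) = (W\<^sup>T * W + N * ind S * N\<^sup>T) $$ (j, j)" by simp
    also have "\<dots> = (W\<^sup>T * W) $$ (j, j) + (N * ind S * N\<^sup>T) $$ (j, j)"
      using W N j by simp
    also have "(W\<^sup>T * W) $$ (j, j) = y j"
      unfolding gram_entry[OF W W j j] y_def by (simp add: power2_eq_square)
    also have "(N * ind S * N\<^sup>T) $$ (j, j) = (\<Sum>k<n. N $$ (j, k) * (if k \<in> S then 1 else 0) * N $$ (j, k))"
      unfolding ind_def diag_conj_entry[OF N j j] ..
    also have "\<dots> = (\<Sum>i\<in>S. (N $$ (i, j))\<^sup>2)"
      using S j by (intro sum.mono_neutral_cong_right) (auto simp: power2_eq_square Nsym[of j])
    finally show ?thesis .
  qed
  have y0: "0 \<le> y j" for j by (auto simp: y_def intro!: sum_nonneg)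
  have N0: "0 \<le> N $$ (j, j)" if "j < n" for j
    unfolding Ny[OF that] using y0 by (intro add_nonneg_nonneg sum_nonneg) auto
  \<comment> \<open>Nonnegativity of \<open>|b_j - t F b_j|^2\<close>, with \<open>t\<close> left
    free for the two leverage bounds that follow.\<close>
  have quad: "0 \<le> \<sigma> - 2 * t * N $$ (j, j) + t\<^sup>2 * y j" if j: "j < n" for t j
  proof -
    have "N = B\<^sup>T * W" using B F by (simp add: N_def W_def sq_simps)
    then have "N $$ (j, j) = (\<Sum>k<n. B $$ (k, j) * W $$ (k, j))"
      using gram_entry[OF B W j j] by simp
    moreover have "Q $$ (j, j) = (\<Sum>k<n. B $$ (k, j) * B $$ (k, j))"
      unfolding Q_def by (rule gram_entry[OF B B j j])
    moreover have "(\<Sum>k<n. (B $$ (k, j) - t * W $$ (k, j))\<^sup>2) =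
        (\<Sum>k<n. B $$ (k, j) * B $$ (k, j)) - 2 * t * (\<Sum>k<n. B $$ (k, j) * W $$ (k, j)) + t\<^sup>2 * y j"
      unfolding y_def sum_distrib_left by (simp add: power2_eq_square algebra_simps sum.distrib sum_subtractf)
    ultimately have "Q $$ (j, j) - 2 * t * N $$ (j, j) + t\<^sup>2 * y j = (\<Sum>k<n. (B $$ (k, j) - t * W $$ (k, j))\<^sup>2)"
      by simp
    also have "\<dots> \<ge> 0" by (intro sum_nonneg) auto
    finally show ?thesis using \<sigma>(2)[OF j] by (simp add: Q_def)
  qed
  have Nle: "N $$ (j, j) \<le> \<sigma>" if j: "j < n" for j
  proof -
    have "y j \<le> N $$ (j, j)" unfolding Ny[OF j] by (simp add: sum_nonneg)
    then show ?thesis using quad[OF j, of 1] by simp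
  qed
  have Nle': "(1 + \<sigma>) * N $$ (i, i) \<le> \<sigma>" if i: "i \<in> S" for i
  proof -
    have i': "i < n" using i S by auto
    have "(N $$ (i, i))\<^sup>2 \<le> (\<Sum>k\<in>S. (N $$ (k, i))\<^sup>2)"
      using i fin by (intro member_le_sum) auto
    then have "y i \<le> N $$ (i, i) - (N $$ (i, i))\<^sup>2" using Ny[OF i'] by simp
    then have "(1 + \<sigma>)\<^sup>2 * y i \<le> (1 + \<sigma>)\<^sup>2 * (N $$ (i, i) - (N $$ (i, i))\<^sup>2)"
      by (intro mult_left_mono) auto
    \<comment> \<open>For \<open>t = 1 + \<sigma>\<close> the vector \<open>b_i - t F b_i\<close>
      vanishes in the extremal case \<open>S = {i}\<close>, \<open>|b_i|^2 = \<sigma>\<close>, so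
      nothing is lost there; it also makes the quadratic factor.\<close>
    with quad[OF i', of "1 + \<sigma>"]
    have "0 \<le> \<sigma> - 2 * (1 + \<sigma>) * N $$ (i, i) + (1 + \<sigma>)\<^sup>2 * (N $$ (i, i) - (N $$ (i, i))\<^sup>2)" by simp
    also have "\<dots> = (\<sigma> - (1 + \<sigma>) * N $$ (i, i)) * (1 + (1 + \<sigma>) * N $$ (i, i))"
      by (simp add: power2_eq_square algebra_simps)
    finally have "0 \<le> (\<sigma> - (1 + \<sigma>) * N $$ (i, i)) * (1 + (1 + \<sigma>) * N $$ (i, i))" .
    moreover have "0 < 1 + (1 + \<sigma>) * N $$ (i, i)"
      using N0[OF i'] \<sigma>(1) by (intro add_pos_nonneg mult_nonneg_nonneg) auto
    ultimately show ?thesis by (simp add: zero_le_mult_iff)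
  qed
  \<comment> \<open>The product of the leverage bounds \<open>\<sigma> / (1 + \<sigma>)\<close>
    inside \<open>S\<close> and \<open>\<sigma>\<close> outside; the constant of the theorem
    originates here.\<close>
  define \<delta> where "\<delta> = \<sigma>\<^sup>2 / (1 + \<sigma>)"
  have \<delta>0: "0 \<le> \<delta>" using \<sigma> by (simp add: \<delta>_def)
  have diff: "N $$ (j, j) \<le> N $$ (i, i) + \<delta>" if i: "i \<in> S" and j: "j \<notin> S" "j < n" for i j
  proof -
    have i': "i < n" using i S by auto
    let ?T = "insert j (S - {i})"
    have "card ?T = card S" using i j fin S by (simp add: card_Diff_singleton)
    then have "pminor (I + B\<^sup>T * B) ?T \<le> pminor (I + B\<^sup>T * B) S" using S j by (intro opt) auto
    moreover have "pminor (I + B\<^sup>T * B) ?T = pminor (I + B\<^sup>T * B) S *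
        ((1 - N $$ (i, i)) * (1 + N $$ (j, j)) + N $$ (i, j) * N $$ (j, i))"
      unfolding pminor_def KQ by (rule det_exchange[OF Q N N_eq i i' j])
    ultimately have "det A * ((1 - N $$ (i, i)) * (1 + N $$ (j, j)) + N $$ (i, j) * N $$ (j, i)) \<le> det A * 1"
      by (simp add: detA)
    then have "(1 - N $$ (i, i)) * (1 + N $$ (j, j)) + N $$ (i, j) * N $$ (j, i) \<le> 1"
      using detA_pos by (simp only: mult_le_cancel_left_pos)
    moreover have "0 \<le> N $$ (i, j) * N $$ (j, i)" using Nsym[OF i' j(2)] by simp
    ultimately have "N $$ (j, j) - N $$ (i, i) \<le> N $$ (i, i) * N $$ (j, j)" by (simp add: algebra_simps)
    also have "\<dots> \<le> \<sigma> / (1 + \<sigma>) * \<sigma>"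
      using Nle'[OF i] Nle[OF j(2)] N0[OF i'] N0[OF j(2)] \<sigma>(1)
      by (intro mult_mono) (auto simp: pos_le_divide_eq mult.commute)
    finally show ?thesis by (simp add: \<delta>_def power2_eq_square)
  qed
  \<comment> \<open>The smallest leverage in \<open>S\<close> is the baseline: \<open>x\<close> and
    \<open>e\<close> have equal sums, so it cancels, and what remains is at most
    \<open>\<delta>\<close> per unit of weight outside \<open>S\<close>.\<close>
  define m where "m = Min ((\<lambda>i. N $$ (i, i)) ` S)"
  have Sne: "S \<noteq> {}" using S by auto
  have "m \<in> (\<lambda>i. N $$ (i, i)) ` S"
    unfolding m_def by (rule Min_in) (use fin Sne in auto)
  then obtain i0 where i0: "i0 \<in> S" "m = N $$ (i0, i0)" by blast
  have m_le: "m \<le> N $$ (i, i)" if "i \<in> S" for i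
    unfolding m_def using fin that by (intro Min_le) auto
  define c where "c = real (min (card S) (n - card S)) * \<delta>"
  have c0: "0 \<le> c" using \<delta>0 by (simp add: c_def)
  have npos: "0 < real n" using S(2) n by simp
  \<comment> \<open>The trace bound \<open>n + c\<close> relative to \<open>n\<close>: dividing
    \<open>F\<close> by \<open>t\<close> brings the trace down to \<open>n\<close>, at the price of
    \<open>n ln t\<close>.\<close>
  define t where "t = 1 + c / real n"
  have t: "0 < t" "real n * t = real n + c" using c0 npos by (auto simp: t_def field_simps)
  have bound: "ln (det (info_mat B (($) x))) \<le> ln (det A) + real n * ln t"
    if x: "x \<in> capped_simplex n (card S)" for x
  proof -
    note xs = capped_simplexD[OF x]
    have sum_e: "(\<Sum>i<n. e i) = real (card S)"
    proof -
      have "(\<Sum>i<n. e i) = (\<Sum>i\<in>S. 1)"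
        unfolding e_def using S by (intro sum.mono_neutral_cong_right) auto
      then show ?thesis by simp
    qed
    define \<tau> where "\<tau> = (\<Sum>i<n. if i \<in> S then 0 else x $ i)"
    have "\<tau> \<le> (\<Sum>i<n. x $ i)" unfolding \<tau>_def using xs by (intro sum_mono) auto
    moreover have "\<tau> \<le> (\<Sum>i<n. 1 - e i)" unfolding \<tau>_def e_def using xs by (intro sum_mono) auto
    ultimately have \<tau>: "\<tau> \<le> real (min (card S) (n - card S))"
      using xs(3) sum_e n by (simp add: sum_subtractf of_nat_diff)
    have "mtrace (info_mat B (($) x) * F) = mtrace F + (\<Sum>i<n. N $$ (i, i) * x $ i)"
      unfolding N_def by (rule mtrace_info_mat[OF B F(1)])
    moreover have "real n = mtrace F + (\<Sum>i<n. N $$ (i, i) * e i)"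
      using mtrace_info_mat[OF B F(1), of e] F(3) by (simp add: N_def A_def)
    ultimately have "mtrace (info_mat B (($) x) * F) = real n + (\<Sum>i<n. N $$ (i, i) * (x $ i - e i))"
      by (simp add: right_diff_distrib sum_subtractf)
    also have "(\<Sum>i<n. N $$ (i, i) * (x $ i - e i)) \<le>
        (\<Sum>i<n. m * (x $ i - e i) + \<delta> * (if i \<in> S then 0 else x $ i))"
    proof (intro sum_mono)
      fix i assume "i \<in> {..<n}"
      then have i: "i < n" by simp
      show "N $$ (i, i) * (x $ i - e i) \<le> m * (x $ i - e i) + \<delta> * (if i \<in> S then 0 else x $ i)"
      proof (cases "i \<in> S")
        case True
        have "N $$ (i, i) * (x $ i - 1) \<le> m * (x $ i - 1)"
          using m_le[OF True] xs(2)[OF i] by (intro mult_right_mono_neg) auto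
        then show ?thesis using True by (simp add: e_def)
      next
        case False
        have "N $$ (i, i) * x $ i \<le> (m + \<delta>) * x $ i"
          using diff[OF i0(1) False i] i0 xs(1)[OF i] by (intro mult_right_mono) auto
        then show ?thesis using False by (simp add: e_def distrib_right)
      qed
    qed
    also have "\<dots> = \<delta> * \<tau>"
      by (simp add: sum.distrib sum_distrib_left[symmetric] sum_subtractf xs(3) sum_e \<tau>_def)
    also have "\<dots> \<le> c" unfolding c_def using mult_left_mono[OF \<tau> \<delta>0] by (simp add: mult.commute)
    finally have tr: "mtrace (info_mat B (($) x) * F) \<le> real n * t" using t by simp
    have Ft: "(1 / t) \<cdot>\<^sub>m F \<in> M\<^sub>n" "pos_def_mat ((1 / t) \<cdot>\<^sub>m F)"
    proof -
      show "(1 / t) \<cdot>\<^sub>m F \<in> M\<^sub>n" using F by simp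
      have "det F \<noteq> 0" using pos_def_det_pos[OF F(1,2)] by simp
      then show "pos_def_mat ((1 / t) \<cdot>\<^sub>m F)"
        using psd_smult[OF pos_def_imp_psd[OF F(1,2)], of "1 / t"] t F(1)
        by (intro psd_det_imp_pos_def) auto
    qed
    have "ln (det (info_mat B (($) x))) + ln (det ((1 / t) \<cdot>\<^sub>m F)) \<le>
        mtrace (info_mat B (($) x) * ((1 / t) \<cdot>\<^sub>m F)) - real n"
      using xs B by (intro ln_det_le_trace_mult Ft pos_def_info_mat) auto
    also have "mtrace (info_mat B (($) x) * ((1 / t) \<cdot>\<^sub>m F)) = mtrace (info_mat B (($) x) * F) / t"
      using B F by (simp add: mult_smult_distrib[of _ n n _ n] mtrace_smult[of _ n])
    also have "\<dots> \<le> real n" using tr t by (simp add: pos_divide_le_eq)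
    also have "ln (det ((1 / t) \<cdot>\<^sub>m F)) = - real n * ln t - ln (det A)"
      using F(1) t pos_def_det_pos[OF F(1,2)] by (simp add: ln_mult ln_realpow ln_div lnF)
    finally show ?thesis by simp
  qed
  have t_eq: "t = 1 + real (min (card S) (n - card S)) * \<sigma>\<^sup>2 / (real n * (1 + \<sigma>))"
    by (simp add: t_def c_def \<delta>_def mult.commute)
  have "dopt_relax B (card S) \<le> ln (det A) + real n * ln t"
    unfolding dopt_relax_def
    by (rule max_on_capped_simplex(2)[OF n ln_det_info_affine_majorant[OF B]]) (use bound in auto)
  then show ?thesis unfolding detA t_eq .
qed

text \<open>Jacobi's identity: multiplying the padded inverse by \<open>K\<close> turns the rows
  outside \<open>S\<close> into unit rows and leaves the rows of \<open>K\<close> on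
  \<open>S\<close>.\<close>

lemma pminor_inverse:
  assumes K: "K \<in> M\<^sub>n" "K' \<in> M\<^sub>n" "K' * K = I"
  shows "pminor K' (- S) * det K = pminor K S"
proof -
  have "(I + ind (- S) * (K' - I)) * K = I + ind S * (K - I)"
  proof -
    have "(I + ind (- S) * (K' - I)) * K = K + (ind (- S) * (K' * K) - ind (- S) * K)"
      using K(1,2) by (simp add: sq_simps)
    also have "\<dots> = I + ind S * (K - I)"
      unfolding K(3) using K(1)
      by (intro entries_eqI) (simp_all add: sq_simps one_minus_ind[symmetric] del: index_mult_mat(1))
    finally show ?thesis .
  qed
  then show ?thesis
    unfolding pminor_def using K(1,2) by (simp flip: det_mult[of _ n])
qed

text \<open>The complement \<open>- S\<close> contains all large naturals; \<open>ind\<close> looks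
  only below \<open>n\<close>.\<close>

lemma pminor_restrict: "pminor K (S \<inter> {..<n}) = pminor K S"
proof -
  have "ind (S \<inter> {..<n}) = ind S" unfolding ind_def by (rule mat_diag_cong) auto
  then show ?thesis by (simp add: pminor_def)
qed

lemma inv_mat_inverse:
  assumes A: "A \<in> M\<^sub>n" "det A \<noteq> 0"
  shows "inv_mat A \<in> M\<^sub>n" "A * inv_mat A = I" "inv_mat A * A = I"
proof -
  have "A \<in> Units (ring_mat TYPE(real) n ())" using det_non_zero_imp_unit[OF A] .
  then obtain B where B: "mat_inverse A = Some B"
    using mat_inverse(1)[OF A(1), where b = "()"] by (cases "mat_inverse A") auto
  from mat_inverse(2)[OF A(1) B] show "inv_mat A \<in> M\<^sub>n" "A * inv_mat A = I" "inv_mat A * A = I"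
    by (auto simp: inv_mat_def B)
qed

lemma inverse_unique:
  assumes "A \<in> M\<^sub>n" "F \<in> M\<^sub>n" "F' \<in> M\<^sub>n" "F * A = I" "A * F' = I"
  shows "F = F'"
proof -
  have "F = F * (A * F')" using assms by simp
  also have "\<dots> = F * A * F'" using assms(1-3) by (simp add: sq_simps)
  finally show ?thesis using assms by simp
qed

lemma pos_def_inv_mat:
  assumes A: "A \<in> M\<^sub>n" "pos_def_mat A"
  shows "pos_def_mat (inv_mat A)"
proof -
  have dA: "det A \<noteq> 0" using pos_def_det_pos[OF A] by simp
  obtain F where F: "F \<in> M\<^sub>n" "pos_def_mat F" "A * F = I"
    by (rule pos_def_inverse[OF A])
  have "inv_mat A = F"
    by (rule inverse_unique[OF A(1) _ F(1) _ F(3)]) (use inv_mat_inverse[OF A(1) dA] in auto)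
  then show ?thesis using F by simp
qed

lemma pd_sqrt_props:
  assumes A: "A \<in> M\<^sub>n" "pos_def_mat A"
  shows "pd_sqrt A \<in> M\<^sub>n" "pos_def_mat (pd_sqrt A)" "pd_sqrt A * pd_sqrt A = A"
proof -
  obtain R where R: "R \<in> M\<^sub>n" "pos_def_mat R" "R * R = A"
    by (rule pos_def_sqrt_exists[OF A])
  have "pd_sqrt A = R"
    unfolding pd_sqrt_def
  proof (rule the_equality)
    show "R \<in> carrier_mat (dim_row A) (dim_row A) \<and> pos_def_mat R \<and> R * R = A"
      using A R by auto
    show "R' = R" if "R' \<in> carrier_mat (dim_row A) (dim_row A) \<and> pos_def_mat R' \<and> R' * R' = A" for R'
    proof (rule pos_def_sqrt_unique[OF _ _ R(1,2)])
      show "R' \<in> M\<^sub>n" using that A(1) by (simp only: carrier_matD)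
      show "pos_def_mat R'" "R' * R' = R * R" using that unfolding R(3) by blast+
    qed
  qed
  then show "pd_sqrt A \<in> M\<^sub>n" "pos_def_mat (pd_sqrt A)" "pd_sqrt A * pd_sqrt A = A" using R by auto
qed

end

section \<open>Proof of the bounds\<close>

text \<open>Conjugation by the root \<open>R\<close> of the inverse turns \<open>C\<close> into the
  identity, and Sylvester's identity passes from size \<open>d\<close> to size \<open>n\<close>. The
  free middle factor \<open>D\<close> lets one formula serve subsets as well as the full sum
  \<open>C + A A^T\<close>.\<close>

lemma whitened_props:
  assumes C: "C \<in> carrier_mat d d" "pos_def_mat C" and A: "A \<in> carrier_mat d n"
  shows "whitened C A \<in> carrier_mat d n"
    and "(whitened C A)\<^sup>T * whitened C A = A\<^sup>T * inv_mat C * A"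
    and "D \<in> carrier_mat n n \<Longrightarrow>
      det (C + A * D * A\<^sup>T) = det C * det (1\<^sub>m n + D * ((whitened C A)\<^sup>T * whitened C A))"
proof -
  interpret square_dim d .
  have dC: "det C \<noteq> 0" using pos_def_det_pos[OF C] by simp
  note inv = inv_mat_inverse[OF C(1) dC]
  define R where "R = pd_sqrt (inv_mat C)"
  have R: "R \<in> M\<^sub>n" "pos_def_mat R" "R * R = inv_mat C"
    using pd_sqrt_props[OF inv(1) pos_def_inv_mat[OF C]] by (auto simp: R_def)
  have RT: "R\<^sup>T = R" using R by (simp add: pos_def_mat_def)
  define B where "B = whitened C A"
  have B_eq: "B = R * A" by (simp add: B_def whitened_def R_def)
  show B: "whitened C A \<in> carrier_mat d n" using R A by (simp add: whitened_def R_def[symmetric])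
  show "(whitened C A)\<^sup>T * whitened C A = A\<^sup>T * inv_mat C * A"
    unfolding B_def[symmetric] B_eq R(3)[symmetric] using R(1) A RT
    by (simp add: transpose_mult[of _ d d _ n] assoc_mult_mat[of _ n d _ d _ n]
        assoc_mult_mat[of _ n d _ d _ d] assoc_mult_mat[of _ d d _ d _ n])
  show "det (C + A * D * A\<^sup>T) = det C * det (1\<^sub>m n + D * ((whitened C A)\<^sup>T * whitened C A))"
    if D: "D \<in> carrier_mat n n"
  proof -
    \<comment> \<open>Moving the outer \<open>R\<close> to the other side as an inverse gives
      \<open>R C R = I\<close> without commuting \<open>R\<close> and \<open>C\<close>.\<close>
    have "R * (R * C) = I" using R C inv(3) by (simp flip: assoc_mult_mat[of R d d R d C d])
    then have "(R * C) * R = I"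
      using R C by (intro left_inverse_imp_right_inverse[of R "R * C"]) auto
    then have RCR: "R * C * R = I" .
    have AD: "A * D * A\<^sup>T \<in> M\<^sub>n" using A D by simp
    have RADR: "R * (A * D * A\<^sup>T) * R = B * (D * B\<^sup>T)"
    proof -
      have "B\<^sup>T = A\<^sup>T * R" unfolding B_eq using R(1) A RT by (simp add: transpose_mult[of _ d d _ n])
      then show ?thesis unfolding B_eq using R(1) A D
        by (simp add: assoc_mult_mat[of _ d d _ n _ d] assoc_mult_mat[of _ d n _ n _ d]
            assoc_mult_mat[of _ d n _ d _ d] assoc_mult_mat[of _ n n _ d _ d] assoc_mult_mat[of _ d d _ d _ d]
            assoc_mult_mat[of _ d d _ n _ n])
    qed
    have "R * (C + A * D * A\<^sup>T) * R = I + B * (D * B\<^sup>T)"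
      unfolding RADR[symmetric] RCR[symmetric] using R(1) C(1) AD by (simp add: sq_simps)
    from arg_cong[OF this, of det]
    have "det R * det R * det (C + A * D * A\<^sup>T) = det (I + B * (D * B\<^sup>T))"
      using R(1) C(1) AD by (simp add: det_mult[of _ d] mult_ac)
    also have "\<dots> = det (1\<^sub>m n + (D * B\<^sup>T) * B)"
      using B D by (intro det_one_plus_mult_comm[of _ d n]) (auto simp: B_def)
    also have "(D * B\<^sup>T) * B = D * (B\<^sup>T * B)"
      using B D by (simp add: assoc_mult_mat[of _ n n _ d _ n] B_def)
    finally have "det R * det R * det (C + A * D * A\<^sup>T) = det (1\<^sub>m n + D * (B\<^sup>T * B))" .
    moreover have "det C * (det R * det R) = 1"
      using arg_cong[OF R(3), of det] R(1) det_mult_inverse[OF C(1) inv(1,2)] by (simp add: det_mult[of _ d])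
    ultimately show ?thesis unfolding B_def by (metis mult.assoc mult.left_neutral)
  qed
qed

theorem corollary14:
  fixes C A V W :: "real mat" and d n s :: nat
  assumes "0 < d"
    and "C \<in> carrier_mat d d" and "pos_def_mat C"
    and "A \<in> carrier_mat d n"
    and "0 < s" and "s < n"
    and "is_cholesky V (1\<^sub>m n + (whitened C A)\<^sup>T * whitened C A)"
    and "is_cholesky W (inv_mat (1\<^sub>m n + (whitened C A)\<^sup>T * whitened C A))"
  shows "z_opt C A s \<le> z_R C A s \<and>
      z_R C A s \<le> z_opt C A s + real n *
        ln (1 + real (min s (n - s)) * (sigma_max C A)\<^sup>2 / (real n * (1 + sigma_max C A))) \<and>
      z_opt C A s \<le> z_M C V s \<and>
      z_M C V s \<le> z_opt C A s + real s *
        ln (real s - (real s - 1) / real s * max (2 * real s - real n) 0) \<and>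
      z_opt C A s \<le> z_Mc C A W s \<and>
      z_Mc C A W s \<le> z_opt C A s + (real n - real s) *
        ln (real n - real s - (real n - real s - 1) / (real n - real s) *
          max (real n - 2 * real s) 0)"
proof -
  interpret square_dim n .
  note C = assms(2,3) and A = assms(4) and s = assms(5,6)
  define B where "B = whitened C A"
  define \<Gamma> where "\<Gamma> = B\<^sup>T * B"
  define K where "K = I + \<Gamma>"
  note wh = whitened_props[OF C A, folded B_def, folded \<Gamma>_def]
  have B: "B \<in> carrier_mat d n" by (rule wh)
  have \<Gamma>: "\<Gamma> \<in> M\<^sub>n" using B by (simp add: \<Gamma>_def)
  have K: "K \<in> M\<^sub>n" using \<Gamma> by (simp add: K_def)
  have K\<Gamma>: "K - I = \<Gamma>" using \<Gamma> unfolding K_def by (intro entries_eqI) auto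
  have psd\<Gamma>: "psd_mat \<Gamma>"
  proof -
    have "0 \<le> v \<bullet> (\<Gamma> *\<^sub>v v)" if v: "v \<in> carrier_vec n" for v
    proof -
      have "v \<bullet> (\<Gamma> *\<^sub>v v) = v \<bullet> (B\<^sup>T *\<^sub>v (B *\<^sub>v v))"
        unfolding \<Gamma>_def using B v by (simp add: assoc_mult_mat_vec[of _ n d _ n])
      also have "\<dots> = (B\<^sup>T *\<^sub>v (B *\<^sub>v v)) \<bullet> v"
        using B v by (intro comm_scalar_prod[of _ n]) auto
      also have "\<dots> = (B *\<^sub>v v) \<bullet> (B *\<^sub>v v)"
        using B v by (intro transpose_vec_mult_scalar[of _ d n]) auto
      finally show ?thesis using scalar_prod_self_nonneg by simp
    qed
    then show ?thesis using B \<Gamma> by (simp add: psd_mat_def \<Gamma>_def transpose_mult[of _ n d _ n])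
  qed
  have pdK: "pos_def_mat K" unfolding K_def by (intro pos_def_add_psd pos_def_one psd\<Gamma>) auto
  have detK: "0 < det K" by (rule pos_def_det_pos[OF K pdK])
  have detC: "0 < det C" by (rule square_dim.pos_def_det_pos[OF C])
  \<comment> \<open>\<open>B\<close> has \<open>d\<close> rows, while the bounds are stated for
    matrices of size \<open>n\<close>; the root of \<open>\<Gamma>\<close> has the same Gram matrix
    and hence the same determinants.\<close>
  obtain B0 where B0: "B0 \<in> M\<^sub>n" "B0\<^sup>T = B0" "B0 * B0 = \<Gamma>"
    by (rule psd_sqrt_exists[OF psd\<Gamma>])
  have B0\<Gamma>: "B0\<^sup>T * B0 = \<Gamma>" using B0 by simp
  have V: "V \<in> M\<^sub>n" "V\<^sup>T * V = K"
    using assms(7) K by (auto simp: is_cholesky_def B_def \<Gamma>_def K_def)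
  have detV: "det V \<noteq> 0"
    using arg_cong[OF V(2), of det] V(1) detK by (auto simp: det_mult[of _ n] det_transpose[of _ n])
  note invK = inv_mat_inverse[OF K less_imp_neq[OF detK, symmetric]]
  have W: "W \<in> M\<^sub>n" "W\<^sup>T * W = inv_mat K"
    using assms(8) invK(1) by (auto simp: is_cholesky_def B_def \<Gamma>_def K_def)
  have detW: "det W \<noteq> 0"
    using arg_cong[OF W(2), of det] W(1) det_mult_inverse[OF K invK(1,2)]
    by (auto simp: det_mult[of _ n] det_transpose[of _ n])
  have pmin_pos: "0 < pminor K S" if "S \<subseteq> {..<n}" for S
    using pminor_gram_pos[OF V(1) detV that] by (simp add: V(2))
  have pmin_compl: "pminor K S = pminor (inv_mat K) ({..<n} - S) * det K" for S
    using pminor_inverse[OF K invK(1,3), of S] pminor_restrict[of "inv_mat K" "- S"]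
    by (simp add: Diff_eq Int_commute)
  have obj: "det (C + outer_sum A S (\<lambda>_. 1)) = det C * pminor K S" if "S \<subseteq> {..<n}" for S
    using outer_sum_eq[OF A that] wh(3)[OF ind_carrier[of S]]
    by (simp add: pminor_def K\<Gamma> ind_def)
  define \<S> where "\<S> = {S. S \<subseteq> {..<n} \<and> card S = s}"
  have fin\<S>: "finite \<S>" by (rule finite_subset[of _ "Pow {..<n}"]) (auto simp: \<S>_def)
  have "{..<s} \<in> \<S>" using s by (auto simp: \<S>_def)
  define z where "z = Max ((\<lambda>S. ln (det C * pminor K S)) ` \<S>)"
  have z: "z_opt C A s = z"
  proof -
    have "{S. S \<subseteq> {0..<dim_col A} \<and> card S = s} = \<S>"
      using A by (auto simp: \<S>_def)
    moreover have "(\<lambda>S. ln (det (C + outer_sum A S (\<lambda>_. 1)))) ` \<S> = (\<lambda>S. ln (det C * pminor K S)) ` \<S>"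
      by (intro image_cong refl) (auto simp: obj \<S>_def)
    ultimately show ?thesis by (simp add: z_opt_def z_def)
  qed
  have "z \<in> (\<lambda>S. ln (det C * pminor K S)) ` \<S>"
    unfolding z_def using fin\<S> \<open>{..<s} \<in> \<S>\<close> by (intro Max_in) auto
  then obtain S where S: "S \<in> \<S>" "z = ln (det C * pminor K S)" by blast
  have S': "S \<subseteq> {..<n}" "card S = s" using S by (auto simp: \<S>_def)
  have z_eq: "z = ln (det C) + ln (pminor K S)"
    unfolding S(2) using detC pmin_pos[OF S'(1)] by (simp add: ln_mult)
  have opt: "pminor K T \<le> pminor K S" if "T \<subseteq> {..<n}" "card T = s" for T
  proof -
    have "ln (det C * pminor K T) \<le> z"
      unfolding z_def using that fin\<S> by (intro Max_ge) (auto simp: \<S>_def)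
    then show ?thesis
      unfolding S(2) using detC pmin_pos[OF that(1)] pmin_pos[OF S'(1)] by simp
  qed
  let ?T = "{..<n} - S"
  have T: "?T \<subseteq> {..<n}" "card ?T = n - s"
    using S' finite_subset[OF S'(1)] by (auto simp: card_Diff_subset)
  \<comment> \<open>Complementation matches the two families of subsets and relates their minors by
    the constant positive factor \<open>det K\<close>, so optimality carries over.\<close>
  have optc: "pminor (inv_mat K) T' \<le> pminor (inv_mat K) ?T" if "T' \<subseteq> {..<n}" "card T' = card ?T" for T'
  proof -
    have "card ({..<n} - T') = s"
      using that T s finite_subset[OF that(1)] by (simp add: card_Diff_subset)
    then have "pminor K ({..<n} - T') \<le> pminor K S" by (intro opt) auto
    moreover have "{..<n} - ({..<n} - T') = T'" using that by auto
    ultimately show ?thesis using detK by (simp add: pmin_compl)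
  qed
  have lnc: "ln (det C * det K) + ln (pminor (inv_mat K) ?T) = z"
  proof -
    have "0 < pminor (inv_mat K) ?T"
      using pminor_gram_pos[OF W(1) detW T(1)] by (simp add: W(2))
    then show ?thesis unfolding z_eq pmin_compl[of S] using detC detK by (simp add: ln_mult)
  qed
  have zM: "z_M C V s = ln (det C) + mesp_relax V s"
    using V(1) by (simp add: z_M_def mesp_relax_def)
  have zMc: "z_Mc C A W s = ln (det C * det K) + mesp_relax W (n - s)"
  proof -
    have "det (C + A * I * A\<^sup>T) = det C * det (I + I * \<Gamma>)" by (rule wh(3)) simp
    then have "det (C + A * A\<^sup>T) = det C * det K" using A \<Gamma> by (simp add: K_def)
    then show ?thesis using W(1) by (simp add: z_Mc_def mesp_relax_def)
  qed
  have zR: "z_R C A s = ln (det C) + dopt_relax B0 s"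
  proof -
    \<comment> \<open>Sylvester's identity is used twice: from size \<open>d\<close> to
      \<open>\<Gamma>\<close>, and from \<open>\<Gamma>\<close> back to \<open>B0\<close>.\<close>
    have "det (1\<^sub>m d + outer_sum B {0..<n} (($) x)) = det (info_mat B0 (($) x))" for x
    proof -
      have "mat_diag n (\<lambda>i. if i \<in> {0..<n} then x $ i else 0) = mat_diag n (($) x)"
        by (rule mat_diag_cong) auto
      then have "outer_sum B {0..<n} (($) x) = B * mat_diag n (($) x) * B\<^sup>T"
        using outer_sum_eq[OF B, of "{0..<n}" "($) x"] by (simp add: atLeast0LessThan)
      also have "\<dots> = B * (mat_diag n (($) x) * B\<^sup>T)"
        using B by (simp add: assoc_mult_mat[of _ d n _ n _ d])
      finally have "det (1\<^sub>m d + outer_sum B {0..<n} (($) x)) = det (I + mat_diag n (($) x) * B\<^sup>T * B)"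
        using B det_one_plus_mult_comm[OF B mult_carrier_mat[of "mat_diag n (($) x)" n n "B\<^sup>T" d]]
        by simp
      also have "mat_diag n (($) x) * B\<^sup>T * B = mat_diag n (($) x) * \<Gamma>"
        unfolding \<Gamma>_def using B by (simp add: assoc_mult_mat[of _ n n _ d _ n])
      finally show ?thesis using det_info_mat[OF B0(1)] B0\<Gamma> by simp
    qed
    then show ?thesis using A assms(2) by (simp add: z_R_def dopt_relax_def B_def[symmetric])
  qed
  have sigma: "sigma_max C A = Max ((\<lambda>i. \<Gamma> $$ (i, i)) ` {0..<n})"
  proof -
    have "inv_mat C \<in> carrier_mat d d"
      using square_dim.inv_mat_inverse(1)[OF C(1)] detC by simp
    then have "col A i \<bullet> (inv_mat C *\<^sub>v col A i) = \<Gamma> $$ (i, i)" if "i < n" for i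
      using square_dim.quad_form_entry[OF A _ that, of "inv_mat C"] by (simp add: wh(2))
    then show ?thesis using A unfolding sigma_max_def by (intro arg_cong[of _ _ Max] image_cong) auto
  qed
  have \<sigma>_ge: "\<Gamma> $$ (i, i) \<le> sigma_max C A" if "i < n" for i
    unfolding sigma using that by (intro Max_ge) auto
  have "0 \<le> \<Gamma> $$ (0, 0)" using psd_diag_entry[OF psd\<Gamma>, of I n 0] \<Gamma> s by simp
  then have \<sigma>0: "0 \<le> sigma_max C A" using \<sigma>_ge[of 0] s by simp
  have R1: "ln (pminor K S) \<le> dopt_relax B0 s"
    using dopt_relax_lower[OF B0(1) S'(1)] by (simp add: B0\<Gamma> K_def[symmetric] S'(2))
  have R2: "dopt_relax B0 s \<le> ln (pminor K S) + real n *
      ln (1 + real (min s (n - s)) * (sigma_max C A)\<^sup>2 / (real n * (1 + sigma_max C A)))"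
    using dopt_relax_upper[OF B0(1) S'(1) _ _ _ \<sigma>0, unfolded B0\<Gamma> K_def[symmetric] S'(2)] s opt \<sigma>_ge by simp
  have M1: "ln (pminor K S) \<le> mesp_relax V s"
    using mesp_relax_lower[OF V(1) detV S'(1)] s by (simp add: V(2) S'(2))
  have M2: "mesp_relax V s \<le> ln (pminor K S) + real s *
      ln (real s - (real s - 1) / real s * max (2 * real s - real n) 0)"
    using mesp_relax_upper[OF V(1) detV S'(1), unfolded V(2) S'(2)] s opt by simp
  have c1: "ln (pminor (inv_mat K) ?T) \<le> mesp_relax W (n - s)"
    using mesp_relax_lower[OF W(1) detW T(1)] s by (simp add: W(2) T(2))
  have c2: "mesp_relax W (n - s) \<le> ln (pminor (inv_mat K) ?T) + (real n - real s) *
      ln (real n - real s - (real n - real s - 1) / (real n - real s) * max (real n - 2 * real s) 0)"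
  proof -
    \<comment> \<open>Matches the positive part of the general bound at cardinality
      \<open>n - s\<close> with the stated one.\<close>
    have "2 * (real n - real s) - real n = real n - 2 * real s" by simp
    then show ?thesis
      using mesp_relax_upper[OF W(1) detW T(1), unfolded W(2) T(2)] s optc T(2) by (simp add: of_nat_diff)
  qed
  show ?thesis
    unfolding z zM zMc zR using R1 R2 M1 M2 c1 c2 z_eq lnc by (intro conjI) linarith+
qed

end
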